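(* Let $r\ge 3$ be an integer, $d>0$ a real number, $(d_n)_{n\in\mathbb{N}}$ a sequence of reals with $d_n\to d$, and $p=p(n)=d_n/\binom{n-1}{r-1}$. Let $H=H^r(n,p)$, and let $v(C_H)$ and $e(C_H)$ denote the numbers of vertices and edges, respectively, of the loose core $C_H$ of $H$. Then with high probability $$v(C_H)=(\alpha+o(1))\,n \qquad\text{and}\qquad e(C_H)=(\beta+o(1))\,n,$$ where, with $\rho_*=\rho_*(r,d)$ as defined in the context, $$\alpha=\rho_*\left(1-d(r-1)(1-\rho_* )^{r-1}\right),\qquad \beta=\frac{d}{r}\left(1-(1-\rho_* )^r-r\rho_*(1-\rho_* )^{r-1}\right).$$
   Context: Asymptotics are as $n\to\infty$; "with high probability" means with probability tending to $1$ as $n\to\infty$. $H^r(n,p)$ is the random $r$-uniform hypergraph on vertex set $[n]$ in which each $r$-subset of $[n]$ is an edge independently with probability $p$. For an $r$-uniform hypergraph $H$, $d_H(v)$ is the number of edges containing $v$, and $\delta(H)$ is the minimum of $d_H(v)$ over vertices $v$. The connection number of an edge $e$ is $\kappa_H(e)=|\{v\in e: d_H(v)\ge 2\}|$, and $\kappa(H)=\min_{e\in E(H)}\kappa_H(e)$. The loose core $C_H$ of $H$ is the maximal (unique) subhypergraph $H'$ of $H$ with $\delta(H')\ge 1$ and $\kappa(H')\ge 2$; if no such subhypergraph exists, the loose core is the empty hypergraph (no vertices, no edges). Let $F(x)=\exp(-d(1-x^{r-1}))$ for $x\ge 0$; $\rho_*=\rho_*(r,d)$ is the largest solution $\rho$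 of $1-\rho=F(1-\rho)$ (note $\rho=0$ is always a solution). *)

theory Defs
  imports "HOL-Probability.Probability" "HOL-Library.Landau_Symbols"
begin

type_synonym 'a hypergraph = "'a set \<times> 'a set set"

abbreviation (input) verts :: "'a hypergraph \<Rightarrow> 'a set" where "verts \<equiv> fst"
abbreviation (input) edges :: "'a hypergraph \<Rightarrow> 'a set set" where "edges \<equiv> snd"

definition subhypergraph :: "'a hypergraph \<Rightarrow> 'a hypergraph \<Rightarrow> bool" where
  "subhypergraph K H \<longleftrightarrow>
     verts K \<subseteq> verts H \<and> edges K \<subseteq> edges H \<and> (\<forall>e\<in>edges K. e \<subseteq> verts K)"

definition deg :: "'a hypergraph \<Rightarrow> 'a \<Rightarrow> nat" where
  "deg H v = card {e \<in> edges H. v \<in> e}"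

definition min_deg :: "'a hypergraph \<Rightarrow> nat" where
  "min_deg H = Min (deg H ` verts H)"

definition conn_num :: "'a hypergraph \<Rightarrow> 'a set \<Rightarrow> nat" where
  "conn_num H e = card {v \<in> e. deg H v \<ge> 2}"

definition min_conn_num :: "'a hypergraph \<Rightarrow> nat" where
  "min_conn_num H = Min (conn_num H ` edges H)"

text \<open>The condition that \<open>K\<close> has a vertex keeps the first minimum from being taken over
  the empty set; together with positive minimum degree it gives \<open>K\<close> an edge, so the second
  minimum is meaningful as well.\<close>

definition loose_subhypergraph :: "'a hypergraph \<Rightarrow> 'a hypergraph \<Rightarrow> bool" where
  "loose_subhypergraph H K \<longleftrightarrow>
     subhypergraph K H \<and> verts K \<noteq> {} \<and> min_deg K \<ge> 1 \<and> min_conn_num K \<ge> 2"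

definition maximal_loose_subhypergraph :: "'a hypergraph \<Rightarrow> 'a hypergraph \<Rightarrow> bool" where
  "maximal_loose_subhypergraph H K \<longleftrightarrow>
     loose_subhypergraph H K \<and>
     (\<forall>L. loose_subhypergraph H L \<and> subhypergraph K L \<longrightarrow> L = K)"

definition loose_core :: "'a hypergraph \<Rightarrow> 'a hypergraph" where
  "loose_core H =
     (if \<exists>K. loose_subhypergraph H K then THE K. maximal_loose_subhypergraph H K
      else ({}, {}))"

text \<open>Outside \<open>[0, 1]\<close> the parameter of \<^const>\<open>bernoulli_pmf\<close> is clamped to that
  interval.\<close>

definition random_hypergraph :: "nat \<Rightarrow> nat \<Rightarrow> real \<Rightarrow> nat hypergraph pmf" where
  "random_hypergraph r n p =
     map_pmf (\<lambda>X. ({1..n}, {e. e \<subseteq> {1..n} \<and> card e = r \<and> X e}))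
       (Pi_pmf {e. e \<subseteq> {1..n} \<and> card e = r} False (\<lambda>_. bernoulli_pmf p))"

definition whp :: "(nat \<Rightarrow> 'b pmf) \<Rightarrow> (nat \<Rightarrow> 'b \<Rightarrow> bool) \<Rightarrow> bool" where
  "whp M P \<longleftrightarrow> (\<lambda>n. measure_pmf.prob (M n) {x. P n x}) \<longlonglongrightarrow> 1"

definition F_map :: "nat \<Rightarrow> real \<Rightarrow> real \<Rightarrow> real" where
  "F_map r d x = exp (- d * (1 - x ^ (r - 1)))"

definition rho_star :: "nat \<Rightarrow> real \<Rightarrow> real" where
  "rho_star r d = (GREATEST \<rho>. 1 - \<rho> \<ge> 0 \<and> 1 - \<rho> = F_map r d (1 - \<rho>))"

text \<open>Well-definedness of the loose core and of \<open>\<rho>\<^sub>*\<close>.\<close>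

lemma loose_subhypergraph_iff:
  assumes "finite (verts H)" "finite (edges H)"
  shows "loose_subhypergraph H K \<longleftrightarrow> subhypergraph K H \<and> verts K \<noteq> {} \<and>
    (\<forall>v\<in>verts K. deg K v \<ge> 1) \<and> (\<forall>e\<in>edges K. conn_num K e \<ge> 2)"
proof (cases "subhypergraph K H \<and> verts K \<noteq> {}")
  case True
  then have fin: "finite (verts K)" "finite (edges K)"
    using assms by (auto simp: subhypergraph_def intro: finite_subset)
  have d: "min_deg K \<ge> 1 \<longleftrightarrow> (\<forall>v\<in>verts K. deg K v \<ge> 1)"
    unfolding min_deg_def using True fin by (subst Min_ge_iff) auto
  have "edges K \<noteq> {}" if "\<forall>v\<in>verts K. deg K v \<ge> 1"
    using that True by (auto simp: deg_def)
  moreover have "min_conn_num K \<ge> 2 \<longleftrightarrow> (\<forall>e\<in>edges K. conn_num K e \<ge> 2)" if "edges K \<noteq> {}"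
    unfolding min_conn_num_def using that fin by (subst Min_ge_iff) auto
  ultimately show ?thesis
    using True d by (auto simp: loose_subhypergraph_def)
qed (auto simp: loose_subhypergraph_def)

lemma deg_mono:
  assumes "finite (edges L)" "edges K \<subseteq> edges L"
  shows "deg K v \<le> deg L v"
  unfolding deg_def using assms by (intro card_mono) auto

lemma conn_num_mono:
  assumes "finite (edges L)" "edges K \<subseteq> edges L" "finite e"
  shows "conn_num K e \<le> conn_num L e"
  unfolding conn_num_def using assms deg_mono[OF assms(1,2)]
  by (intro card_mono) (auto intro: order_trans)

lemma loose_subhypergraph_union:
  assumes fin: "finite (verts H)" "finite (edges H)"
    and K: "loose_subhypergraph H K" and L: "loose_subhypergraph H L"
  shows "loose_subhypergraph H (verts K \<union> verts L, edges K \<union> edges L)"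
    (is "loose_subhypergraph H ?U")
proof -
  note KL = K[unfolded loose_subhypergraph_iff[OF fin]] L[unfolded loose_subhypergraph_iff[OF fin]]
  have finU: "finite (edges ?U)"
    using KL fin by (auto simp: subhypergraph_def intro: finite_subset)
  have fine: "finite e" if "e \<in> edges K \<union> edges L" for e
  proof -
    have "e \<subseteq> verts H" using that KL unfolding subhypergraph_def by blast
    then show ?thesis using fin finite_subset by blast
  qed
  have "deg ?U v \<ge> 1" if "v \<in> verts K \<union> verts L" for v
    using that KL deg_mono[OF finU, of K v] deg_mono[OF finU, of L v] by force
  moreover have "conn_num ?U e \<ge> 2" if "e \<in> edges K \<union> edges L" for e
    using that KL conn_num_mono[OF finU _ fine[OF that], of K]
      conn_num_mono[OF finU _ fine[OF that], of L] by force
  moreover have "subhypergraph ?U H" "verts ?U \<noteq> {}"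
    using KL by (auto simp: subhypergraph_def)
  ultimately show ?thesis
    by (auto simp: loose_subhypergraph_iff[OF fin])
qed

lemma ex1_maximal_loose_subhypergraph:
  assumes fin: "finite (verts H)" "finite (edges H)" and ex: "\<exists>K. loose_subhypergraph H K"
  shows "\<exists>!K. maximal_loose_subhypergraph H K"
proof -
  let ?S = "{K. loose_subhypergraph H K}"
  let ?f = "\<lambda>K :: 'a hypergraph. card (verts K) + card (edges K)"
  have "?S \<subseteq> Pow (verts H) \<times> Pow (edges H)"
    by (auto simp: loose_subhypergraph_def subhypergraph_def)
  then have finS: "finite ?S"
    using fin by (meson finite_Pow_iff finite_SigmaI finite_subset)
  define U where "U = (\<Union>(verts ` ?S), \<Union>(edges ` ?S))"
  have gen: "A \<noteq> {} \<Longrightarrow> A \<subseteq> ?S \<Longrightarrow>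
      loose_subhypergraph H (\<Union>(verts ` A), \<Union>(edges ` A))" if "finite A" for A
    using that
  proof (induction rule: finite_induct)
    case (insert K A)
    show ?case
    proof (cases "A = {}")
      case False
      then show ?thesis
        using insert loose_subhypergraph_union[OF fin, of K "(\<Union>(verts ` A), \<Union>(edges ` A))"]
        by simp
    qed (use insert in auto)
  qed simp
  have U: "loose_subhypergraph H U"
    unfolding U_def using gen[OF finS] ex by auto
  have sub: "subhypergraph K U" if "loose_subhypergraph H K" for K
    using that by (auto simp: subhypergraph_def U_def loose_subhypergraph_def)
  have anti: "K = L" if "subhypergraph K L" "subhypergraph L K" for K L :: "'a hypergraph"
    using that by (auto simp: subhypergraph_def prod_eq_iff)
  have "maximal_loose_subhypergraph H U"
    unfolding maximal_loose_subhypergraph_def using U sub anti by blast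
  moreover have "K = U" if "maximal_loose_subhypergraph H K" for K
    using that U sub unfolding maximal_loose_subhypergraph_def by blast
  ultimately show ?thesis by blast
qed

lemma rho_star_greatest:
  assumes "0 \<le> d"
  shows "1 - rho_star r d = F_map r d (1 - rho_star r d)"
    and "0 \<le> rho_star r d" and "rho_star r d \<le> 1"
    and "\<And>\<rho>. \<rho> \<le> 1 \<Longrightarrow> 1 - \<rho> = F_map r d (1 - \<rho>) \<Longrightarrow> \<rho> \<le> rho_star r d"
proof -
  let ?P = "\<lambda>\<rho>. 1 - \<rho> \<ge> 0 \<and> 1 - \<rho> = F_map r d (1 - \<rho>)"
  let ?S = "{\<rho> \<in> {0..1}. 1 - \<rho> - F_map r d (1 - \<rho>) = 0}"
  have c: "continuous_on {0..1} (\<lambda>\<rho>. 1 - \<rho> - F_map r d (1 - \<rho>))"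
    unfolding F_map_def by (intro continuous_intros)
  have "closed ?S"
    using continuous_closed_preimage_constant[OF c, of 0] by simp
  then have comp: "compact ?S"
    using compact_Int_closed[of "{0..1::real}" ?S] by (simp add: Int_def conj_ac cong: conj_cong)
  have z: "0 \<in> ?S" by (simp add: F_map_def)
  obtain m where m: "m \<in> ?S" "\<forall>x\<in>?S. x \<le> m"
    using compact_attains_sup[OF comp] z by blast
  have m0: "0 \<le> m" using m(2) z by blast
  have Pm: "?P m" using m(1) by auto
  have le: "y \<le> m" if "?P y" for y
  proof (cases "y \<ge> 0")
    case True
    then have "y \<in> ?S" using that by auto
    then show ?thesis using m(2) by blast
  qed (use m0 in linarith)
  have "rho_star r d = m"
    unfolding rho_star_def using Pm le by (rule Greatest_equality)
  then show "1 - rho_star r d = F_map r d (1 - rho_star r d)" "0 \<le> rho_star r d" "rho_star r d \<le> 1"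
    "\<And>\<rho>. \<rho> \<le> 1 \<Longrightarrow> 1 - \<rho> = F_map r d (1 - \<rho>) \<Longrightarrow> \<rho> \<le> rho_star r d"
    using Pm m0 le by auto
qed

end

theory Submission
  imports Defs
begin


text \<open>Call a vertex \<open>k\<close>-large if its component has at least \<open>k\<close> vertices. Revealing the edges at one
  vertex after all the others shows that the expected fraction \<open>s\<^sub>k\<close> of \<open>k\<close>-large vertices satisfies
  \<open>s\<^sub>k\<^sub>+\<^sub>1 \<ge> \<phi>(s\<^sub>k) - o(1)\<close> and, for every \<open>m\<close>, \<open>s\<^sub>l \<le> \<phi>(s\<^sub>k) + O(1/m) + o(1)\<close> with \<open>l = mrk + 1\<close> and
  \<open>\<phi>(x) = 1 - F(1 - x)\<close>. One edge changes the number of \<open>k\<close>-large vertices by a bounded amount, so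
  the Efron--Stein inequality gives concentration, and \<open>s\<^sub>k\<close> tends to the largest fixed point \<open>\<rho>\<^sub>*\<close> of
  \<open>\<phi>\<close> as first \<open>n\<close> and then \<open>k\<close> tends to infinity.

  Almost all pairs of \<open>k\<close>-large vertices lie in the same component: by Russo's formula, a slight
  increase of the edge probability would otherwise merge more than the \<open>n/k\<close> available large
  components, and \<open>\<rho>\<^sub>*\<close> is left continuous in \<open>d\<close>. Hence, with \<open>o(n)\<close> exceptions, an edge \<open>e\<close> lies in
  the loose core iff at least two of its vertices are \<open>k\<close>-large in \<open>H - e\<close>, which yields \<open>\<beta>\<close>. Every
  edge outside the core, when removed, splits its component into \<open>r\<close> parts; counting components
  therefore expresses the number of core vertices through numbers of edges, which yields \<open>\<alpha>\<close>.\<close>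

section \<open>Expectations over binomial random subsets\<close>

text \<open>The core itself reacts unboundedly to one edge: closing a single long cycle can put many
  edges into it. Concentration and recursion are therefore used only for counts with a cut-off
  \<open>k\<close>, and the core is compared with these counts deterministically, with error terms
  of small mean.

  An edge or star is always tested against the hypergraph without it, so that the two are
  independent; this is why \<open>X - {e}\<close> appears throughout.

  Deciding whether a vertex lies in the core would involve all its edges jointly. Counting
  components avoids this. In the limit it says that each non-core edge of the giant component, added
  from the core outwards, brings \<open>r - 1\<close> vertices outside the core. Up to
  \<open>o(n)\<close> exceptions these are the edges with exactly one vertex in the giant of
  \<open>H - e\<close>, about \<open>d * \<rho> * (1 - \<rho>) ^ (r - 1) * n\<close> in number,
  which explains the term subtracted from \<rho> in \<alpha>.\<close>

definition Ebin :: "'a set \<Rightarrow> real \<Rightarrow> ('a set \<Rightarrow> real) \<Rightarrow> real" where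
  "Ebin A p f = (\<Sum>X\<in>Pow A. p ^ card X * (1 - p) ^ card (A - X) * f X)"

lemma Ebin_empty [simp]: "Ebin {} p f = f {}"
  by (simp add: Ebin_def)

lemma Ebin_cong:
  assumes "\<And>X. X \<subseteq> A \<Longrightarrow> f X = g X"
  shows "Ebin A p f = Ebin A p g"
  unfolding Ebin_def by (intro sum.cong) (use assms in auto)

lemma Ebin_insert:
  assumes "finite A" "e \<notin> A"
  shows "Ebin (insert e A) p f = p * Ebin A p (\<lambda>X. f (insert e X)) + (1 - p) * Ebin A p f"
proof -
  have inj: "inj_on (insert e) (Pow A)"
    using assms(2) by (auto simp: inj_on_def)
  have "Ebin (insert e A) p f =
      (\<Sum>X\<in>Pow A. p ^ card X * (1 - p) ^ card (insert e A - X) * f X) +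
      (\<Sum>X\<in>insert e ` Pow A. p ^ card X * (1 - p) ^ card (insert e A - X) * f X)"
    unfolding Ebin_def Pow_insert
    by (intro sum.union_disjoint) (use assms in auto)
  also have "(\<Sum>X\<in>Pow A. p ^ card X * (1 - p) ^ card (insert e A - X) * f X) = (1 - p) * Ebin A p f"
    unfolding Ebin_def sum_distrib_left
  proof (intro sum.cong refl)
    fix X assume X: "X \<in> Pow A"
    have "insert e A - X = insert e (A - X)" using X assms by auto
    then have "card (insert e A - X) = Suc (card (A - X))" using assms by simp
    then show "p ^ card X * (1 - p) ^ card (insert e A - X) * f X =
      (1 - p) * (p ^ card X * (1 - p) ^ card (A - X) * f X)" by simp
  qed
  also have "(\<Sum>X\<in>insert e ` Pow A. p ^ card X * (1 - p) ^ card (insert e A - X) * f X)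
     = (\<Sum>X\<in>Pow A. p ^ card (insert e X) * (1 - p) ^ card (insert e A - insert e X) * f (insert e X))"
    by (subst sum.reindex[OF inj]) simp
  also have "\<dots> = p * Ebin A p (\<lambda>X. f (insert e X))"
    unfolding Ebin_def sum_distrib_left
  proof (intro sum.cong refl)
    fix X assume X: "X \<in> Pow A"
    have "insert e A - insert e X = A - X" using X assms by auto
    moreover have "card (insert e X) = Suc (card X)"
      using X assms by (metis PowD card_insert_disjoint finite_subset subsetD)
    ultimately show "p ^ card (insert e X) * (1 - p) ^ card (insert e A - insert e X) * f (insert e X)
       = p * (p ^ card X * (1 - p) ^ card (A - X) * f (insert e X))" by simp
  qed
  finally show ?thesis by simp
qed

lemma Ebin_add: "Ebin A p (\<lambda>X. f X + g X) = Ebin A p f + Ebin A p g"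
  by (simp add: Ebin_def algebra_simps sum.distrib)

lemma Ebin_diff: "Ebin A p (\<lambda>X. f X - g X) = Ebin A p f - Ebin A p g"
  by (simp add: Ebin_def algebra_simps sum_subtractf)

lemma Ebin_cmult: "Ebin A p (\<lambda>X. c * f X) = c * Ebin A p f"
  by (simp add: Ebin_def sum_distrib_left algebra_simps)

lemma Ebin_sum: "Ebin A p (\<lambda>X. \<Sum>i\<in>I. f i X) = (\<Sum>i\<in>I. Ebin A p (f i))"
  unfolding Ebin_def sum_distrib_left by (rule sum.swap)

lemma Ebin_const: "finite A \<Longrightarrow> Ebin A p (\<lambda>X. c) = c"
  by (induction A rule: finite_induct) (simp_all add: Ebin_insert algebra_simps)

lemma Ebin_mono:
  assumes "0 \<le> p" "p \<le> 1" "\<And>X. X \<subseteq> A \<Longrightarrow> f X \<le> g X"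
  shows "Ebin A p f \<le> Ebin A p g"
  unfolding Ebin_def by (intro sum_mono mult_left_mono) (use assms in auto)

lemma Ebin_nonneg:
  assumes "0 \<le> p" "p \<le> 1" "\<And>X. X \<subseteq> A \<Longrightarrow> 0 \<le> f X"
  shows "0 \<le> Ebin A p f"
  unfolding Ebin_def by (intro sum_nonneg mult_nonneg_nonneg) (use assms in auto)

lemma Ebin_le_const:
  assumes "finite A" "0 \<le> p" "p \<le> 1" "\<And>X. X \<subseteq> A \<Longrightarrow> f X \<le> c"
  shows "Ebin A p f \<le> c"
  using Ebin_mono[OF assms(2,3), of A f "\<lambda>_. c"] assms by (simp add: Ebin_const)

lemma Ebin_ge_const:
  assumes "finite A" "0 \<le> p" "p \<le> 1" "\<And>X. X \<subseteq> A \<Longrightarrow> c \<le> f X"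
  shows "c \<le> Ebin A p f"
  using Ebin_mono[OF assms(2,3), of A "\<lambda>_. c" f] assms by (simp add: Ebin_const)

lemma Ebin_abs_le:
  assumes "0 \<le> p" "p \<le> 1"
  shows "\<bar>Ebin A p f\<bar> \<le> Ebin A p (\<lambda>X. \<bar>f X\<bar>)"
proof -
  have "Ebin A p f \<le> Ebin A p (\<lambda>X. \<bar>f X\<bar>)" "Ebin A p (\<lambda>X. (-1) * f X) \<le> Ebin A p (\<lambda>X. \<bar>f X\<bar>)"
    by (auto intro!: Ebin_mono assms)
  then show ?thesis unfolding Ebin_cmult by linarith
qed

section \<open>Independence: splitting, restricting, and removing a single edge\<close>

lemma Ebin_union:
  assumes "finite A" "finite B" "A \<inter> B = {}"
  shows "Ebin (A \<union> B) p f = Ebin A p (\<lambda>X. Ebin B p (\<lambda>Y. f (X \<union> Y)))"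
  using assms
proof (induction A arbitrary: f rule: finite_induct)
  case (insert e A)
  have "Ebin (insert e A \<union> B) p f =
    p * Ebin (A \<union> B) p (\<lambda>X. f (insert e X)) + (1 - p) * Ebin (A \<union> B) p f"
    using insert by (simp add: Ebin_insert)
  also have "\<dots> = p * Ebin A p (\<lambda>X. Ebin B p (\<lambda>Y. f (insert e (X \<union> Y)))) +
      (1 - p) * Ebin A p (\<lambda>X. Ebin B p (\<lambda>Y. f (X \<union> Y)))"
    using insert by simp
  also have "\<dots> = Ebin (insert e A) p (\<lambda>X. Ebin B p (\<lambda>Y. f (X \<union> Y)))"
    using insert by (simp add: Ebin_insert)
  finally show ?case .
qed simp

lemma Ebin_restrict:
  assumes "finite A" "B \<subseteq> A"
  shows "Ebin A p (\<lambda>X. f (X \<inter> B)) = Ebin B p f"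
proof -
  have fin: "finite B" using assms finite_subset by auto
  have "Ebin A p (\<lambda>X. f (X \<inter> B)) = Ebin (B \<union> (A - B)) p (\<lambda>X. f (X \<inter> B))"
    using assms by (simp add: Un_absorb1)
  also have "\<dots> = Ebin B p (\<lambda>X. Ebin (A - B) p (\<lambda>Y. f ((X \<union> Y) \<inter> B)))"
    by (rule Ebin_union) (use assms fin in auto)
  also have "\<dots> = Ebin B p (\<lambda>X. Ebin (A - B) p (\<lambda>Y. f X))"
  proof (intro Ebin_cong)
    fix X Y assume "X \<subseteq> B" "Y \<subseteq> A - B"
    then have "(X \<union> Y) \<inter> B = X" by auto
    then show "f ((X \<union> Y) \<inter> B) = f X" by simp
  qed
  also have "\<dots> = Ebin B p f" using assms by (simp add: Ebin_const)
  finally show ?thesis .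
qed

lemma Ebin_avoid:
  assumes "finite A"
  shows "Ebin A p (\<lambda>X. of_bool (X \<inter> B = {})) = (1 - p) ^ card (A \<inter> B)"
  using assms
proof (induction A rule: finite_induct)
  case (insert e A)
  have "Ebin (insert e A) p (\<lambda>X. of_bool (X \<inter> B = {})) =
     p * Ebin A p (\<lambda>X. of_bool (insert e X \<inter> B = {})) + (1 - p) * Ebin A p (\<lambda>X. of_bool (X \<inter> B = {}))"
    using insert by (simp add: Ebin_insert)
  also have "Ebin A p (\<lambda>X. of_bool (insert e X \<inter> B = {})) =
      Ebin A p (\<lambda>X. of_bool (e \<notin> B) * of_bool (X \<inter> B = {}))"
    by (intro Ebin_cong) auto
  also have "\<dots> = of_bool (e \<notin> B) * (1 - p) ^ card (A \<inter> B)"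
    using insert by (simp add: Ebin_cmult)
  also have "p * (of_bool (e \<notin> B) * (1 - p) ^ card (A \<inter> B)) +
      (1 - p) * Ebin A p (\<lambda>X. of_bool (X \<inter> B = {})) = (1 - p) ^ card (insert e A \<inter> B)"
    using insert by (cases "e \<in> B") (simp_all add: algebra_simps)
  finally show ?case .
qed simp

lemma Ebin_split:
  assumes "finite A" "e \<in> A"
  shows "Ebin A p f = p * Ebin (A - {e}) p (\<lambda>X. f (insert e X)) + (1 - p) * Ebin (A - {e}) p f"
  using Ebin_insert[of "A - {e}" e p f] assms by (simp add: insert_absorb)

text \<open>The presence of \<open>e\<close> is independent of the rest, and \<open>g\<close> sees
  only the rest. This decoupling is behind every estimate of the mean number of edges with some
  property.\<close>

lemma Ebin_member:
  assumes "finite A" "e \<in> A"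
  shows "Ebin A p (\<lambda>X. of_bool (e \<in> X) * g (X - {e})) = p * Ebin (A - {e}) p g"
proof -
  have "Ebin (A - {e}) p (\<lambda>X. of_bool (e \<in> insert e X) * g (insert e X - {e})) = Ebin (A - {e}) p g"
  proof (rule Ebin_cong)
    fix X assume "X \<subseteq> A - {e}"
    then have "insert e X - {e} = X" by auto
    then show "of_bool (e \<in> insert e X) * g (insert e X - {e}) = g X" by simp
  qed
  moreover have "Ebin (A - {e}) p (\<lambda>X. of_bool (e \<in> X) * g (X - {e})) = Ebin (A - {e}) p (\<lambda>X. 0)"
    by (rule Ebin_cong) auto
  ultimately show ?thesis
    by (subst Ebin_split[OF assms]) (use assms in \<open>simp add: Ebin_const\<close>)
qed

lemma Ebin_nonmember:
  assumes "finite A" "e \<in> A"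
  shows "Ebin A p (\<lambda>X. of_bool (e \<notin> X) * g X) = (1 - p) * Ebin (A - {e}) p g"
proof -
  have "Ebin (A - {e}) p (\<lambda>X. of_bool (e \<notin> X) * g X) = Ebin (A - {e}) p g"
    by (rule Ebin_cong) auto
  then show ?thesis
    by (subst Ebin_split[OF assms]) (use assms in \<open>simp add: Ebin_const\<close>)
qed

text \<open>The law of the set without \<open>e\<close> is the law of \<open>X\<close> conditioned
  on the absence of \<open>e\<close>, an event of probability \<open>1 - p \<ge> 1/2\<close>; that
  costs the factor 2. The crude form serves for counts that only have to be shown small.\<close>

lemma Ebin_sum_members_le:
  assumes "finite A" "0 \<le> p" "p \<le> 1/2" "\<And>e X. 0 \<le> g e X"
  shows "Ebin A p (\<lambda>X. \<Sum>e\<in>X. g e (X - {e})) \<le> 2 * p * Ebin A p (\<lambda>X. \<Sum>e\<in>A. g e X)"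
proof -
  have "Ebin A p (\<lambda>X. \<Sum>e\<in>X. g e (X - {e})) = Ebin A p (\<lambda>X. \<Sum>e\<in>A. of_bool (e \<in> X) * g e (X - {e}))"
  proof (rule Ebin_cong)
    fix X assume "X \<subseteq> A"
    then show "(\<Sum>e\<in>X. g e (X - {e})) = (\<Sum>e\<in>A. of_bool (e \<in> X) * g e (X - {e}))"
      using assms(1) by (intro sum.mono_neutral_cong_left) auto
  qed
  also have "\<dots> = (\<Sum>e\<in>A. p * Ebin (A - {e}) p (g e))"
    unfolding Ebin_sum using assms by (intro sum.cong) (auto simp: Ebin_member)
  also have "\<dots> \<le> (\<Sum>e\<in>A. 2 * p * Ebin A p (g e))"
  proof (rule sum_mono)
    fix e assume e: "e \<in> A"
    have nn: "0 \<le> Ebin (A - {e}) p (g e)" by (rule Ebin_nonneg) (use assms in auto)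
    have "(1/2) * Ebin (A - {e}) p (g e) \<le> (1 - p) * Ebin (A - {e}) p (g e)"
      using assms nn by (intro mult_right_mono) auto
    also have "\<dots> = Ebin A p (\<lambda>X. of_bool (e \<notin> X) * g e X)"
      using assms e by (simp add: Ebin_nonmember)
    also have "\<dots> \<le> Ebin A p (g e)"
      using assms by (intro Ebin_mono) auto
    finally have "p * Ebin (A - {e}) p (g e) \<le> p * (2 * Ebin A p (g e))"
      using assms by (intro mult_left_mono) auto
    then show "p * Ebin (A - {e}) p (g e) \<le> 2 * p * Ebin A p (g e)" by simp
  qed
  also have "\<dots> = 2 * p * Ebin A p (\<lambda>X. \<Sum>e\<in>A. g e X)"
    by (simp add: Ebin_sum sum_distrib_left)
  finally show ?thesis .
qed

text \<open>The sharp form, for counts of order \<open>n\<close>: forgetting the state of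
  \<open>e\<close> changes the mean of \<open>g e\<close> by at most \<open>p\<close>, and each of
  the \<open>card A\<close> summands carries the weight \<open>p\<close>.\<close>

lemma Ebin_sum_members_approx:
  assumes "finite A" "0 \<le> p" "p \<le> 1" "\<And>e X. 0 \<le> g e X" "\<And>e X. g e X \<le> 1"
  shows "\<bar>Ebin A p (\<lambda>X. \<Sum>e\<in>X. g e (X - {e})) - p * Ebin A p (\<lambda>X. \<Sum>e\<in>A. g e X)\<bar> \<le> p * p * card A"
proof -
  have "Ebin A p (\<lambda>X. \<Sum>e\<in>X. g e (X - {e})) = Ebin A p (\<lambda>X. \<Sum>e\<in>A. of_bool (e \<in> X) * g e (X - {e}))"
  proof (rule Ebin_cong)
    fix X assume "X \<subseteq> A"
    then show "(\<Sum>e\<in>X. g e (X - {e})) = (\<Sum>e\<in>A. of_bool (e \<in> X) * g e (X - {e}))"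
      using assms(1) by (intro sum.mono_neutral_cong_left) auto
  qed
  also have "\<dots> = (\<Sum>e\<in>A. p * Ebin (A - {e}) p (g e))"
    unfolding Ebin_sum using assms by (intro sum.cong) (auto simp: Ebin_member)
  finally have "Ebin A p (\<lambda>X. \<Sum>e\<in>X. g e (X - {e})) - p * Ebin A p (\<lambda>X. \<Sum>e\<in>A. g e X)
     = (\<Sum>e\<in>A. p * (Ebin (A - {e}) p (g e) - Ebin A p (g e)))"
    by (simp add: Ebin_sum sum_distrib_left sum_subtractf algebra_simps)
  also have "\<bar>\<dots>\<bar> \<le> (\<Sum>e\<in>A. \<bar>p * (Ebin (A - {e}) p (g e) - Ebin A p (g e))\<bar>)"
    by (rule sum_abs)
  also have "\<dots> \<le> (\<Sum>e\<in>A. p * p)"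
  proof (rule sum_mono)
    fix e assume e: "e \<in> A"
    have bd: "0 \<le> Ebin (A - {e}) p h \<and> Ebin (A - {e}) p h \<le> 1" if "\<And>X. 0 \<le> h X" "\<And>X. h X \<le> 1" for h
      using assms that by (auto intro!: Ebin_nonneg Ebin_le_const)
    have "\<bar>Ebin (A - {e}) p (g e) - Ebin (A - {e}) p (\<lambda>X. g e (insert e X))\<bar> \<le> 1"
      using bd[of "g e"] bd[of "\<lambda>X. g e (insert e X)"] assms by (simp add: abs_le_iff)
    moreover have "Ebin (A - {e}) p (g e) - Ebin A p (g e) =
        p * (Ebin (A - {e}) p (g e) - Ebin (A - {e}) p (\<lambda>X. g e (insert e X)))"
      by (subst Ebin_split[OF assms(1) e, of p "g e"]) (simp add: algebra_simps)
    ultimately have "\<bar>Ebin (A - {e}) p (g e) - Ebin A p (g e)\<bar> \<le> p"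
      using assms by (auto simp: abs_mult intro: mult_left_le)
    then show "\<bar>p * (Ebin (A - {e}) p (g e) - Ebin A p (g e))\<bar> \<le> p * p"
      using assms by (auto simp: abs_mult intro: mult_left_mono)
  qed
  finally show ?thesis by (simp add: mult.commute)
qed

lemma Ebin_card:
  assumes "finite A"
  shows "Ebin A p (\<lambda>X. real (card (X \<inter> B))) = p * card (A \<inter> B)"
proof -
  have "Ebin A p (\<lambda>X. real (card (X \<inter> B))) = Ebin A p (\<lambda>X. \<Sum>e\<in>A \<inter> B. of_bool (e \<in> X) * 1)"
  proof (rule Ebin_cong)
    fix X assume "X \<subseteq> A"
    then have "A \<inter> B \<inter> {x. x \<in> X} = X \<inter> B" by auto
    then show "real (card (X \<inter> B)) = (\<Sum>e\<in>A \<inter> B. of_bool (e \<in> X) * 1)"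
      using assms by (simp add: sum_of_bool_eq)
  qed
  also have "\<dots> = (\<Sum>e\<in>A \<inter> B. p)"
    unfolding Ebin_sum
    by (intro sum.cong refl, subst Ebin_member[where g = "\<lambda>_. 1"]) (use assms in \<open>auto simp: Ebin_const\<close>)
  finally show ?thesis by simp
qed

section \<open>Russo's formula and the Efron-Stein inequality\<close>

text \<open>Russo's formula, by the product rule and induction on one edge at a time. Being a finite
  sum, \<open>Ebin A p f\<close> is a polynomial defined for every real \<open>p\<close>, so it can
  be differentiated without regard to the probabilistic range.\<close>

lemma Ebin_has_derivative:
  assumes "finite A"
  shows "((\<lambda>p. Ebin A p f) has_real_derivative
           (\<Sum>e\<in>A. Ebin A p (\<lambda>X. f (insert e X) - f (X - {e})))) (at p)"
  using assms
proof (induction A arbitrary: f rule: finite_induct)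
  case (insert a A)
  let ?D = "\<lambda>f e X. f (insert e X) - f (X - {e}) :: real"
  have "((\<lambda>p. p * Ebin A p (\<lambda>X. f (insert a X)) + (1 - p) * Ebin A p f) has_real_derivative
     (Ebin A p (\<lambda>X. f (insert a X)) + p * (\<Sum>e\<in>A. Ebin A p (?D (\<lambda>X. f (insert a X)) e)))
     + (- Ebin A p f + (1 - p) * (\<Sum>e\<in>A. Ebin A p (?D f e)))) (at p)"
    by (auto intro!: derivative_eq_intros insert.IH)
  moreover have "Ebin (insert a A) p (?D f e) =
       p * Ebin A p (?D (\<lambda>X. f (insert a X)) e) + (1 - p) * Ebin A p (?D f e)" if "e \<in> A" for e
  proof -
    have "insert e (insert a X) = insert a (insert e X)" "insert a X - {e} = insert a (X - {e})" for X
      using insert that by auto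
    then show ?thesis using insert by (simp add: Ebin_insert)
  qed
  moreover have "Ebin (insert a A) p (?D f a) = Ebin A p (\<lambda>X. f (insert a X)) - Ebin A p f"
  proof -
    have "Ebin A p (\<lambda>X. ?D f a (insert a X)) = Ebin A p (\<lambda>X. f (insert a X) - f X)"
      "Ebin A p (?D f a) = Ebin A p (\<lambda>X. f (insert a X) - f X)"
    proof (rule_tac [!] Ebin_cong)
      fix X assume "X \<subseteq> A"
      then have "X - {a} = X" "insert a X - {a} = X" using insert.hyps by auto
      then show "?D f a (insert a X) = f (insert a X) - f X" "?D f a X = f (insert a X) - f X"
        by simp_all
    qed
    then show ?thesis using insert by (simp add: Ebin_insert Ebin_diff algebra_simps)
  qed
  ultimately have "((\<lambda>p. p * Ebin A p (\<lambda>X. f (insert a X)) + (1 - p) * Ebin A p f) has_real_derivative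
     Ebin (insert a A) p (?D f a) + (\<Sum>e\<in>A. Ebin (insert a A) p (?D f e))) (at p)"
    by (simp add: sum_distrib_left sum.distrib cong: sum.cong) (simp add: algebra_simps)
  then show ?case
    using insert.hyps by (simp add: Ebin_insert[of A a _ f])
qed simp

text \<open>For increasing \<open>f\<close> every summand in Russo's formula is nonnegative; this
  takes the place of a coupling of the two densities.\<close>

lemma Ebin_mono_prob:
  assumes "finite A" "0 \<le> p" "p \<le> q" "q \<le> 1" "\<And>X Y. X \<subseteq> Y \<Longrightarrow> Y \<subseteq> A \<Longrightarrow> f X \<le> f Y"
  shows "Ebin A p f \<le> Ebin A q f"
proof (rule DERIV_nonneg_imp_nondecreasing[OF assms(3)])
  fix x assume x: "p \<le> x" "x \<le> q"
  show "\<exists>y. ((\<lambda>a. Ebin A a f) has_real_derivative y) (at x) \<and> 0 \<le> y"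
    using x assms
    by (intro exI[of _ "\<Sum>e\<in>A. Ebin A x (\<lambda>X. f (insert e X) - f (X - {e}))"] conjI
        Ebin_has_derivative sum_nonneg Ebin_nonneg) (auto intro!: assms(5))
qed

text \<open>Efron-Stein by the law of total variance over one edge: the two conditional means differ
  by at most \<open>c\<close>, which adds at most \<open>p * c\<^sup>2\<close>. The factor
  \<open>p\<close> matters: in the application \<open>p * card A\<close>, the expected number of
  edges, is of order \<open>n\<close>, while \<open>card A\<close> is of order
  \<open>n ^ r\<close>.\<close>

lemma Ebin_variance:
  assumes "finite A" "0 \<le> p" "p \<le> 1"
    and "\<And>e X. e \<in> A \<Longrightarrow> X \<subseteq> A - {e} \<Longrightarrow> \<bar>f (insert e X) - f X\<bar> \<le> c"
  shows "Ebin A p (\<lambda>X. (f X - Ebin A p f)\<^sup>2) \<le> p * c\<^sup>2 * card A"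
  using assms(1,4)
proof (induction A arbitrary: f rule: finite_induct)
  case (insert a A)
  define m1 m0 where "m1 = Ebin A p (\<lambda>X. f (insert a X))" and "m0 = Ebin A p f"
  have m: "Ebin (insert a A) p f = p * m1 + (1 - p) * m0"
    using insert by (simp add: Ebin_insert m1_def m0_def)
  have shift: "Ebin A p (\<lambda>X. (g X - z)\<^sup>2) = Ebin A p (\<lambda>X. (g X - Ebin A p g)\<^sup>2) + (Ebin A p g - z)\<^sup>2" for g z
  proof -
    have "Ebin A p (\<lambda>X. (g X - z)\<^sup>2) = Ebin A p (\<lambda>X. ((g X - Ebin A p g)\<^sup>2 + 2 * (Ebin A p g - z) * (g X - Ebin A p g))
       + (Ebin A p g - z)\<^sup>2)"
      by (rule Ebin_cong) (simp add: power2_eq_square algebra_simps)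
    also have "\<dots> = Ebin A p (\<lambda>X. (g X - Ebin A p g)\<^sup>2) + (Ebin A p g - z)\<^sup>2"
      unfolding Ebin_add Ebin_cmult Ebin_diff using insert by (simp add: Ebin_const)
    finally show ?thesis .
  qed
  have i1: "Ebin A p (\<lambda>X. (f (insert a X) - m1)\<^sup>2) \<le> p * c\<^sup>2 * card A"
    unfolding m1_def
  proof (rule insert.IH)
    fix e X assume e: "e \<in> A" "X \<subseteq> A - {e}"
    then have "\<bar>f (insert e (insert a X)) - f (insert a X)\<bar> \<le> c"
      using insert by (intro insert.prems) auto
    then show "\<bar>f (insert a (insert e X)) - f (insert a X)\<bar> \<le> c" by (simp add: insert_commute)
  qed
  have i0: "Ebin A p (\<lambda>X. (f X - m0)\<^sup>2) \<le> p * c\<^sup>2 * card A"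
    unfolding m0_def by (rule insert.IH) (rule insert.prems, use insert.hyps in auto)
  have dm: "\<bar>m1 - m0\<bar> \<le> c"
  proof -
    have "\<bar>m1 - m0\<bar> \<le> Ebin A p (\<lambda>X. \<bar>f (insert a X) - f X\<bar>)"
      unfolding m1_def m0_def Ebin_diff[symmetric] using assms by (intro Ebin_abs_le)
    also have "\<dots> \<le> c"
      using insert assms by (intro Ebin_le_const) (auto intro!: insert.prems)
    finally show ?thesis .
  qed
  let ?m = "p * m1 + (1 - p) * m0"
  have "Ebin (insert a A) p (\<lambda>X. (f X - Ebin (insert a A) p f)\<^sup>2) =
     p * Ebin A p (\<lambda>X. (f (insert a X) - ?m)\<^sup>2) + (1 - p) * Ebin A p (\<lambda>X. (f X - ?m)\<^sup>2)"
    unfolding m using insert by (simp add: Ebin_insert)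
  also have "\<dots> = p * (Ebin A p (\<lambda>X. (f (insert a X) - m1)\<^sup>2) + (m1 - ?m)\<^sup>2) +
     (1 - p) * (Ebin A p (\<lambda>X. (f X - m0)\<^sup>2) + (m0 - ?m)\<^sup>2)"
    by (subst (1 2) shift) (simp add: m1_def m0_def)
  also have "\<dots> \<le> p * (p * c\<^sup>2 * card A + (m1 - ?m)\<^sup>2) + (1 - p) * (p * c\<^sup>2 * card A + (m0 - ?m)\<^sup>2)"
    using i1 i0 assms by (intro add_mono mult_left_mono) auto
  also have "\<dots> = p * c\<^sup>2 * card A + p * (1 - p) * (m1 - m0)\<^sup>2"
    by (simp add: power2_eq_square algebra_simps)
  also have "\<dots> \<le> p * c\<^sup>2 * card A + p * c\<^sup>2"
  proof -
    have "(m1 - m0)\<^sup>2 \<le> c\<^sup>2" using dm by (metis abs_ge_zero power2_abs power_mono)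
    then have "p * (1 - p) * (m1 - m0)\<^sup>2 \<le> p * c\<^sup>2"
      using assms(2,3) by (intro mult_mono) (auto simp: mult_left_le)
    then show ?thesis by simp
  qed
  also have "\<dots> = p * c\<^sup>2 * card (insert a A)"
    using insert by (simp add: algebra_simps)
  finally show ?case .
qed (simp)

lemma Ebin_square_le:
  assumes "finite A" "0 \<le> p" "p \<le> 1"
  shows "(Ebin A p f)\<^sup>2 \<le> Ebin A p (\<lambda>X. (f X)\<^sup>2)"
proof -
  define m where "m = Ebin A p f"
  have "0 \<le> Ebin A p (\<lambda>X. (f X - m)\<^sup>2)" by (rule Ebin_nonneg) (use assms in auto)
  also have "\<dots> = Ebin A p (\<lambda>X. ((f X)\<^sup>2 - 2 * m * f X) + m\<^sup>2)"
    by (rule Ebin_cong) (simp add: power2_eq_square algebra_simps)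
  also have "\<dots> = Ebin A p (\<lambda>X. (f X)\<^sup>2) - m\<^sup>2"
    unfolding Ebin_add Ebin_diff Ebin_cmult using assms by (simp add: Ebin_const m_def power2_eq_square)
  finally show ?thesis by (simp add: m_def)
qed

lemma Ebin_deviation:
  assumes "finite A" "0 \<le> p" "p \<le> 1" "0 \<le> c"
    and "\<And>e X. e \<in> A \<Longrightarrow> X \<subseteq> A - {e} \<Longrightarrow> \<bar>f (insert e X) - f X\<bar> \<le> c"
  shows "Ebin A p (\<lambda>X. \<bar>f X - Ebin A p f\<bar>) \<le> c * sqrt (p * card A)"
proof -
  have "(Ebin A p (\<lambda>X. \<bar>f X - Ebin A p f\<bar>))\<^sup>2 \<le> Ebin A p (\<lambda>X. \<bar>f X - Ebin A p f\<bar>\<^sup>2)"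
    by (rule Ebin_square_le[OF assms(1-3)])
  also have "\<dots> \<le> p * c\<^sup>2 * card A"
    using Ebin_variance[OF assms(1-3,5)] by simp
  finally have "Ebin A p (\<lambda>X. \<bar>f X - Ebin A p f\<bar>) \<le> sqrt (p * c\<^sup>2 * card A)"
    by (rule real_le_rsqrt)
  also have "\<dots> = c * sqrt (p * card A)"
    using assms by (simp add: real_sqrt_mult)
  finally show ?thesis .
qed

text \<open>The link with the probability space: revealing one more coordinate of the product
  measure matches \<open>Ebin_insert\<close>.\<close>

lemma expectation_Pi_pmf_bernoulli:
  fixes f :: "'a set \<Rightarrow> real"
  assumes "finite A" "0 \<le> p" "p \<le> 1"
  shows "measure_pmf.expectation (Pi_pmf A False (\<lambda>_. bernoulli_pmf p)) (\<lambda>X. f {e \<in> A. X e}) = Ebin A p f"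
  using assms(1)
proof (induction A arbitrary: f rule: finite_induct)
  case (insert a A)
  let ?P = "Pi_pmf A False (\<lambda>_. bernoulli_pmf p)"
  have fin: "finite (set_pmf ?P)"
    using insert by (intro finite_subset[OF set_Pi_pmf_subset'[OF insert(1)]]) auto
  have eqs: "{e. (e = a \<or> e \<in> A) \<and> (X(a := True)) e} = insert a {e \<in> A. X e}"
       "{e. (e = a \<or> e \<in> A) \<and> (X(a := False)) e} = {e \<in> A. X e}" for X :: "'a \<Rightarrow> bool"
    using insert by auto
  have "measure_pmf.expectation (Pi_pmf (insert a A) False (\<lambda>_. bernoulli_pmf p)) (\<lambda>X. f {e \<in> insert a A. X e}) =
     (\<Sum>b\<in>UNIV. pmf (bernoulli_pmf p) b *\<^sub>R measure_pmf.expectation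
        (?P \<bind> (\<lambda>f. return_pmf (f(a := b)))) (\<lambda>X. f {e \<in> insert a A. X e}))"
    by (subst Pi_pmf_insert'[OF insert(1,2)], subst pmf_expectation_bind[where A = UNIV])
      (use fin in auto)
  also have "\<dots> = (\<Sum>b\<in>UNIV. pmf (bernoulli_pmf p) b * measure_pmf.expectation ?P (\<lambda>X. f {e \<in> insert a A. (X(a := b)) e}))"
    by (simp add: map_pmf_def[symmetric])
  also have "\<dots> = Ebin (insert a A) p f"
    using insert assms(2,3)
    by (simp add: UNIV_bool eqs Ebin_insert insert.IH[of "\<lambda>X. f (insert a X)"] del: fun_upd_apply)
  finally show ?case .
qed simp

section \<open>Components\<close>

definition component :: "'a set set \<Rightarrow> 'a \<Rightarrow> 'a set" where
  "component X u = {v. (u, v) \<in> {(a, b). \<exists>e\<in>X. a \<in> e \<and> b \<in> e}\<^sup>*}"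

lemma component_refl [simp]: "u \<in> component X u"
  by (simp add: component_def)

lemma component_trans: "v \<in> component X u \<Longrightarrow> w \<in> component X v \<Longrightarrow> w \<in> component X u"
  unfolding component_def by (auto intro: rtrancl_trans)

lemma component_sym: "v \<in> component X u \<Longrightarrow> u \<in> component X v"
proof -
  have "sym {(a, b). \<exists>e\<in>X. a \<in> e \<and> b \<in> e}" by (auto simp: sym_def)
  then have "sym ({(a, b). \<exists>e\<in>X. a \<in> e \<and> b \<in> e}\<^sup>*)" by (rule sym_rtrancl)
  then show "v \<in> component X u \<Longrightarrow> u \<in> component X v" unfolding component_def by (auto dest: symD)
qed

lemma component_eq: "v \<in> component X u \<Longrightarrow> component X v = component X u"
  by (auto intro: component_trans component_sym)

lemma component_mono: "X \<subseteq> Y \<Longrightarrow> component X u \<subseteq> component Y u"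
  unfolding component_def by (auto elim!: rtrancl_mono[THEN subsetD, rotated])

lemma component_edge: "e \<in> X \<Longrightarrow> a \<in> e \<Longrightarrow> b \<in> e \<Longrightarrow> b \<in> component X a"
  unfolding component_def by (auto intro!: r_into_rtrancl)

lemma component_closed: "e \<in> X \<Longrightarrow> a \<in> e \<Longrightarrow> a \<in> component X u \<Longrightarrow> e \<subseteq> component X u"
  by (blast intro: component_trans component_edge)

lemma component_in_edge:
  assumes "v \<in> component X u" "v \<noteq> u"
  shows "\<exists>e\<in>X. v \<in> e"
  using assms unfolding component_def by (auto elim: rtranclE)

lemma component_subset:
  assumes "u \<in> V" "\<Union>X \<subseteq> V"
  shows "component X u \<subseteq> V"
proof
  fix v assume "v \<in> component X u"
  then show "v \<in> V" using component_in_edge[of v X u] assms by (cases "v = u") auto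
qed

lemma component_isolated:
  assumes "u \<notin> \<Union>X"
  shows "component X u = {u}"
proof -
  have "v = u" if "v \<in> component X u" for v
    using component_in_edge[OF component_sym[OF that]] assms by blast
  then show ?thesis by auto
qed

text \<open>A walk that uses \<open>f\<close> is cut at its first entry into \<open>f\<close> and at
  its last exit; the parts before and after run in \<open>P\<close>.\<close>

lemma component_insert_cases:
  assumes "w \<in> component (insert f P) u"
  shows "w \<in> component P u \<or> (\<exists>a\<in>f. \<exists>b\<in>f. a \<in> component P u \<and> w \<in> component P b)"
proof -
  have "(u, w) \<in> {(a, b). \<exists>e\<in>insert f P. a \<in> e \<and> b \<in> e}\<^sup>*"
    using assms by (simp add: component_def)
  then show ?thesis
  proof (induction rule: rtrancl_induct)
    case (step y z)
    then obtain e where e: "e \<in> insert f P" "y \<in> e" "z \<in> e" by auto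
    show ?case
    proof (cases "e = f")
      case True
      then show ?thesis using step.IH e component_refl by metis
    next
      case False
      then have "z \<in> component P y" using e by (auto intro: component_edge)
      then show ?thesis using step.IH component_trans by metis
    qed
  qed simp
qed

lemma component_insert_disjoint:
  assumes "component P u \<inter> f = {}"
  shows "component (insert f P) u = component P u"
  using assms component_insert_cases[of _ f P u] component_mono[of P "insert f P" u] by blast

lemma component_insert_meets:
  assumes "component P u \<inter> f \<noteq> {}"
  shows "component (insert f P) u = (\<Union>b\<in>f. component P b)"
proof -
  obtain a where a: "a \<in> f" "a \<in> component P u" using assms by auto
  have "w \<in> (\<Union>b\<in>f. component P b)" if "w \<in> component (insert f P) u" for w
    using component_insert_cases[OF that] a component_eq[OF a(2)] by auto
  moreover have "w \<in> component (insert f P) u" if "b \<in> f" "w \<in> component P b" for b w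
  proof -
    have "a \<in> component (insert f P) u" "b \<in> component (insert f P) a" "w \<in> component (insert f P) b"
      using a that component_mono[of P "insert f P"] component_edge[of f "insert f P" a b] by auto
    then show ?thesis by (blast intro: component_trans)
  qed
  ultimately show ?thesis by auto
qed

section \<open>Vertices in components of size at least k\<close>

definition large :: "'a set \<Rightarrow> nat \<Rightarrow> 'a set set \<Rightarrow> 'a set" where
  "large V k X = {v \<in> V. k \<le> card (component X v)}"

lemma large_subset: "large V k X \<subseteq> V"
  by (auto simp: large_def)

lemma large_mono:
  assumes "finite V" "X \<subseteq> Y" "\<Union>Y \<subseteq> V"
  shows "large V k X \<subseteq> large V k Y"
proof -
  have "card (component X v) \<le> card (component Y v)" if "v \<in> V" for v
    using component_mono[OF assms(2)] component_subset[OF that assms(3)] assms(1)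
    by (meson card_mono finite_subset)
  then show ?thesis by (force simp: large_def)
qed

lemma large_antimono: "k \<le> l \<Longrightarrow> large V l X \<subseteq> large V k X"
  by (auto simp: large_def)

lemma large_one:
  assumes "finite V" "\<Union>X \<subseteq> V"
  shows "large V 1 X = V"
proof -
  have "1 \<le> card (component X v)" if "v \<in> V" for v
    using component_subset[OF that assms(2)] assms(1) component_refl[of v X]
    by (metis Suc_leI card_gt_0_iff empty_iff finite_subset One_nat_def)
  then show ?thesis by (auto simp: large_def)
qed

lemma large_component: "u \<in> large V k X \<Longrightarrow> w \<in> component X u \<Longrightarrow> w \<in> V \<Longrightarrow> w \<in> large V k X"
  by (auto simp: large_def component_eq)

text \<open>A vertex that becomes large had a component of fewer than \<open>k\<close> vertices
  meeting \<open>f\<close>. At most \<open>card f\<close> such components exist, so the cut-off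
  makes the effect of one edge bounded.\<close>

lemma large_insert_diff:
  "large V k (insert f P) - large V k P \<subseteq>
     (\<Union>b\<in>{b \<in> f. card (component P b) < k}. component P b)"
proof
  fix v assume v: "v \<in> large V k (insert f P) - large V k P"
  then have lt: "card (component P v) < k" by (auto simp: large_def)
  have "component P v \<inter> f \<noteq> {}"
    using v component_insert_disjoint[of P v f] by (auto simp: large_def)
  then obtain b where b: "b \<in> f" "b \<in> component P v" by auto
  then have "component P b = component P v" by (simp add: component_eq)
  with b lt show "v \<in> (\<Union>b\<in>{b \<in> f. card (component P b) < k}. component P b)" by auto
qed

lemma card_large_insert_diff:
  assumes "finite V" "\<Union>P \<subseteq> V" "f \<subseteq> V"
  shows "card (large V k (insert f P) - large V k P) \<le> card f * k"
proof -
  have fin: "finite f" using assms(1,3) by (rule rev_finite_subset)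
  have "finite (component P b)" if "b \<in> f" for b
    using component_subset[of b V P] that assms by (auto intro: finite_subset)
  then have "card (large V k (insert f P) - large V k P) \<le>
      card (\<Union>b\<in>{b \<in> f. card (component P b) < k}. component P b)"
    using fin by (intro card_mono large_insert_diff) auto
  also have "\<dots> \<le> (\<Sum>b\<in>{b \<in> f. card (component P b) < k}. card (component P b))"
    using fin by (intro card_UN_le) auto
  also have "\<dots> \<le> (\<Sum>b\<in>{b \<in> f. card (component P b) < k}. k)"
    by (intro sum_mono) auto
  also have "\<dots> \<le> card f * k"
    using fin by (auto intro!: mult_right_mono card_mono)
  finally show ?thesis .
qed

lemma card_large_insert:
  assumes "finite V" "\<Union>P \<subseteq> V" "f \<subseteq> V"
  shows "\<bar>real (card (large V k (insert f P))) - real (card (large V k P))\<bar> \<le> card f * k"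
proof -
  have fin: "finite (large V k Q)" for Q using assms(1) large_subset finite_subset by metis
  have sub: "large V k P \<subseteq> large V k (insert f P)"
    using assms by (intro large_mono) auto
  have "card (large V k (insert f P)) =
      card (large V k P) + card (large V k (insert f P) - large V k P)"
    using sub fin by (metis card_Diff_subset card_mono le_add_diff_inverse)
  then show ?thesis using of_nat_mono[OF card_large_insert_diff[OF assms, of k], where 'a = real] by simp
qed

text \<open>Largeness is tested without \<open>e\<close>, so for random \<open>X\<close> it is
  independent of the presence of \<open>e\<close>. Up to exceptions, the values \<open>j = 0\<close>
  and \<open>j = 1\<close> give the edges outside the core.\<close>

definition attached :: "'a set \<Rightarrow> nat \<Rightarrow> nat \<Rightarrow> 'a set set \<Rightarrow> 'a set set" where
  "attached V k j X = {e \<in> X. card (e \<inter> large V k (X - {e})) = j}"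

lemma ex_max_if_finite_nat:
  fixes g :: "'b \<Rightarrow> nat"
  assumes "finite S" "S \<noteq> {}"
  shows "\<exists>x\<in>S. \<forall>y\<in>S. g y \<le> g x"
proof -
  have "Max (g ` S) \<in> g ` S" using assms by simp
  then obtain x where "x \<in> S" "Max (g ` S) = g x" by auto
  then show ?thesis using assms by (metis Max_ge finite_imageI imageI)
qed

text \<open>If \<open>e\<close> is chosen to maximise the component of \<open>z\<close> in \<open>X - {e}\<close>, then all other edges counted here lie
  inside that component.\<close>

lemma card_small_touching_le:
  assumes "finite V" "\<Union>X \<subseteq> V" "z \<in> V"
  shows "card {e \<in> X. e \<inter> component (X - {e}) z \<noteq> {} \<and> card (component (X - {e}) z) < k} \<le> 1 + 2 ^ k"
    (is "card ?E \<le> _")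
proof (cases "?E = {}")
  case False
  let ?Z = "\<lambda>e. component (X - {e}) z"
  have finX: "finite X" using assms by (meson finite_UnionD finite_subset)
  have finZ: "finite (?Z e)" for e
    using component_subset[of z V "X - {e}"] assms by (auto intro: finite_subset)
  have "finite ?E" using finX by auto
  from ex_max_if_finite_nat[OF this False, of "\<lambda>e. card (?Z e)"]
  obtain e where e: "e \<in> ?E" and max: "\<And>e'. e' \<in> ?E \<Longrightarrow> card (?Z e') \<le> card (?Z e)" by blast
  have "e' \<subseteq> ?Z e" if e': "e' \<in> ?E" "e' \<noteq> e" for e'
  proof (rule ccontr)
    assume "\<not> e' \<subseteq> ?Z e"
    then have disj: "e' \<inter> ?Z e = {}"
      using component_closed[of e' "X - {e}" _ z] e' by blast
    have "component (X - {e} - {e'}) z \<inter> e' = {}"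
      using disj component_mono[of "X - {e} - {e'}" "X - {e}" z] by blast
    then have "component (insert e' (X - {e} - {e'})) z = component (X - {e} - {e'}) z"
      by (rule component_insert_disjoint)
    moreover have "insert e' (X - {e} - {e'}) = X - {e}" using e' by auto
    ultimately have "?Z e \<subseteq> ?Z e'"
      using component_mono[of "X - {e} - {e'}" "X - {e'}" z] by auto
    then have "?Z e = ?Z e'"
      using max[OF e'(1)] finZ by (simp add: card_seteq)
    then show False using disj e' by auto
  qed
  then have "?E \<subseteq> insert e (Pow (?Z e))" by auto
  then have "card ?E \<le> card (insert e (Pow (?Z e)))"
    using finZ by (intro card_mono) auto
  also have "\<dots> \<le> 1 + card (Pow (?Z e))"
    using finZ by (simp add: card_insert_if)
  also have "\<dots> \<le> 1 + 2 ^ k"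
    using finZ e by (simp add: card_Pow)
  finally show ?thesis .
qed (simp only: card.empty)

text \<open>Adding \<open>a\<close> changes the status of another edge \<open>e\<close> only if a
  vertex of \<open>e\<close> becomes large; then \<open>e\<close> meets a component of
  \<open>X - {e}\<close> with fewer than \<open>k\<close> vertices that contains some
  \<open>z \<in> a\<close>. For each \<open>z\<close>, \<open>card_small_touching_le\<close> limits
  these \<open>e\<close>; the leading 1 is for \<open>a\<close> itself.\<close>

lemma card_attached_insert:
  assumes "finite V" "\<Union>X \<subseteq> V" "a \<subseteq> V" "a \<notin> X"
  shows "\<bar>real (card (attached V k j (insert a X))) - real (card (attached V k j X))\<bar>
     \<le> 1 + card a * (1 + 2 ^ k)"
proof -
  let ?E = "\<lambda>z. {e \<in> X. e \<inter> component (X - {e}) z \<noteq> {} \<and> card (component (X - {e}) z) < k}"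
  let ?D = "insert a (\<Union>z\<in>a. ?E z)"
  have finX: "finite X" using assms by (meson finite_UnionD finite_subset)
  have fina: "finite a" using assms(1,3) by (rule rev_finite_subset)
  have agree: "e \<in> attached V k j (insert a X) \<longleftrightarrow> e \<in> attached V k j X" if "e \<notin> ?D" for e
  proof (cases "e \<in> X")
    case True
    have ne: "e \<noteq> a" using that by auto
    then have i: "insert a X - {e} = insert a (X - {e})" by auto
    have "large V k (X - {e}) \<subseteq> large V k (insert a (X - {e}))"
      using assms by (intro large_mono) auto
    moreover have "w \<in> large V k (X - {e})" if w: "w \<in> e" "w \<in> large V k (insert a (X - {e}))" for w
    proof (rule ccontr)
      assume "w \<notin> large V k (X - {e})"
      then obtain b where b: "b \<in> a" "card (component (X - {e}) b) < k" "w \<in> component (X - {e}) b"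
        using large_insert_diff[of V k a "X - {e}"] w by blast
      then have "e \<in> ?E b" using w True by auto
      then show False using that b \<open>e \<notin> ?D\<close> by auto
    qed
    ultimately have "e \<inter> large V k (insert a (X - {e})) = e \<inter> large V k (X - {e})" by auto
    then show ?thesis using True i by (simp add: attached_def)
  qed (use that in \<open>auto simp: attached_def\<close>)
  have fin: "finite ?D" using finX fina by auto
  have finA: "finite (attached V k j Y)" if "finite Y" for Y
    using that by (auto simp: attached_def)
  have "card ?D \<le> 1 + card (\<Union>z\<in>a. ?E z)"
    using fin by (simp add: card_insert_if)
  also have "\<dots> \<le> 1 + (\<Sum>z\<in>a. card (?E z))"
    using fina by (intro add_mono card_UN_le) auto
  also have "\<dots> \<le> 1 + (\<Sum>z\<in>a. 1 + 2 ^ k)"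
    using assms by (intro add_left_mono sum_mono card_small_touching_le[OF assms(1,2)]) auto
  finally have D: "card ?D \<le> 1 + card a * (1 + 2 ^ k)" by simp
  have le: "card P \<le> card Q + card ?D" if "P \<subseteq> Q \<union> ?D" "finite Q" for P Q :: "'a set set"
    using card_mono[OF _ that(1)] card_Un_le[of Q ?D] fin that(2) by fastforce
  have "card (attached V k j (insert a X)) \<le> card (attached V k j X) + card ?D"
    "card (attached V k j X) \<le> card (attached V k j (insert a X)) + card ?D"
    by (rule le; use agree finA finX in blast)+
  then have "\<bar>real (card (attached V k j (insert a X))) - real (card (attached V k j X))\<bar> \<le> real (card ?D)"
    by linarith
  also have "\<dots> \<le> real (1 + card a * (1 + 2 ^ k))" using D of_nat_mono by blast
  finally show ?thesis by simp
qed

section \<open>Numbers of components\<close>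

definition ncomp :: "'a set \<Rightarrow> 'a set set \<Rightarrow> nat" where
  "ncomp V X = card (component X ` V)"

definition tree_edge :: "'a set set \<Rightarrow> 'a set \<Rightarrow> bool" where
  "tree_edge X e \<longleftrightarrow> (\<forall>u\<in>e. \<forall>w\<in>e. u \<noteq> w \<longrightarrow> w \<notin> component (X - {e}) u)"

lemma ncomp_insert:
  assumes "finite V" "f \<subseteq> V" "f \<noteq> {}" "\<And>u w. u \<in> f \<Longrightarrow> w \<in> f \<Longrightarrow> u \<noteq> w \<Longrightarrow> w \<notin> component P u"
  shows "ncomp V P = ncomp V (insert f P) + (card f - 1)"
proof -
  let ?U = "\<Union>b\<in>f. component P b"
  \<comment> \<open>Adding \<open>f\<close> acts on the set of components as one map: those meeting
    \<open>f\<close> go to their union \<open>?U\<close>, the others stay.\<close>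
  have collapse: "(\<lambda>K. if K \<in> T then ?U else K) ` S = insert ?U (S - T)" if "T \<subseteq> S" "T \<noteq> {}" for T S
    using that by (auto simp: image_iff)
  have iff: "component P v \<in> component P ` f \<longleftrightarrow> component P v \<inter> f \<noteq> {}" for v
  proof
    assume "component P v \<in> component P ` f"
    then obtain b where "b \<in> f" "component P v = component P b" by auto
    then show "component P v \<inter> f \<noteq> {}" using component_refl[of b P] by blast
  next
    assume "component P v \<inter> f \<noteq> {}"
    then obtain b where "b \<in> f" "b \<in> component P v" by auto
    then show "component P v \<in> component P ` f" using component_eq[of b P v] by blast
  qed
  have "component (insert f P) v = (if component P v \<in> component P ` f then ?U else component P v)" for v
    using component_insert_disjoint[of P v f] component_insert_meets[of P v f] iff[of v] by (cases "component P v \<inter> f = {}") simp_all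
  then have "component (insert f P) = (\<lambda>K. if K \<in> component P ` f then ?U else K) \<circ> component P"
    by auto
  then have "component (insert f P) ` V =
      (\<lambda>K. if K \<in> component P ` f then ?U else K) ` component P ` V"
    by (simp only: image_comp)
  moreover obtain b where "b \<in> f" using assms by auto
  moreover have "component P ` f \<subseteq> component P ` V" using assms(2) by auto
  ultimately have eq: "component (insert f P) ` V = insert ?U (component P ` V - component P ` f)"
    using collapse[of "component P ` f" "component P ` V"]
    by (metis (no_types, lifting) empty_iff image_is_empty)
  have "?U \<notin> component P ` V - component P ` f"
    using iff \<open>b \<in> f\<close> component_refl[of b P] by fastforce
  then have "ncomp V (insert f P) = Suc (card (component P ` V - component P ` f))"
    using assms by (simp add: ncomp_def eq)
  moreover have "card (component P ` f) = card f"
  proof (rule card_image, rule inj_onI)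
    fix u w assume "u \<in> f" "w \<in> f" "component P u = component P w"
    then show "u = w" using assms(4)[of u w] component_refl[of w P] by blast
  qed
  moreover have "card (component P ` V - component P ` f) = ncomp V P - card (component P ` f)"
    unfolding ncomp_def using assms rev_finite_subset[OF assms(1,2)] by (intro card_Diff_subset) auto
  moreover have "card (component P ` f) \<le> ncomp V P"
    unfolding ncomp_def using assms by (intro card_mono) auto
  moreover have "card f > 0" using assms by (meson card_gt_0_iff finite_subset)
  ultimately show ?thesis by linarith
qed

text \<open>Being a tree edge is inherited when other edges are deleted, so the edges of
  \<open>B\<close> can be added one at a time, and each fuses \<open>r\<close> components.\<close>

lemma ncomp_union:
  assumes "finite V" "finite B" "B \<inter> C = {}" "r \<ge> 1"
    "\<And>e. e \<in> B \<Longrightarrow> e \<subseteq> V \<and> card e = r \<and> tree_edge (C \<union> B) e"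
  shows "ncomp V C = ncomp V (C \<union> B) + (r - 1) * card B"
  using assms(2,3,5)
proof (induction B rule: finite_induct)
  case (insert b B)
  have sub: "tree_edge (C \<union> B) e" if "e \<in> B" for e
    using insert.prems(2)[of e] that component_mono[of "C \<union> B - {e}" "C \<union> insert b B - {e}"]
    unfolding tree_edge_def by blast
  have b: "b \<subseteq> V" "card b = r" "tree_edge (C \<union> insert b B) b" using insert.prems by auto
  have "C \<union> insert b B - {b} = C \<union> B" using insert by auto
  then have "ncomp V (C \<union> B) = ncomp V (insert b (C \<union> B)) + (card b - 1)"
    using b assms(1,4) by (intro ncomp_insert) (auto simp: tree_edge_def)
  moreover have "ncomp V C = ncomp V (C \<union> B) + (r - 1) * card B"
    using insert sub by auto
  ultimately show ?case using insert b by simp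
qed simp

lemma ncomp_empty: "ncomp V {} = card V"
proof -
  have "component {} v = {v}" for v :: 'a by (rule component_isolated) simp
  then have "inj_on (component {}) V" by (auto simp: inj_on_def)
  then show ?thesis by (simp add: ncomp_def card_image)
qed

text \<open>Vertices in no edge are components by themselves. Applied to the core, this turns a
  count of its vertices into a count of components.\<close>

lemma ncomp_support:
  assumes "finite V" "\<Union>X \<subseteq> V"
  shows "ncomp V X + card (\<Union>X) = card V + card (component X ` \<Union>X)"
proof -
  have sing: "component X v = {v}" if "v \<notin> \<Union>X" for v
    using that by (rule component_isolated)
  have "component X ` V = component X ` \<Union>X \<union> component X ` (V - \<Union>X)"
    using assms by auto
  moreover have "component X ` \<Union>X \<inter> component X ` (V - \<Union>X) = {}"
  proof (rule ccontr)
    assume "component X ` \<Union>X \<inter> component X ` (V - \<Union>X) \<noteq> {}"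
    then obtain u v where "u \<in> \<Union>X" "v \<notin> \<Union>X" "component X u = component X v" by blast
    then show False using sing[of v] component_refl[of u X] by auto
  qed
  ultimately have "ncomp V X = card (component X ` \<Union>X) + card (component X ` (V - \<Union>X))"
    unfolding ncomp_def using assms by (simp add: card_Un_disjoint finite_subset)
  moreover have "card (component X ` (V - \<Union>X)) = card (V - \<Union>X)"
    by (rule card_image) (auto simp: inj_on_def sing)
  moreover have "card (V - \<Union>X) = card V - card (\<Union>X)" "card (\<Union>X) \<le> card V"
    using assms by (auto intro: card_Diff_subset finite_subset card_mono)
  ultimately show ?thesis by linarith
qed

section \<open>The loose core\<close>

text \<open>For \<open>e \<in> P\<close> this says that \<open>v\<close> is a vertex of
  \<open>e\<close> with degree at least two in \<open>P\<close>; naming the second edge makes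
  monotonicity in \<open>P\<close> immediate.\<close>

definition linked :: "'a set set \<Rightarrow> 'a set \<Rightarrow> 'a \<Rightarrow> bool" where
  "linked P e v \<longleftrightarrow> v \<in> e \<and> (\<exists>f\<in>P. f \<noteq> e \<and> v \<in> f)"

definition loose :: "'a set set \<Rightarrow> bool" where
  "loose P \<longleftrightarrow> (\<forall>e\<in>P. \<exists>u w. u \<noteq> w \<and> linked P e u \<and> linked P e w)"

text \<open>Unions of loose sets are loose, so this union is the largest loose subset of
  \<open>X\<close>. It is empty if no nonempty one exists, in agreement with the convention for the
  loose core.\<close>

definition core :: "'a set set \<Rightarrow> 'a set set" where
  "core X = \<Union>{P. P \<subseteq> X \<and> loose P}"

lemma linked_mono: "P \<subseteq> Q \<Longrightarrow> linked P e v \<Longrightarrow> linked Q e v"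
  by (auto simp: linked_def)

lemma core_subset: "core X \<subseteq> X"
  by (auto simp: core_def)

lemma core_greatest: "P \<subseteq> X \<Longrightarrow> loose P \<Longrightarrow> P \<subseteq> core X"
  by (auto simp: core_def)

lemma loose_core_edges: "loose (core X)"
  unfolding loose_def
proof
  fix e assume "e \<in> core X"
  then obtain P where P: "P \<subseteq> X" "loose P" "e \<in> P" by (auto simp: core_def)
  then show "\<exists>u w. u \<noteq> w \<and> linked (core X) e u \<and> linked (core X) e w"
    using linked_mono[OF core_greatest[OF P(1,2)], of e] unfolding loose_def by blast
qed

lemma core_linked:
  assumes "e \<in> core X"
  obtains u w where "u \<noteq> w" "linked (core X) e u" "linked (core X) e w"
  using assms loose_core_edges[of X] unfolding loose_def by blast

lemma core_mono: "X \<subseteq> Y \<Longrightarrow> core X \<subseteq> core Y"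
  by (auto simp: core_def)

text \<open>Each edge of a minimal set \<open>P\<close> connecting \<open>u\<close> to \<open>w\<close> separates them when removed, so it
  meets both of the resulting components.\<close>

lemma minimal_connecting_set:
  assumes "finite Y" "w \<in> component (C \<union> Y) u" "w \<notin> component C u" "C \<inter> Y = {}"
  obtains P where "P \<subseteq> Y" "P \<noteq> {}" "w \<in> component (C \<union> P) u"
    "\<And>f. f \<in> P \<Longrightarrow> \<exists>a\<in>f. \<exists>b\<in>f. a \<noteq> b \<and> a \<in> component (C \<union> P - {f}) u \<and> b \<in> component (C \<union> P - {f}) w"
proof -
  let ?Q = "\<lambda>P. P \<subseteq> Y \<and> w \<in> component (C \<union> P) u"
  obtain P where P: "?Q P" and min: "\<And>P'. ?Q P' \<Longrightarrow> card P \<le> card P'"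
    using ex_has_least_nat[of ?Q Y card] assms(2) by auto
  have fin: "finite P" using P assms(1) finite_subset by blast
  show ?thesis
  proof
    show "P \<subseteq> Y" "w \<in> component (C \<union> P) u" using P by auto
    then show "P \<noteq> {}" using assms(3) by auto
    fix f assume f: "f \<in> P"
    let ?R = "C \<union> P - {f}"
    have R: "?R = C \<union> (P - {f})" using f P assms(4) by auto
    have "card (P - {f}) < card P" using f fin by (meson card_Diff1_less)
    then have nw: "w \<notin> component ?R u"
      using min[of "P - {f}"] P unfolding R by (auto simp: not_le[symmetric])
    have "insert f ?R = C \<union> P" using f by auto
    then have "w \<in> component (insert f ?R) u" using P by simp
    from component_insert_cases[OF this] nw
    obtain a b where ab: "a \<in> f" "b \<in> f" "a \<in> component ?R u" "w \<in> component ?R b" by blast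
    then have "b \<in> component ?R w" "a \<noteq> b" using component_sym component_trans nw by metis+
    then show "\<exists>a\<in>f. \<exists>b\<in>f. a \<noteq> b \<and> a \<in> component ?R u \<and> b \<in> component ?R w"
      using ab by blast
  qed
qed

text \<open>A minimal set \<open>P\<close> of other edges connecting \<open>u\<close> to
  \<open>w\<close> closes a cycle with \<open>e\<close>. In \<open>insert e P\<close> each edge of
  \<open>P\<close> is linked once on the side of \<open>u\<close> and once on the side of
  \<open>w\<close>, and \<open>e\<close> is linked at \<open>u\<close> and \<open>w\<close>; so the
  set is loose.\<close>

lemma core_cyclic_edge:
  assumes "finite X" "e \<in> X" "u \<in> e" "w \<in> e" "u \<noteq> w" "w \<in> component (X - {e}) u"
  shows "e \<in> core X"
proof -
  obtain P where P: "P \<subseteq> X - {e}" "w \<in> component P u"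
    "\<And>f. f \<in> P \<Longrightarrow> \<exists>a\<in>f. \<exists>b\<in>f. a \<noteq> b \<and> a \<in> component (P - {f}) u \<and> b \<in> component (P - {f}) w"
    by (rule minimal_connecting_set[of "X - {e}" w "{}" u]) (use assms component_isolated[of u "{}"] in auto)
  \<comment> \<open>Either \<open>a\<close> is the endpoint \<open>z\<close>, which \<open>e\<close>
    contains, or the walk from \<open>z\<close> reaches \<open>a\<close> through another edge of
    \<open>P\<close>.\<close>
  have link: "linked (insert e P) f a" if "f \<in> P" "a \<in> f" "z \<in> e" "a \<in> component (P - {f}) z" for f a z
  proof (cases "a = z")
    case True
    then show ?thesis using that P(1) by (auto simp: linked_def)
  next
    case False
    then show ?thesis using component_in_edge[OF that(4)] that by (auto simp: linked_def)
  qed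
  have "loose (insert e P)"
    unfolding loose_def
  proof
    fix f assume "f \<in> insert e P"
    then consider "f = e" | "f \<in> P" by auto
    then show "\<exists>a b. a \<noteq> b \<and> linked (insert e P) f a \<and> linked (insert e P) f b"
    proof cases
      case 1
      have "\<exists>g\<in>P. w \<in> g" "\<exists>g\<in>P. u \<in> g"
        using component_in_edge[OF P(2)] component_in_edge[OF component_sym[OF P(2)]] assms(5) by auto
      then have "linked (insert e P) e u" "linked (insert e P) e w"
        using P(1) assms by (auto simp: linked_def)
      then show ?thesis using 1 assms(5) by blast
    next
      case 2
      then show ?thesis using P(3)[OF 2] link[OF 2] assms(3,4) by meson
    qed
  qed
  then show ?thesis using core_greatest[of "insert e P" X] P(1) assms(2) by auto
qed

text \<open>Otherwise a minimal set of non-core edges joining \<open>a\<close> to \<open>b\<close>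
  could be added to the core without losing looseness, against maximality. So each component of
  \<open>X\<close> contains at most one component of the core.\<close>

lemma core_component:
  assumes "finite X" "a \<in> \<Union>(core X)" "b \<in> \<Union>(core X)" "b \<in> component X a"
  shows "b \<in> component (core X) a"
proof (rule ccontr)
  assume n: "b \<notin> component (core X) a"
  let ?C = "core X"
  have un: "?C \<union> (X - ?C) = X" using core_subset by auto
  obtain P where P: "P \<subseteq> X - ?C" "P \<noteq> {}"
    "\<And>f. f \<in> P \<Longrightarrow> \<exists>x\<in>f. \<exists>y\<in>f. x \<noteq> y \<and> x \<in> component (?C \<union> P - {f}) a \<and> y \<in> component (?C \<union> P - {f}) b"
    by (rule minimal_connecting_set[of "X - ?C" b ?C a]) (use assms n un in auto)
  have link: "linked (?C \<union> P) f x"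
    if "f \<in> P" "x \<in> f" "z \<in> \<Union>?C" "x \<in> component (?C \<union> P - {f}) z" for f x z
  proof (cases "x = z")
    case True
    then show ?thesis using that P(1) by (auto simp: linked_def)
  next
    case False
    then show ?thesis using component_in_edge[OF that(4)] that by (auto simp: linked_def)
  qed
  have "loose (?C \<union> P)"
    unfolding loose_def
  proof
    fix f assume "f \<in> ?C \<union> P"
    then consider "f \<in> ?C" | "f \<in> P" by auto
    then show "\<exists>x y. x \<noteq> y \<and> linked (?C \<union> P) f x \<and> linked (?C \<union> P) f y"
    proof cases
      case 1
      then show ?thesis by (metis core_linked linked_mono sup_ge1)
    next
      case 2
      then show ?thesis using P(3)[OF 2] link[OF 2] assms(2,3) by meson
    qed
  qed
  then have "?C \<union> P \<subseteq> core X"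
    using P(1) core_subset[of X] by (intro core_greatest) auto
  then show False using P by auto
qed

text \<open>By \<open>core_cyclic_edge\<close>, an edge outside the core closes no cycle and hence
  is a tree edge of \<open>X\<close>.\<close>

lemma ncomp_core:
  assumes "finite V" "\<And>e. e \<in> X \<Longrightarrow> e \<subseteq> V \<and> card e = r" "r \<ge> 1"
  shows "ncomp V (core X) = ncomp V X + (r - 1) * card (X - core X)"
proof -
  have "X \<subseteq> Pow V" using assms by auto
  then have fin: "finite X" using assms(1) by (meson finite_Pow_iff finite_subset)
  have un: "core X \<union> (X - core X) = X" using core_subset by auto
  have tree: "tree_edge X e" if "e \<in> X - core X" for e
    using core_cyclic_edge[OF fin, of e] that unfolding tree_edge_def by blast
  have "ncomp V (core X) = ncomp V (core X \<union> (X - core X)) + (r - 1) * card (X - core X)"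
    by (rule ncomp_union) (use assms fin tree un in auto)
  then show ?thesis unfolding un .
qed

lemma card_core_components_le:
  assumes "finite V" "\<Union>X \<subseteq> V"
  shows "card (component (core X) ` \<Union>(core X)) \<le> card {K \<in> component X ` V. K \<inter> \<Union>(core X) \<noteq> {}}"
proof -
  let ?S = "\<Union>(core X)"
  have fin: "finite X" using assms by (meson finite_UnionD finite_subset)
  have S: "?S \<subseteq> V" using core_subset[of X] assms by blast
  have eq: "component (core X) v = component X v \<inter> ?S" if "v \<in> ?S" for v
    using core_component[OF fin that] component_mono[OF core_subset, of X v]
      component_subset[OF that, of "core X"] by blast
  have "component (core X) ` ?S \<subseteq> (\<lambda>K. K \<inter> ?S) ` {K \<in> component X ` V. K \<inter> ?S \<noteq> {}}"
  proof
    fix K assume "K \<in> component (core X) ` ?S"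
    then obtain v where v: "v \<in> ?S" "K = component (core X) v" by auto
    have "component X v \<in> {K \<in> component X ` V. K \<inter> ?S \<noteq> {}}"
      using v S component_refl[of v X] by blast
    then show "K \<in> (\<lambda>K. K \<inter> ?S) ` {K \<in> component X ` V. K \<inter> ?S \<noteq> {}}"
      using v eq by blast
  qed
  then have "card (component (core X) ` ?S) \<le> card ((\<lambda>K. K \<inter> ?S) ` {K \<in> component X ` V. K \<inter> ?S \<noteq> {}})"
    using assms by (intro card_mono) auto
  also have "\<dots> \<le> card {K \<in> component X ` V. K \<inter> ?S \<noteq> {}}"
    using assms by (intro card_image_le) auto
  finally show ?thesis .
qed

text \<open>The hypothesis allows one exceptional edge \<open>e0\<close> having a single linked vertex. Were there no
  cyclic edge, \<open>P\<close> would have at least \<open>(r - 1)|P| + 1\<close> vertices; but counting incidences, and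
  once more the vertices of degree one, gives at most \<open>(r - 1)|P| + 1/2\<close>.\<close>

lemma ex_cyclic_edge:
  assumes "finite P" "e0 \<in> P" "r \<ge> 2" "\<And>e. e \<in> P \<Longrightarrow> finite e \<and> card e = r"
    and "\<exists>u. linked P e0 u"
    and two: "\<And>e. e \<in> P \<Longrightarrow> e \<noteq> e0 \<Longrightarrow> \<exists>u w. u \<noteq> w \<and> linked P e u \<and> linked P e w"
  shows "\<exists>e\<in>P. \<exists>u\<in>e. \<exists>w\<in>e. u \<noteq> w \<and> w \<in> component (P - {e}) u"
proof (rule ccontr)
  assume "\<not> ?thesis"
  then have tree: "tree_edge P e" if "e \<in> P" for e using that unfolding tree_edge_def by blast
  let ?V = "\<Union>P" and ?m = "card P"
  have finV: "finite ?V" using assms by auto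
  have "ncomp ?V {} = ncomp ?V ({} \<union> P) + (r - 1) * ?m"
    by (rule ncomp_union) (use assms finV tree in auto)
  moreover have "ncomp ?V P \<ge> 1"
  proof -
    have "?V \<noteq> {}" using assms by fastforce
    then show ?thesis unfolding ncomp_def using finV
      by (simp add: Suc_leI card_gt_0_iff)
  qed
  ultimately have V: "card ?V \<ge> 1 + (r - 1) * ?m" by (simp add: ncomp_empty)
  let ?p = "\<lambda>e. {v \<in> e. \<not> linked P e v}"
  have "2 * card ?V = (\<Sum>v\<in>?V. 2)" by simp
  also have "\<dots> \<le> (\<Sum>v\<in>?V. \<Sum>e\<in>P. of_bool (v \<in> e) * (1 + of_bool (v \<in> ?p e)))"
  proof (rule sum_mono)
    fix v assume "v \<in> ?V"
    then obtain e where e: "e \<in> P" "v \<in> e" by auto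
    let ?t = "\<lambda>e. of_bool (v \<in> e) * (1 + of_bool (v \<in> ?p e)) :: nat"
    show "2 \<le> (\<Sum>e\<in>P. ?t e)"
    proof (cases "linked P e v")
      case True
      then obtain f where f: "f \<in> P" "f \<noteq> e" "v \<in> f" by (auto simp: linked_def)
      have "2 \<le> (\<Sum>e\<in>{e, f}. ?t e)" using f e by simp
      also have "\<dots> \<le> (\<Sum>e\<in>P. ?t e)" using assms f e by (intro sum_mono2) auto
      finally show ?thesis .
    next
      case False
      then have "2 \<le> (\<Sum>e\<in>{e}. ?t e)" using e by simp
      also have "\<dots> \<le> (\<Sum>e\<in>P. ?t e)" using assms e by (intro sum_mono2) auto
      finally show ?thesis .
    qed
  qed
  also have "\<dots> = (\<Sum>e\<in>P. \<Sum>v\<in>?V. of_bool (v \<in> e) * (1 + of_bool (v \<in> ?p e)))"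
    by (rule sum.swap)
  also have "\<dots> = (\<Sum>e\<in>P. r + card (?p e))"
  proof (rule sum.cong[OF refl])
    fix e assume e: "e \<in> P"
    have "(\<Sum>v\<in>?V. of_bool (v \<in> e) * (1 + of_bool (v \<in> ?p e))) = (\<Sum>v\<in>e. 1 + of_bool (v \<in> ?p e) :: nat)"
      by (rule sum.mono_neutral_cong_right) (use e finV in auto)
    also have "\<dots> = card e + (\<Sum>v\<in>e. of_bool (v \<in> ?p e))"
      by (subst sum.distrib) simp
    also have "(\<Sum>v\<in>e. of_bool (v \<in> ?p e)) = card (?p e)"
      using assms(4)[OF e] by (subst sum_of_bool_eq) (auto intro!: arg_cong[where f = card])
    finally show "(\<Sum>v\<in>?V. of_bool (v \<in> e) * (1 + of_bool (v \<in> ?p e))) = r + card (?p e)"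
      using assms(4)[OF e] by simp
  qed
  \<comment> \<open>Two linked vertices leave at most \<open>r - 2\<close> unlinked ones; the single
    linked vertex of \<open>e0\<close> leaves \<open>r - 1\<close>, whence the extra 1.\<close>
  also have "\<dots> \<le> (\<Sum>e\<in>P. (2 * r - 2) + of_bool (e = e0))"
  proof (rule sum_mono)
    fix e assume e: "e \<in> P"
    show "r + card (?p e) \<le> 2 * r - 2 + of_bool (e = e0)"
    proof (cases "e = e0")
      case True
      then obtain u where u: "linked P e u" using assms by auto
      then have "card (?p e) \<le> card (e - {u})"
        using assms(4)[OF e] by (intro card_mono) auto
      also have "\<dots> = r - 1" using assms(4)[OF e] u by (auto simp: linked_def)
      finally show ?thesis using True assms(3) by simp
    next
      case False
      then obtain u w where u: "u \<noteq> w" "linked P e u" "linked P e w" using two[OF e] by auto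
      then have "card (?p e) \<le> card (e - {u, w})"
        using assms(4)[OF e] by (intro card_mono) auto
      also have "\<dots> = r - 2"
        using assms(4)[OF e] u by (subst card_Diff_subset) (auto simp: linked_def)
      finally show ?thesis using False assms(3) by simp
    qed
  qed
  also have "\<dots> = (2 * r - 2) * ?m + 1"
    using assms(1,2) by (subst sum.distrib) (simp add: mult.commute)
  finally have "2 * card ?V \<le> 2 * ((r - 1) * ?m) + 1"
    by (simp add: algebra_simps diff_mult_distrib)
  then show False using V by linarith
qed

section \<open>Exceptional edges\<close>

text \<open>From here to \<open>bad_edges\<close>: the obstacles to reading off core membership from
  large vertices. For fixed \<open>k\<close> the mean numbers of \<open>cyclic_edges\<close> and
  \<open>pendant_cyclic\<close> stay bounded as \<open>n\<close> grows; for \<open>bad_edges\<close>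
  the bound \<open>o(n)\<close> comes from sprinkling.\<close>

definition cyclic_edges :: "nat \<Rightarrow> 'a set set \<Rightarrow> 'a set set" where
  "cyclic_edges k X = {e \<in> X. \<exists>u\<in>e. \<exists>w\<in>e. u \<noteq> w \<and> w \<in> component (X - {e}) u \<and>
     card (component (X - {e}) u) < k}"

definition cyclic_verts :: "'a set \<Rightarrow> nat \<Rightarrow> 'a set set \<Rightarrow> 'a set" where
  "cyclic_verts V k X = {v \<in> V. card (component X v) < k \<and> component X v \<inter> \<Union>(cyclic_edges k X) \<noteq> {}}"

definition pendant_cyclic :: "'a set \<Rightarrow> nat \<Rightarrow> 'a set set \<Rightarrow> 'a set set" where
  "pendant_cyclic V k X = {e \<in> X. e \<inter> cyclic_verts V k (X - {e}) \<noteq> {}}"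

definition bad_edges :: "'a set \<Rightarrow> nat \<Rightarrow> 'a set set \<Rightarrow> 'a set set" where
  "bad_edges V k X = {e \<in> X. \<exists>u\<in>e. \<exists>w\<in>e. u \<in> large V k (X - {e}) \<and> w \<in> large V k (X - {e}) \<and>
     w \<notin> component (X - {e}) u}"

text \<open>Suppose the component \<open>?Z\<close> of \<open>u\<close> in \<open>X - {e}\<close> is
  small, and consider the core edges inside it. As \<open>e\<close> meets \<open>?Z\<close> only in
  \<open>u\<close>, all their links stay inside \<open>?Z\<close>, except that one at
  \<open>u\<close> may have used \<open>e\<close>. Hence \<open>ex_cyclic_edge\<close> finds a cycle
  in \<open>?Z\<close>, and \<open>e\<close> would belong to \<open>pendant_cyclic\<close>.\<close>

lemma core_edge_large:
  assumes "finite V" "\<And>e. e \<in> X \<Longrightarrow> e \<subseteq> V \<and> card e = r" "r \<ge> 2"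
    and e: "e \<in> core X" "e \<notin> cyclic_edges k X" "e \<notin> pendant_cyclic V k X"
    and u: "linked (core X) e u"
  shows "u \<in> large V k (X - {e})"
proof (rule ccontr)
  assume small: "u \<notin> large V k (X - {e})"
  let ?Z = "component (X - {e}) u"
  have eX: "e \<in> X" using e core_subset by auto
  have "X \<subseteq> Pow V" using assms by auto
  then have finX: "finite X" using assms(1) by (meson finite_Pow_iff finite_subset)
  have ue: "u \<in> e" "u \<in> V" using u assms(2)[OF eX] by (auto simp: linked_def)
  have lt: "card ?Z < k" using small ue by (auto simp: large_def)
  have only: "w = u" if "w \<in> e" "w \<in> ?Z" for w
    using that e(2) eX ue lt unfolding cyclic_edges_def by auto
  define P where "P = {f \<in> core X. f \<noteq> e \<and> f \<inter> ?Z \<noteq> {}}"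
  have PX: "P \<subseteq> X - {e}" using core_subset by (auto simp: P_def)
  have PZ: "f \<subseteq> ?Z" if "f \<in> P" for f
  proof -
    obtain a where "a \<in> f" "a \<in> ?Z" using \<open>f \<in> P\<close> by (auto simp: P_def)
    then show ?thesis using component_closed[of f "X - {e}" a u] PX that by auto
  qed
  obtain f0 where f0: "f0 \<in> core X" "f0 \<noteq> e" "u \<in> f0" using u by (auto simp: linked_def)
  then have f0P: "f0 \<in> P" by (auto simp: P_def)
  \<comment> \<open>Only the link of \<open>f0\<close> at \<open>u\<close> can be lost, namely when
    \<open>e\<close> is the second edge there; this makes \<open>f0\<close> the exceptional edge of
    \<open>ex_cyclic_edge\<close>.\<close>
  have link: "linked P f a" if f: "f \<in> P" and a: "linked (core X) f a" and "a \<noteq> u \<or> f \<noteq> f0" for f a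
  proof (cases "a = u")
    case True
    then show ?thesis using that f0P f0 by (auto simp: linked_def)
  next
    case False
    obtain g where g: "g \<in> core X" "g \<noteq> f" "a \<in> g" using a by (auto simp: linked_def)
    have aZ: "a \<in> ?Z" using a PZ[OF f] by (auto simp: linked_def)
    have "g \<noteq> e" using only aZ g False by auto
    then have "g \<in> P" using g aZ by (auto simp: P_def)
    then show ?thesis using g a by (auto simp: linked_def)
  qed
  have two: "\<exists>a b. a \<noteq> b \<and> linked (core X) f a \<and> linked (core X) f b" if "f \<in> P" for f
    using that by (auto simp: P_def elim: core_linked)
  have "\<exists>f\<in>P. \<exists>a\<in>f. \<exists>b\<in>f. a \<noteq> b \<and> b \<in> component (P - {f}) a"
  proof (rule ex_cyclic_edge[of P f0 r])
    show "finite P" using finX PX finite_subset by blast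
    show "finite f \<and> card f = r" if "f \<in> P" for f
    proof -
      have "f \<subseteq> V" "card f = r" using that PX assms(2) by auto
      then show ?thesis using finite_subset[OF _ assms(1)] by simp
    qed
    show "\<exists>a. linked P f0 a" using two[OF f0P] link[OF f0P] by metis
    show "\<exists>a b. a \<noteq> b \<and> linked P f a \<and> linked P f b" if "f \<in> P" "f \<noteq> f0" for f
      using two[OF that(1)] link[OF that(1)] that(2) by metis
  qed (use f0P assms in auto)
  then obtain f a b where f: "f \<in> P" "a \<in> f" "b \<in> f" "a \<noteq> b" "b \<in> component (P - {f}) a" by auto
  have aZ: "a \<in> ?Z" using PZ f by auto
  have sub: "component (X - {e} - {f}) a \<subseteq> ?Z"
    using component_mono[of "X - {e} - {f}" "X - {e}" a] component_eq[OF aZ] by auto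
  have "finite ?Z"
    using component_subset[of u V "X - {e}"] assms ue finite_subset by (metis DiffD1 Sup_le_iff)
  then have "card (component (X - {e} - {f}) a) < k"
    using sub lt by (meson card_mono le_less_trans)
  moreover have "b \<in> component (X - {e} - {f}) a"
    using f(5) component_mono[of "P - {f}" "X - {e} - {f}" a] PX by auto
  ultimately have "f \<in> cyclic_edges k (X - {e})"
    using f PX unfolding cyclic_edges_def by blast
  then have "u \<in> cyclic_verts V k (X - {e})"
    using ue lt aZ f by (auto simp: cyclic_verts_def)
  then show False using e(3) eX ue by (auto simp: pendant_cyclic_def)
qed

section \<open>Deterministic estimates for uniform hypergraphs\<close>

lemma two_le_card_iff:
  assumes "finite S"
  shows "2 \<le> card S \<longleftrightarrow> (\<exists>u\<in>S. \<exists>w\<in>S. u \<noteq> w)"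
proof
  assume "2 \<le> card S"
  then obtain T where "T \<subseteq> S" "card T = 2" using obtain_subset_with_card_n by metis
  then show "\<exists>u\<in>S. \<exists>w\<in>S. u \<noteq> w" by (auto simp: card_2_iff)
next
  assume "\<exists>u\<in>S. \<exists>w\<in>S. u \<noteq> w"
  then obtain u w where "u \<in> S" "w \<in> S" "u \<noteq> w" by auto
  then have "card {u, w} \<le> card S" using assms by (intro card_mono) auto
  then show "2 \<le> card S" using \<open>u \<noteq> w\<close> by simp
qed

locale uniform_edges =
  fixes V :: "'a set" and r :: nat and X :: "'a set set"
  assumes finV: "finite V" and edges: "\<And>e. e \<in> X \<Longrightarrow> e \<subseteq> V \<and> card e = r" and r3: "r \<ge> 3"
begin

lemma X_sub: "\<Union>X \<subseteq> V" using edges by auto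

lemma finX: "finite X"
proof -
  have "X \<subseteq> Pow V" using edges by auto
  then show ?thesis using finV by (meson finite_Pow_iff finite_subset)
qed

lemma fin_edge: "e \<in> X \<Longrightarrow> finite e"
  using edges finV finite_subset by blast

lemma large_remove: "large V k (X - {e}) \<subseteq> large V k X"
  using finV X_sub by (intro large_mono) auto

lemma core_not_attached:
  assumes "e \<in> core X" "e \<notin> cyclic_edges k X" "e \<notin> pendant_cyclic V k X"
  shows "2 \<le> card (e \<inter> large V k (X - {e}))"
proof -
  obtain u w where uw: "u \<noteq> w" "linked (core X) e u" "linked (core X) e w"
    using core_linked[OF assms(1)] by blast
  have "x \<in> large V k (X - {e})" if "linked (core X) e x" for x
    by (rule core_edge_large[OF finV edges _ assms that]) (use r3 in auto)
  then have "u \<in> large V k (X - {e})" "w \<in> large V k (X - {e})" using uw by auto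
  moreover have "u \<in> e" "w \<in> e" using uw by (auto simp: linked_def)
  moreover have "finite e" using assms(1) core_subset fin_edge by blast
  ultimately show ?thesis using uw(1) by (subst two_le_card_iff) auto
qed

lemma card_core_upper:
  "card (core X) + card (attached V k 0 X) + card (attached V k 1 X) \<le>
     card X + (card (cyclic_edges k X) + card (pendant_cyclic V k X))"
proof -
  let ?A = "attached V k 0 X \<union> attached V k 1 X"
  have sub: "?A \<subseteq> X" "core X \<subseteq> X" "cyclic_edges k X \<subseteq> X" "pendant_cyclic V k X \<subseteq> X"
    using core_subset by (auto simp: attached_def cyclic_edges_def pendant_cyclic_def)
  then have fin: "finite ?A" "finite (core X)" "finite (cyclic_edges k X)" "finite (pendant_cyclic V k X)"
    using finX finite_subset by blast+
  have "card ?A = card (attached V k 0 X) + card (attached V k 1 X)"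
    using fin by (intro card_Un_disjoint) (auto simp: attached_def)
  moreover have "card (core X) + card ?A = card (core X \<union> ?A) + card (core X \<inter> ?A)"
    using fin by (intro card_Un_Int)
  moreover have "card (core X \<union> ?A) \<le> card X"
    using sub finX by (intro card_mono) auto
  moreover have "core X \<inter> ?A \<subseteq> cyclic_edges k X \<union> pendant_cyclic V k X"
    using core_not_attached[of _ k] by (fastforce simp: attached_def)
  then have "card (core X \<inter> ?A) \<le> card (cyclic_edges k X \<union> pendant_cyclic V k X)"
    using fin by (intro card_mono) auto
  moreover have "card (cyclic_edges k X \<union> pendant_cyclic V k X) \<le>
      card (cyclic_edges k X) + card (pendant_cyclic V k X)"
    by (rule card_Un_le)
  ultimately show ?thesis by linarith
qed

text \<open>An edge with two large vertices in \<open>X - {e}\<close> either has them in different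
  components there, so it is bad, or closes a cycle and lies in the core by
  \<open>core_cyclic_edge\<close>.\<close>

lemma card_core_lower:
  "card X \<le> card (core X) + card (attached V k 0 X) + card (attached V k 1 X) + card (bad_edges V k X)"
proof -
  let ?U = "core X \<union> attached V k 0 X \<union> attached V k 1 X \<union> bad_edges V k X"
  have "X \<subseteq> ?U"
  proof
    fix e assume e: "e \<in> X"
    show "e \<in> ?U"
    proof (rule ccontr)
      assume n: "e \<notin> ?U"
      then have "card (e \<inter> large V k (X - {e})) \<noteq> 0" "card (e \<inter> large V k (X - {e})) \<noteq> 1"
        using e by (auto simp: attached_def)
      then have "2 \<le> card (e \<inter> large V k (X - {e}))" by linarith
      then obtain u w where "u \<in> e" "w \<in> e" "u \<in> large V k (X - {e})" "w \<in> large V k (X - {e})" "u \<noteq> w"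
        using fin_edge[OF e] by (subst (asm) two_le_card_iff) auto
      moreover from this have "w \<in> component (X - {e}) u"
        using n e by (auto simp: bad_edges_def)
      ultimately have "e \<in> core X" using core_cyclic_edge[OF finX e] by blast
      then show False using n by simp
    qed
  qed
  moreover have "finite ?U"
    using finX core_subset[of X] by (auto simp: attached_def bad_edges_def intro: finite_subset)
  ultimately have "card X \<le> card ?U" by (intro card_mono)
  also have "\<dots> \<le> card (core X) + card (attached V k 0 X) + card (attached V k 1 X) + card (bad_edges V k X)"
    by (intro order_trans[OF card_Un_le] add_mono order_refl)
  finally show ?thesis .
qed

text \<open>Largeness refers to \<open>X\<close> itself here, as the count of components requires.
  The number is then sandwiched between \<open>attached\<close> counts at the levels
  \<open>k\<close> and \<open>r * k\<close>, whose means can be computed.\<close>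

definition small_edges :: "nat \<Rightarrow> 'a set set" where
  "small_edges k = {e \<in> X. e \<inter> large V k X = {}}"

lemma small_edges_attached: "card (small_edges k) \<le> card (attached V k 0 X)"
proof (rule card_mono)
  have "e \<inter> large V k (X - {e}) = {}" if "e \<in> small_edges k" for e
    using that large_remove[of k e] by (auto simp: small_edges_def)
  then show "small_edges k \<subseteq> attached V k 0 X"
    by (auto simp: attached_def) (auto simp: small_edges_def)
qed (use finX in \<open>auto simp: attached_def\<close>)

text \<open>With \<open>e\<close> put back, its vertices share one component made of at most
  \<open>r\<close> pieces with at most \<open>k - 1\<close> vertices each; hence the level
  \<open>r * k\<close>.\<close>

lemma attached_small_edges:
  assumes "k \<ge> 1"
  shows "card (attached V k 0 X) \<le> card (small_edges (r * k))"
proof (rule card_mono)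
  show "finite (small_edges (r * k))" using finX by (simp add: small_edges_def)
  show "attached V k 0 X \<subseteq> small_edges (r * k)"
  proof
    fix e assume "e \<in> attached V k 0 X"
    then have e: "e \<in> X" "e \<inter> large V k (X - {e}) = {}"
      using fin_edge by (auto simp: attached_def)
    have "v \<notin> large V (r * k) X" if v: "v \<in> e" for v
    proof -
      have i: "insert e (X - {e}) = X" using e by auto
      have "component (X - {e}) v \<inter> e \<noteq> {}" using v component_refl[of v "X - {e}"] by blast
      then have "component X v = (\<Union>b\<in>e. component (X - {e}) b)"
        using component_insert_meets[of "X - {e}" v e] i by simp
      then have "card (component X v) \<le> (\<Sum>b\<in>e. card (component (X - {e}) b))"
        using fin_edge[OF e(1)] by (simp add: card_UN_le)
      also have "\<dots> \<le> (\<Sum>b\<in>e. k - 1)"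
      proof (rule sum_mono)
        fix b assume b: "b \<in> e"
        then have "b \<in> V" "b \<notin> large V k (X - {e})" using e edges by auto
        then show "card (component (X - {e}) b) \<le> k - 1" by (auto simp: large_def)
      qed
      also have "\<dots> = r * (k - 1)" using edges e by simp
      also have "\<dots> < r * k" using r3 assms by simp
      finally show ?thesis by (simp add: large_def)
    qed
    then show "e \<in> small_edges (r * k)" using e by (auto simp: small_edges_def)
  qed
qed

lemma card_large_components:
  assumes "k \<ge> 1"
  shows "card (component X ` large V k X) * k \<le> card V"
proof -
  let ?C = "component X ` large V k X"
  have sub: "K \<subseteq> V" if "K \<in> ?C" for K
    using that X_sub component_subset[of _ V X] by (auto simp: large_def)
  have finC: "finite ?C" using finV finite_subset[OF large_subset] by blast
  have "card ?C * k = (\<Sum>K\<in>?C. k)" by simp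
  also have "\<dots> \<le> (\<Sum>K\<in>?C. card K)"
    by (intro sum_mono) (auto simp: large_def)
  also have "\<dots> = card (\<Union>?C)"
  proof (rule card_Union_disjoint[symmetric])
    show "disjoint ?C"
      unfolding pairwise_def disjnt_def
    proof (intro ballI impI)
      fix K L assume "K \<in> ?C" "L \<in> ?C" "K \<noteq> L"
      then obtain u v where "K = component X u" "L = component X v" by auto
      with \<open>K \<noteq> L\<close> show "K \<inter> L = {}" using component_eq[of _ X u] component_eq[of _ X v] by blast
    qed
    show "finite K" if "K \<in> ?C" for K using sub[OF that] finV finite_subset by blast
  qed
  also have "\<dots> \<le> card V" using sub finV by (intro card_mono) auto
  finally show ?thesis .
qed

lemma small_edges_sub: "uniform_edges V r (small_edges k)"
  using finV edges r3 by unfold_locales (auto simp: small_edges_def)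

text \<open>Dropping the edges at large vertices isolates those vertices and leaves every smaller
  component untouched.\<close>

lemma ncomp_small_edges:
  "ncomp V (small_edges k) = card (large V k X) + card (component X ` (V - large V k X))"
proof -
  let ?L = "large V k X" and ?Y = "small_edges k"
  have YX: "?Y \<subseteq> X" by (auto simp: small_edges_def)
  have L: "component ?Y v = {v}" if "v \<in> ?L" for v
    using that by (intro component_isolated) (auto simp: small_edges_def)
  have S: "component ?Y v = component X v" if "v \<in> V - ?L" for v
  proof
    show "component ?Y v \<subseteq> component X v" by (rule component_mono[OF YX])
    show "component X v \<subseteq> component ?Y v"
    proof
      fix w assume w: "w \<in> component X v"
      then have "(v, w) \<in> {(a, b). \<exists>e\<in>X. a \<in> e \<and> b \<in> e}\<^sup>*" by (simp add: component_def)
      then show "w \<in> component ?Y v"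
      proof (induction rule: rtrancl_induct)
        case (step y z)
        then obtain e where e: "e \<in> X" "y \<in> e" "z \<in> e" by auto
        have y: "y \<in> component X v" using step.IH component_mono[OF YX] by auto
        have "e \<inter> ?L = {}"
        proof (rule ccontr)
          assume "e \<inter> ?L \<noteq> {}"
          then obtain a where a: "a \<in> e" "a \<in> ?L" by auto
          then have "a \<in> component X v" using component_closed[OF e(1,2) y] by auto
          then have "v \<in> component X a" by (rule component_sym)
          then show False using large_component[OF a(2)] that by auto
        qed
        then have "e \<in> ?Y" using e by (simp add: small_edges_def)
        then show ?case using step.IH e component_trans[OF step.IH component_edge] by metis
      qed simp
    qed
  qed
  have "component ?Y ` V = component ?Y ` ?L \<union> component ?Y ` (V - ?L)"
    using large_subset[of V k X] by (auto simp: image_Un[symmetric] Un_absorb1)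
  moreover have "component ?Y ` (V - ?L) = component X ` (V - ?L)"
    using S by (intro image_cong) auto
  moreover have "component ?Y ` ?L = (\<lambda>v. {v}) ` ?L"
    using L by (intro image_cong) auto
  moreover have "(\<lambda>v. {v}) ` ?L \<inter> component X ` (V - ?L) = {}"
  proof (rule ccontr)
    assume "(\<lambda>v. {v}) ` ?L \<inter> component X ` (V - ?L) \<noteq> {}"
    then obtain u v where "u \<in> ?L" "v \<notin> ?L" "{u} = component X v" by blast
    then show False using component_refl[of v X] by auto
  qed
  moreover have "finite ?L" by (rule finite_subset[OF large_subset finV])
  ultimately have "ncomp V ?Y = card ((\<lambda>v. {v}) ` ?L) + card (component X ` (V - ?L))"
    unfolding ncomp_def using finV by (simp add: card_Un_disjoint)
  then show ?thesis by (simp add: card_image)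
qed

lemma ncomp_bounds: "ncomp V X \<le> card V" "card V \<le> ncomp V X + r * card X"
proof -
  show "ncomp V X \<le> card V" unfolding ncomp_def by (rule card_image_le[OF finV])
  have "card (\<Union>X) \<le> (\<Sum>e\<in>X. card e)" by (rule card_Union_le_sum_card)
  also have "\<dots> = r * card X" using edges by simp
  finally show "card V \<le> ncomp V X + r * card X"
    using ncomp_support[OF finV X_sub] by linarith
qed

text \<open>Adding the edges outside the core one at a time merges \<open>r\<close> components each time. This is used for
  the whole hypergraph and for its edges in components with fewer than \<open>k\<close> vertices; there are at most
  \<open>|V|/k\<close> other components.\<close>

lemma card_core_verts:
  assumes k: "k \<ge> 1"
  shows "\<bar>real (card (\<Union>(core X))) - (real (card (large V k X)) +
      (real r - 1) * (real (card (small_edges k)) + real (card (core X)) - real (card X)))\<bar>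
    \<le> real (card V) / k + (real r + 1) * (real (card (cyclic_edges k X)) + real (card (pendant_cyclic V k X)))"
proof -
  let ?C = "core X" and ?Y = "small_edges k" and ?L = "large V k X"
  let ?E = "cyclic_edges k X \<union> pendant_cyclic V k X"
  interpret Y: uniform_edges V r ?Y by (rule small_edges_sub)
  interpret C: uniform_edges V r ?C
    using finV edges r3 core_subset by unfold_locales auto
  interpret CY: uniform_edges V r "core ?Y"
    using finV Y.edges r3 core_subset[of ?Y] by unfold_locales auto
  have YX: "?Y \<subseteq> X" by (auto simp: small_edges_def)
  have finE: "finite ?E"
    using finX by (auto simp: cyclic_edges_def pendant_cyclic_def)
  \<comment> \<open>A core edge outside \<open>?E\<close> has two large vertices, a small edge none.
    So few core edges lie in small components, and \<open>core ?Y\<close>, being part of the core of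
    \<open>X\<close>, is small too.\<close>
  have err: "e \<in> ?E" if "e \<in> ?C" "e \<in> ?Y" for e
  proof (rule ccontr)
    assume "e \<notin> ?E"
    then have "2 \<le> card (e \<inter> large V k (X - {e}))" using core_not_attached that by auto
    moreover have "e \<inter> large V k (X - {e}) = {}"
      using that(2) large_remove by (auto simp: small_edges_def)
    ultimately show False by simp
  qed
  have "core ?Y \<subseteq> ?E" using err core_subset[of ?Y] core_mono[OF YX] by blast
  then have cY: "card (core ?Y) \<le> card ?E" using finE by (rule card_mono[rotated])
  have n1: "ncomp V ?C = ncomp V X + (r - 1) * card (X - ?C)"
    by (rule ncomp_core) (use finV edges r3 in auto)
  have n2: "ncomp V (core ?Y) = ncomp V ?Y + (r - 1) * card (?Y - core ?Y)"
    by (rule ncomp_core) (use finV Y.edges r3 in auto)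
  have n3: "ncomp V ?C + card (\<Union>?C) = card V + card (component ?C ` \<Union>?C)"
    by (rule ncomp_support[OF finV C.X_sub])
  have VL: "?L \<union> (V - ?L) = V" using large_subset[of V k X] by auto
  have "component X ` V = component X ` ?L \<union> component X ` (V - ?L)"
    by (simp only: image_Un[symmetric] VL)
  moreover have "component X ` ?L \<inter> component X ` (V - ?L) = {}"
    using large_component[of _ V k X] component_refl[of _ X] by fastforce
  moreover have finL: "finite ?L" by (rule finite_subset[OF large_subset finV])
  ultimately have n4: "ncomp V X = card (component X ` ?L) + card (component X ` (V - ?L))"
    unfolding ncomp_def using finV by (simp add: card_Un_disjoint)
  have n5: "ncomp V ?Y = card ?L + card (component X ` (V - ?L))"
    by (rule ncomp_small_edges)
  \<comment> \<open>\<open>core ?Y\<close> has few edges and so leaves nearly all vertices isolated;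
    \<nu> below measures the defect.\<close>
  have n6: "ncomp V (core ?Y) \<le> card V" "card V \<le> ncomp V (core ?Y) + r * card (core ?Y)"
    by (rule CY.ncomp_bounds)+
  \<comment> \<open>A component meeting the core is large or contains an edge of \<open>?E\<close>,
    and it contains only one component of the core.\<close>
  have n7: "card (component ?C ` \<Union>?C) \<le> card (component X ` ?L) + card ?E"
  proof -
    let ?K = "{K \<in> component X ` V. K \<inter> \<Union>?C \<noteq> {}}"
    let ?g = "\<lambda>e. component X (SOME v. v \<in> e)"
    have "?K \<subseteq> component X ` ?L \<union> ?g ` ?E"
    proof
      fix K assume "K \<in> ?K"
      then obtain v w e where v: "v \<in> V" "K = component X v" "w \<in> K" "w \<in> e" "e \<in> ?C" by auto
      show "K \<in> component X ` ?L \<union> ?g ` ?E"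
      proof (cases "v \<in> ?L")
        case False
        have eX: "e \<in> X" using v core_subset by auto
        have eK: "e \<subseteq> K" using component_closed[OF eX] v by auto
        have "e \<inter> ?L = {}"
        proof (rule ccontr)
          assume "e \<inter> ?L \<noteq> {}"
          then obtain a where "a \<in> ?L" "a \<in> component X v" using eK v by auto
          then show False using large_component[of a V k X v] component_sym v False by metis
        qed
        then have "e \<in> ?E" using err v eX by (auto simp: small_edges_def)
        moreover have "(SOME v. v \<in> e) \<in> e" using v(4) by (rule someI)
        then have "(SOME v. v \<in> e) \<in> component X v" using eK v(2) by blast
        then have "?g e = K" unfolding v(2) by (rule component_eq)
        ultimately show ?thesis by blast
      qed (use v in auto)
    qed
    then have "card ?K \<le> card (component X ` ?L \<union> ?g ` ?E)"
      using finL finE by (intro card_mono) auto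
    also have "\<dots> \<le> card (component X ` ?L) + card (?g ` ?E)" by (rule card_Un_le)
    also have "card (?g ` ?E) \<le> card ?E" by (rule card_image_le[OF finE])
    finally show ?thesis
      using card_core_components_le[OF finV X_sub] by linarith
  qed
  have n8: "real (card (component X ` ?L)) \<le> card V / k"
    using card_large_components[OF k] k
    by (simp add: pos_le_divide_eq of_nat_mult[symmetric] del: of_nat_mult)
  have c1: "real (card (X - ?C)) = real (card X) - real (card ?C)"
    using core_subset[of X] finX by (simp add: card_Diff_subset finite_subset card_mono of_nat_diff)
  have c2: "real (card (?Y - core ?Y)) = real (card ?Y) - real (card (core ?Y))"
    using core_subset[of ?Y] Y.finX by (simp add: card_Diff_subset finite_subset card_mono of_nat_diff)
  have E: "real (card ?E) \<le> real (card (cyclic_edges k X)) + real (card (pendant_cyclic V k X))"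
    using card_Un_le[of "cyclic_edges k X" "pendant_cyclic V k X"] by linarith
  define \<kappa> l c where "\<kappa> = real (card (component ?C ` \<Union>?C))" and "l = real (card (component X ` ?L))"
    and "c = real (card (core ?Y))"
  define \<nu> where "\<nu> = real (card V) - real (ncomp V (core ?Y))"
  have r1: "real (r - 1) = real r - 1" using r3 by simp
  have m1: "real (ncomp V ?C) = real (ncomp V X) + (real r - 1) * (real (card X) - real (card ?C))"
    unfolding n1 using c1 r1 by simp
  have m2: "real (ncomp V (core ?Y)) = real (ncomp V ?Y) + (real r - 1) * (real (card ?Y) - c)"
    unfolding n2 c_def using c2 r1 by simp
  have m3: "real (card (\<Union>?C)) = real (card V) + \<kappa> - real (ncomp V ?C)"
    unfolding \<kappa>_def using n3 by linarith
  \<comment> \<open>Subtracting the count for \<open>?Y\<close> from the count for \<open>X\<close>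
    cancels the unknown number of components with fewer than \<open>k\<close> vertices.\<close>
  have eq: "real (card (\<Union>?C)) - (real (card ?L) +
      (real r - 1) * (real (card ?Y) + real (card ?C) - real (card X))) = \<kappa> - l + \<nu> - (real r - 1) * c"
    using m1 m2 m3 n4 n5 by (simp add: \<nu>_def l_def algebra_simps)
  have "0 \<le> \<nu>" "\<nu> \<le> real r * c"
    unfolding \<nu>_def c_def using n6 by (simp_all add: of_nat_mult[symmetric] of_nat_add[symmetric] del: of_nat_mult of_nat_add)
  moreover have "0 \<le> \<kappa>" "0 \<le> l" "\<kappa> \<le> l + real (card ?E)" "0 \<le> c" "c \<le> real (card ?E)" "l \<le> card V / k"
    using n7 n8 cY by (auto simp: \<kappa>_def l_def c_def)
  moreover have "real r * c \<le> real r * real (card ?E)" "(real r - 1) * c \<le> (real r - 1) * real (card ?E)" "0 \<le> (real r - 1) * c"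
    using \<open>0 \<le> c\<close> \<open>c \<le> real (card ?E)\<close> r3 by (auto intro!: mult_left_mono mult_nonneg_nonneg)
  moreover have "(real r + 1) * real (card ?E) \<le> (real r + 1) * (real (card (cyclic_edges k X)) + real (card (pendant_cyclic V k X)))"
    using E by (intro mult_left_mono) auto
  ultimately show ?thesis unfolding eq abs_le_iff by (simp add: algebra_simps)
qed

text \<open>Deleting the edges at \<open>v\<close> isolates it, so \<open>v\<close> is missing from
  the component of \<open>u\<close> there and adds one vertex to it.\<close>

lemma star_lower:
  assumes "e \<in> X" "v \<in> e" "u \<in> e" "u \<noteq> v" "u \<in> large V k {e \<in> X. v \<notin> e}"
  shows "v \<in> large V (k + 1) X"
proof -
  let ?Y = "{e \<in> X. v \<notin> e}"
  have v: "v \<in> V" using assms edges by auto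
  have "component ?Y v = {v}" by (rule component_isolated) auto
  then have nv: "v \<notin> component ?Y u" using component_sym[of v ?Y u] assms by auto
  have "u \<in> component X v" using assms by (auto intro: component_edge)
  then have "component X u = component X v" by (rule component_eq)
  then have ins: "insert v (component ?Y u) \<subseteq> component X v"
    using component_mono[of ?Y X u] by auto
  moreover have fin: "finite (component X v)"
    using component_subset[OF v X_sub] finV finite_subset by blast
  ultimately have "card (insert v (component ?Y u)) \<le> card (component X v)" by (intro card_mono)
  moreover have "finite (component ?Y u)"
    using finite_subset[OF ins fin] by simp
  ultimately show ?thesis using nv v assms(5) by (simp add: large_def)
qed

text \<open>The component of \<open>v\<close> consists of \<open>v\<close> and the components
  hanging from its fewer than \<open>m\<close> edges, at most \<open>r\<close> per edge with at most
  \<open>k\<close> vertices each. The cap on the degree is paid for by a Markov term later.\<close>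

lemma star_upper:
  assumes v: "v \<in> V" and k: "k \<ge> 1" and m: "card {e \<in> X. v \<in> e} < m"
    and no: "\<And>e. e \<in> X \<Longrightarrow> v \<in> e \<Longrightarrow> e \<inter> (large V k {e \<in> X. v \<notin> e} - {v}) = {}"
  shows "v \<notin> large V (m * r * k + 1) X"
proof -
  let ?Y = "{e \<in> X. v \<notin> e}" and ?S = "{e \<in> X. v \<in> e}"
  let ?R = "insert v (\<Union>e\<in>?S. \<Union>u\<in>e - {v}. component ?Y u)"
  have "component X v \<subseteq> ?R"
  proof
    fix w assume "w \<in> component X v"
    then have "(v, w) \<in> {(a, b). \<exists>e\<in>X. a \<in> e \<and> b \<in> e}\<^sup>*" by (simp add: component_def)
    then show "w \<in> ?R"
    proof (induction rule: rtrancl_induct)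
      case (step y z)
      then obtain e where e: "e \<in> X" "y \<in> e" "z \<in> e" by auto
      show ?case
      proof (cases "v \<in> e")
        case True
        then show ?thesis using e component_refl[of z ?Y] by blast
      next
        case False
        then obtain e' u where u: "e' \<in> ?S" "u \<in> e' - {v}" "y \<in> component ?Y u"
          using step.IH e by auto
        have "z \<in> component ?Y u"
          using component_closed[of e ?Y y u] e False u by auto
        then show ?thesis using u by blast
      qed
    qed simp
  qed
  moreover have finS: "finite ?S" using finX by auto
  have small: "card (component ?Y u) \<le> k" "finite (component ?Y u)" if "e \<in> ?S" "u \<in> e - {v}" for e u
  proof -
    have "u \<in> V" "u \<notin> large V k ?Y" using that no[of e] edges by auto
    then show "card (component ?Y u) \<le> k" by (auto simp: large_def)
    show "finite (component ?Y u)"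
      using component_subset[OF \<open>u \<in> V\<close>, of ?Y] edges finV by (auto intro: finite_subset)
  qed
  moreover have finR: "finite ?R" using finS small(2) fin_edge by auto
  ultimately have "card (component X v) \<le> card ?R" by (intro card_mono)
  also have "\<dots> \<le> 1 + card (\<Union>e\<in>?S. \<Union>u\<in>e - {v}. component ?Y u)"
    using finR by (simp add: card_insert_if)
  also have "card (\<Union>e\<in>?S. \<Union>u\<in>e - {v}. component ?Y u) \<le> (\<Sum>e\<in>?S. card (\<Union>u\<in>e - {v}. component ?Y u))"
    by (rule card_UN_le[OF finS])
  also have "\<dots> \<le> (\<Sum>e\<in>?S. r * k)"
  proof (rule sum_mono)
    fix e assume e: "e \<in> ?S"
    have "card (\<Union>u\<in>e - {v}. component ?Y u) \<le> (\<Sum>u\<in>e - {v}. card (component ?Y u))"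
      using e fin_edge by (intro card_UN_le) auto
    also have "\<dots> \<le> (\<Sum>u\<in>e - {v}. k)" by (intro sum_mono small(1)[OF e])
    also have "\<dots> \<le> r * k" using e edges fin_edge by (auto intro!: mult_right_mono)
    finally show "card (\<Union>u\<in>e - {v}. component ?Y u) \<le> r * k" .
  qed
  also have "\<dots> = card ?S * (r * k)" by simp
  finally have "card (component X v) \<le> 1 + card ?S * (r * k)" by simp
  also have "\<dots> \<le> Suc (card ?S) * (r * k)" using k r3 by simp
  also have "\<dots> \<le> m * (r * k)" using m by (intro mult_right_mono) auto
  finally show ?thesis by (simp add: large_def mult.assoc)
qed

end

text \<open>A component with \<open>c \<ge> k\<close> vertices contributes \<open>1 - c/k\<close> to the potential, so joining two such
  components lowers it by one.\<close>

definition potential :: "'a set \<Rightarrow> nat \<Rightarrow> 'a set set \<Rightarrow> real" where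
  "potential V k X = (\<Sum>v\<in>V. min 0 (1 / card (component X v) - 1 / k))"

text \<open>The whole range has length \<open>card V / k\<close>: this is the budget for merging
  large components.\<close>

lemma potential_bounds:
  assumes "finite V" "k \<ge> 1"
  shows "potential V k X \<le> 0" "- (card V / k) \<le> potential V k X"
proof -
  show "potential V k X \<le> 0" unfolding potential_def by (intro sum_nonpos) auto
  have "- (card V / k) = (\<Sum>v\<in>V. - (1 / k))" by simp
  also have "\<dots> \<le> potential V k X"
    unfolding potential_def by (intro sum_mono) auto
  finally show "- (card V / k) \<le> potential V k X" .
qed

context
  fixes V :: "'a set" and X Y :: "'a set set"
  assumes fin: "finite V" and XY: "X \<subseteq> Y" and Y: "\<Union>Y \<subseteq> V"
begin

lemma potential_term_mono:
  assumes "v \<in> V"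
  shows "min 0 (1 / card (component Y v) - 1 / real k) \<le> min 0 (1 / card (component X v) - 1 / real k)"
proof -
  have sub: "component X v \<subseteq> component Y v" "component Y v \<subseteq> V"
    using component_mono[OF XY] component_subset[OF assms Y] by auto
  then have "card (component X v) \<le> card (component Y v)" "finite (component X v)"
    using fin by (meson card_mono finite_subset)+
  moreover have "card (component X v) > 0"
    using calculation(2) component_refl[of v X] by (metis card_gt_0_iff empty_iff)
  ultimately have "1 / real (card (component Y v)) \<le> 1 / real (card (component X v))"
    by (intro divide_left_mono) auto
  then show ?thesis by auto
qed

lemma potential_antimono: "potential V k Y \<le> potential V k X"
  unfolding potential_def by (intro sum_mono potential_term_mono)

lemma potential_drop:
  assumes f: "f \<in> Y" and u: "u \<in> f" "u \<in> large V k X" and w: "w \<in> f" "w \<in> large V k X"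
    and sep: "w \<notin> component X u" and k: "k \<ge> 1"
  shows "potential V k Y \<le> potential V k X - 1"
proof -
  let ?U = "component X u" and ?W = "component X w"
  let ?t = "\<lambda>X v. min 0 (1 / card (component X v) - 1 / real k)"
  have uV: "u \<in> V" "w \<in> V" using u w by (auto simp: large_def)
  have sub: "?U \<subseteq> V" "?W \<subseteq> V"
    using uV XY Y by (intro component_subset; blast)+
  then have finU: "finite ?U" "finite ?W" using fin finite_subset by auto
  have disj: "?U \<inter> ?W = {}" using sep component_eq[of _ X u] component_eq[of _ X w] component_refl[of w X] by blast
  define a b where "a = card ?U" and "b = card ?W"
  have ab: "a \<ge> k" "b \<ge> k" using u w by (auto simp: a_def b_def large_def)
  have big: "?U \<union> ?W \<subseteq> component Y z" if "z \<in> ?U \<union> ?W" for z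
  proof -
    have "w \<in> component Y u" using component_edge[OF f] u w by auto
    then have "component Y w = component Y u" by (rule component_eq)
    moreover have "?U \<subseteq> component Y u" "?W \<subseteq> component Y w" by (auto intro!: component_mono[OF XY, THEN subsetD])
    ultimately show ?thesis using that component_eq[of z Y u] by auto
  qed
  have new: "?t Y z \<le> 1 / (a + b) - 1 / k" if "z \<in> ?U \<union> ?W" for z
  proof -
    have "z \<in> V" using that sub by auto
    then have "finite (component Y z)" using component_subset[OF _ Y] fin finite_subset by blast
    then have "card (?U \<union> ?W) \<le> card (component Y z)" using big[OF that] by (rule card_mono)
    then have "a + b \<le> card (component Y z)" unfolding a_def b_def
      using disj finU by (simp add: card_Un_disjoint)
    then have "1 / real (card (component Y z)) \<le> 1 / real (a + b)"
      using ab k by (intro divide_left_mono) auto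
    then show ?thesis by auto
  qed
  have old: "?t X z = 1 / c - 1 / k" if "card (component X z) = c" "c \<ge> k" for z c
  proof -
    have "1 / real c \<le> 1 / real k" using that k by (intro divide_left_mono) auto
    then show ?thesis using that by auto
  qed
  have "(\<Sum>z\<in>?U \<union> ?W. ?t Y z) \<le> (\<Sum>z\<in>?U \<union> ?W. 1 / (a + b) - 1 / k)"
    by (intro sum_mono new)
  also have "\<dots> = real (a + b) * (1 / (a + b) - 1 / k)"
    using disj finU by (simp add: card_Un_disjoint a_def b_def)
  also have "\<dots> = 1 - (a + b) / k" using ab k by (simp add: right_diff_distrib)
  finally have n: "(\<Sum>z\<in>?U \<union> ?W. ?t Y z) \<le> 1 - (a + b) / k" .
  have "(\<Sum>z\<in>?U. ?t X z) = (\<Sum>z\<in>?U. 1 / a - 1 / k)"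
    using ab by (intro sum.cong old) (auto simp: a_def component_eq)
  also have "\<dots> = 1 - a / k" using ab k by (simp add: a_def[symmetric] right_diff_distrib)
  finally have oU: "(\<Sum>z\<in>?U. ?t X z) = 1 - a / k" .
  have "(\<Sum>z\<in>?W. ?t X z) = (\<Sum>z\<in>?W. 1 / b - 1 / k)"
    using ab by (intro sum.cong old) (auto simp: b_def component_eq)
  also have "\<dots> = 1 - b / k" using ab k by (simp add: b_def[symmetric] right_diff_distrib)
  finally have oW: "(\<Sum>z\<in>?W. ?t X z) = 1 - b / k" .
  have split: "potential V k Z = (\<Sum>z\<in>V - (?U \<union> ?W). ?t Z z) + (\<Sum>z\<in>?U \<union> ?W. ?t Z z)" for Z
    unfolding potential_def using sub fin by (intro sum.subset_diff) auto
  have "(\<Sum>z\<in>V - (?U \<union> ?W). ?t Y z) \<le> (\<Sum>z\<in>V - (?U \<union> ?W). ?t X z)"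
    by (intro sum_mono potential_term_mono) auto
  moreover have "(\<Sum>z\<in>?U \<union> ?W. ?t X z) = (\<Sum>z\<in>?U. ?t X z) + (\<Sum>z\<in>?W. ?t X z)"
    using finU disj by (intro sum.union_disjoint)
  ultimately show ?thesis
    using n oU oW split[of X] split[of Y] by (simp add: add_divide_distrib)
qed

end

section \<open>Identification with the loose core\<close>

text \<open>Positive minimum degree forces the vertex set to be the union of the edges. The
  admissible subhypergraphs thus correspond to the nonempty loose edge sets, whose largest member is
  \<open>core X\<close>.\<close>

lemma loose_core_eq:
  assumes fin: "finite V" and sub: "\<And>e. e \<in> X \<Longrightarrow> e \<subseteq> V"
  shows "loose_core (V, X) = (\<Union>(core X), core X)"
proof -
  have finX: "finite X"
  proof -
    have "X \<subseteq> Pow V" using sub by auto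
    then show ?thesis using fin by (meson finite_Pow_iff finite_subset)
  qed
  let ?H = "(V, X)"
  have finH: "finite (verts ?H)" "finite (edges ?H)" using fin finX by auto
  have conn: "2 \<le> conn_num K e \<longleftrightarrow> (\<exists>u w. u \<noteq> w \<and> linked (edges K) e u \<and> linked (edges K) e w)"
    if K: "edges K \<subseteq> X" "e \<in> edges K" for K e
  proof -
    have fe: "finite e" using K sub fin finite_subset by blast
    have finK: "finite (edges K)" using K finX finite_subset by auto
    have d: "2 \<le> deg K v \<longleftrightarrow> linked (edges K) e v" if "v \<in> e" for v
    proof -
      have "2 \<le> deg K v \<longleftrightarrow> (\<exists>f\<in>{e \<in> edges K. v \<in> e}. \<exists>g\<in>{e \<in> edges K. v \<in> e}. f \<noteq> g)"
        unfolding deg_def using finK by (subst two_le_card_iff) auto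
      also have "\<dots> \<longleftrightarrow> linked (edges K) e v" using that K(2) unfolding linked_def by blast
      finally show ?thesis .
    qed
    have "{v \<in> e. deg K v \<ge> 2} = {v. linked (edges K) e v}"
    proof (rule Collect_cong)
      show "(v \<in> e \<and> 2 \<le> deg K v) = linked (edges K) e v" for v
        using d[of v] by (cases "v \<in> e") (simp_all add: linked_def)
    qed
    moreover have "finite {v. linked (edges K) e v}"
      using fe by (rule finite_subset[rotated]) (auto simp: linked_def)
    ultimately show ?thesis unfolding conn_num_def by (simp only: two_le_card_iff) blast
  qed
  have deg1: "1 \<le> deg K v \<longleftrightarrow> v \<in> \<Union>(edges K)" if "edges K \<subseteq> X" for K v
  proof -
    have "finite {e \<in> edges K. v \<in> e}" using finite_subset[OF that finX] by simp
    then show ?thesis unfolding deg_def by (auto simp: Suc_le_eq card_gt_0_iff)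
  qed
  have iff: "loose_subhypergraph ?H K \<longleftrightarrow>
      edges K \<subseteq> X \<and> verts K = \<Union>(edges K) \<and> edges K \<noteq> {} \<and> loose (edges K)" for K
  proof
    assume "loose_subhypergraph ?H K"
    then have K: "subhypergraph K ?H" "verts K \<noteq> {}" "\<forall>v\<in>verts K. deg K v \<ge> 1" "\<forall>e\<in>edges K. conn_num K e \<ge> 2"
      unfolding loose_subhypergraph_iff[OF finH] by auto
    have s: "edges K \<subseteq> X" using K by (simp add: subhypergraph_def)
    have "verts K = \<Union>(edges K)" using K deg1[OF s] by (auto simp: subhypergraph_def)
    moreover have "loose (edges K)"
      unfolding loose_def by (intro ballI conn[OF s, THEN iffD1] K(4)[rule_format])
    ultimately show "edges K \<subseteq> X \<and> verts K = \<Union>(edges K) \<and> edges K \<noteq> {} \<and> loose (edges K)"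
      using s K(2) by auto
  next
    assume K: "edges K \<subseteq> X \<and> verts K = \<Union>(edges K) \<and> edges K \<noteq> {} \<and> loose (edges K)"
    then have s: "edges K \<subseteq> X" by auto
    have "subhypergraph K ?H" using K sub by (auto simp: subhypergraph_def)
    moreover have "verts K \<noteq> {}"
    proof -
      obtain e where "e \<in> edges K" using K by auto
      moreover from this K obtain u where "linked (edges K) e u" unfolding loose_def by blast
      ultimately show ?thesis using K by (auto simp: linked_def)
    qed
    moreover have "\<forall>v\<in>verts K. deg K v \<ge> 1" using K deg1[OF s] by auto
    moreover have "\<forall>e\<in>edges K. conn_num K e \<ge> 2"
      using K unfolding loose_def by (intro ballI conn[OF s, THEN iffD2]) blast+
    ultimately show "loose_subhypergraph ?H K" unfolding loose_subhypergraph_iff[OF finH] by auto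
  qed
  show ?thesis
  proof (cases "core X = {}")
    case True
    have "\<not> loose_subhypergraph ?H K" for K
    proof
      assume "loose_subhypergraph ?H K"
      then have "edges K \<subseteq> core X" "edges K \<noteq> {}"
        using core_greatest[of "edges K" X] unfolding iff by auto
      then show False using True by simp
    qed
    then show ?thesis using True by (simp add: loose_core_def)
  next
    case False
    let ?C = "(\<Union>(core X), core X)"
    have C: "loose_subhypergraph ?H ?C" unfolding iff using False core_subset loose_core_edges by auto
    have "L = ?C" if L: "loose_subhypergraph ?H L" "subhypergraph ?C L" for L
    proof -
      have "edges L \<subseteq> core X" using L(1) core_greatest unfolding iff by blast
      then have "edges L = core X" using L(2) by (auto simp: subhypergraph_def)
      then show ?thesis using L(1) unfolding iff by (simp add: prod_eq_iff)
    qed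
    then have "maximal_loose_subhypergraph ?H ?C" unfolding maximal_loose_subhypergraph_def using C by blast
    moreover have "\<exists>!K. maximal_loose_subhypergraph ?H K"
      using ex1_maximal_loose_subhypergraph[OF finH] C by blast
    ultimately have "(THE K. maximal_loose_subhypergraph ?H K) = ?C" by (intro the1_equality)
    then show ?thesis using C unfolding loose_core_def by auto
  qed
qed

section \<open>Moments for a fixed number of vertices\<close>

lemma card_subsets_containing_avoiding:
  assumes "finite V" "D \<subseteq> V" "T \<subseteq> V" "D \<inter> T = {}" "card D \<le> r"
  shows "card {e. e \<subseteq> V \<and> card e = r \<and> D \<subseteq> e \<and> e \<inter> T = {}} = (card V - card D - card T) choose (r - card D)"
proof -
  have fin: "finite D" "finite T" using assms(1-3) by (auto intro: finite_subset[OF _ assms(1)])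
  let ?W = "V - D - T"
  have "bij_betw (\<lambda>e. e - D) {e. e \<subseteq> V \<and> card e = r \<and> D \<subseteq> e \<and> e \<inter> T = {}}
     {f. f \<subseteq> ?W \<and> card f = r - card D}"
  proof (rule bij_betw_byWitness[where f' = "\<lambda>f. f \<union> D"])
    show "(\<lambda>e. e - D) ` {e. e \<subseteq> V \<and> card e = r \<and> D \<subseteq> e \<and> e \<inter> T = {}} \<subseteq> {f. f \<subseteq> ?W \<and> card f = r - card D}"
      using fin by (auto simp: card_Diff_subset)
    show "(\<lambda>f. f \<union> D) ` {f. f \<subseteq> ?W \<and> card f = r - card D} \<subseteq> {e. e \<subseteq> V \<and> card e = r \<and> D \<subseteq> e \<and> e \<inter> T = {}}"
    proof
      fix e assume "e \<in> (\<lambda>f. f \<union> D) ` {f. f \<subseteq> ?W \<and> card f = r - card D}"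
      then obtain f where f: "e = f \<union> D" "f \<subseteq> ?W" "card f = r - card D" by auto
      have "finite f" using f assms(1) by (meson finite_Diff finite_subset)
      then have "card e = card f + card D"
        unfolding f(1) using f fin by (intro card_Un_disjoint) auto
      then show "e \<in> {e. e \<subseteq> V \<and> card e = r \<and> D \<subseteq> e \<and> e \<inter> T = {}}"
        using f assms by auto
    qed
  qed auto
  then have "card {e. e \<subseteq> V \<and> card e = r \<and> D \<subseteq> e \<and> e \<inter> T = {}} = card {f. f \<subseteq> ?W \<and> card f = r - card D}"
    by (rule bij_betw_same_card)
  also have "\<dots> = card ?W choose (r - card D)"
    using assms(1) by (intro n_subsets) auto
  also have "card ?W = card (V - D) - card T"
    using assms fin by (intro card_Diff_subset) auto
  also have "card (V - D) = card V - card D"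
    using assms fin by (intro card_Diff_subset)
  finally show ?thesis .
qed

lemma card_subsets_meeting:
  assumes "finite V" "T \<subseteq> V" "j \<le> r"
  shows "card {e. e \<subseteq> V \<and> card e = r \<and> card (e \<inter> T) = j} = (card T choose j) * ((card V - card T) choose (r - j))"
proof -
  have fin: "finite T" by (rule finite_subset[OF assms(2,1)])
  have "bij_betw (\<lambda>e. (e \<inter> T, e - T)) {e. e \<subseteq> V \<and> card e = r \<and> card (e \<inter> T) = j}
     ({f. f \<subseteq> T \<and> card f = j} \<times> {g. g \<subseteq> V - T \<and> card g = r - j})"
  proof (rule bij_betw_byWitness[where f' = "\<lambda>(f, g). f \<union> g"])
    show "(\<lambda>e. (e \<inter> T, e - T)) ` {e. e \<subseteq> V \<and> card e = r \<and> card (e \<inter> T) = j} \<subseteq>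
        {f. f \<subseteq> T \<and> card f = j} \<times> {g. g \<subseteq> V - T \<and> card g = r - j}"
      using fin by (auto simp: card_Diff_subset_Int)
    show "(\<lambda>(f, g). f \<union> g) ` ({f. f \<subseteq> T \<and> card f = j} \<times> {g. g \<subseteq> V - T \<and> card g = r - j})
       \<subseteq> {e. e \<subseteq> V \<and> card e = r \<and> card (e \<inter> T) = j}"
    proof
      fix e assume "e \<in> (\<lambda>(f, g). f \<union> g) ` ({f. f \<subseteq> T \<and> card f = j} \<times> {g. g \<subseteq> V - T \<and> card g = r - j})"
      then obtain f g where f: "e = f \<union> g" "f \<subseteq> T" "card f = j" "g \<subseteq> V - T" "card g = r - j" by auto
      have "finite f" "finite g" using f fin assms(1) by (meson finite_Diff finite_subset)+
      then have "card e = card f + card g"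
        unfolding f(1) using f by (intro card_Un_disjoint) auto
      moreover have "e \<inter> T = f" using f by auto
      ultimately show "e \<in> {e. e \<subseteq> V \<and> card e = r \<and> card (e \<inter> T) = j}"
        using f assms by auto
    qed
  qed auto
  then have "card {e. e \<subseteq> V \<and> card e = r \<and> card (e \<inter> T) = j} =
     card ({f. f \<subseteq> T \<and> card f = j} \<times> {g. g \<subseteq> V - T \<and> card g = r - j})"
    by (rule bij_betw_same_card)
  also have "\<dots> = (card T choose j) * (card (V - T) choose (r - j))"
    using fin assms(1) by (simp add: card_cartesian_product n_subsets)
  finally show ?thesis using assms fin by (simp add: card_Diff_subset)
qed

section \<open>Random uniform hypergraph on a fixed vertex set\<close>

definition rsets :: "'a set \<Rightarrow> nat \<Rightarrow> 'a set set" where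
  "rsets V r = {e. e \<subseteq> V \<and> card e = r}"

definition apart :: "'a set \<Rightarrow> nat \<Rightarrow> 'a set set \<Rightarrow> ('a \<times> 'a) set" where
  "apart V k X = {(u, w). u \<in> large V k X \<and> w \<in> large V k X \<and> w \<notin> component X u}"

locale vertex_set =
  fixes V :: "'a set" and r :: nat
  assumes finV: "finite V" and r3: "r \<ge> 3" and nr: "card V \<ge> r"
begin

abbreviation "A \<equiv> rsets V r"
abbreviation "n \<equiv> card V"
abbreviation "N \<equiv> (n - 1) choose (r - 1)"
abbreviation "N2 \<equiv> (n - 2) choose (r - 2)"

lemma A_sub: "A \<subseteq> Pow V" by (auto simp: rsets_def)

lemma finA: "finite A"
  using A_sub finV by (meson finite_Pow_iff finite_subset)

lemma uniform: "X \<subseteq> A \<Longrightarrow> uniform_edges V r X"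
  using finV r3 by unfold_locales (auto simp: rsets_def)

lemma card_A: "card A = n choose r"
  unfolding rsets_def by (rule n_subsets[OF finV])

lemma card_A_N: "r * card A = n * N"
  unfolding card_A using r3 nr by (simp add: times_binomial_minus1_eq)

lemma N2_N: "(n - 1) * N2 = (r - 1) * N"
  using times_binomial_minus1_eq[of "r - 1" "n - 1"] r3 nr by (simp add: numeral_2_eq_2)

lemma N_pos: "N > 0" and N2_pos: "N2 > 0"
  using nr by (auto simp: zero_less_binomial_iff)

lemma card_star: "u \<in> V \<Longrightarrow> card {e \<in> A. u \<in> e} = N"
  using card_subsets_containing_avoiding[OF finV, of "{u}" "{}" r] r3
  by (simp add: rsets_def conj_ac)

lemma card_pair: "u \<in> V \<Longrightarrow> w \<in> V \<Longrightarrow> u \<noteq> w \<Longrightarrow> card {e \<in> A. u \<in> e \<and> w \<in> e} = N2"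
  using card_subsets_containing_avoiding[OF finV, of "{u, w}" "{}" r] r3
  by (simp add: rsets_def conj_ac numeral_2_eq_2)

lemma card_star_meeting:
  assumes "v \<in> V" "T \<subseteq> V" "v \<notin> T"
  shows "card {e \<in> A. v \<in> e \<and> e \<inter> T \<noteq> {}} = N - ((n - 1 - card T) choose (r - 1))"
proof -
  let ?U = "{e. e \<subseteq> V \<and> card e = r \<and> {v} \<subseteq> e \<and> e \<inter> T = {}}"
  have "{e \<in> A. v \<in> e \<and> e \<inter> T \<noteq> {}} = {e \<in> A. v \<in> e} - ?U"
    by (auto simp: rsets_def)
  moreover have "card ({e \<in> A. v \<in> e} - ?U) = card {e \<in> A. v \<in> e} - card ?U"
    using finV by (intro card_Diff_subset) (auto simp: rsets_def)
  moreover have "card ?U = (n - card {v} - card T) choose (r - card {v})"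
  proof (rule card_subsets_containing_avoiding[OF finV])
    show "{v} \<subseteq> V" "T \<subseteq> V" "{v} \<inter> T = {}" using assms by blast+
    show "card {v} \<le> r" using r3 by simp
  qed
  moreover have "card {v} = 1" by simp
  ultimately show ?thesis by (simp only: card_star[OF assms(1)])
qed

lemma card_edges_with_pair_le:
  assumes "Q \<subseteq> V \<times> V" "\<And>u. (u, u) \<notin> Q"
  shows "card {e \<in> A. \<exists>u\<in>e. \<exists>w\<in>e. (u, w) \<in> Q} \<le> card Q * N2"
proof -
  have finQ: "finite Q" using finite_subset[OF assms(1)] finV by simp
  have "{e \<in> A. \<exists>u\<in>e. \<exists>w\<in>e. (u, w) \<in> Q} \<subseteq> (\<Union>q\<in>Q. {e \<in> A. fst q \<in> e \<and> snd q \<in> e})" by force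
  then have "card {e \<in> A. \<exists>u\<in>e. \<exists>w\<in>e. (u, w) \<in> Q} \<le> card (\<Union>q\<in>Q. {e \<in> A. fst q \<in> e \<and> snd q \<in> e})"
    using finQ finA by (intro card_mono) auto
  also have "\<dots> \<le> (\<Sum>q\<in>Q. card {e \<in> A. fst q \<in> e \<and> snd q \<in> e})" by (rule card_UN_le[OF finQ])
  also have "\<dots> = (\<Sum>q\<in>Q. N2)"
  proof (rule sum.cong[OF refl])
    fix q assume "q \<in> Q"
    then show "card {e \<in> A. fst q \<in> e \<and> snd q \<in> e} = N2"
      using assms by (cases q) (auto intro!: card_pair)
  qed
  finally show ?thesis by simp
qed

text \<open>Double counting: a pair lies in \<open>N2\<close> potential edges, an edge contains at
  most \<open>r\<^sup>2\<close> ordered pairs. This direction turns few merging edges into few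
  separated pairs.\<close>

lemma card_edges_with_pair_ge:
  assumes "Q \<subseteq> V \<times> V" "\<And>u. (u, u) \<notin> Q"
  shows "card Q * N2 \<le> r\<^sup>2 * card {e \<in> A. \<exists>u\<in>e. \<exists>w\<in>e. (u, w) \<in> Q}"
proof -
  let ?B = "{e \<in> A. \<exists>u\<in>e. \<exists>w\<in>e. (u, w) \<in> Q}"
  have finQ: "finite Q" using finite_subset[OF assms(1)] finV by simp
  have "card Q * N2 = (\<Sum>q\<in>Q. card {e \<in> A. fst q \<in> e \<and> snd q \<in> e})"
  proof -
    have "card {e \<in> A. fst q \<in> e \<and> snd q \<in> e} = N2" if "q \<in> Q" for q
      using assms that by (cases q) (auto intro!: card_pair)
    then show ?thesis by simp
  qed
  also have "\<dots> = (\<Sum>q\<in>Q. \<Sum>e\<in>A. of_bool (fst q \<in> e \<and> snd q \<in> e))"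
    using finA by (intro sum.cong refl) (simp add: sum_of_bool_eq Int_def)
  also have "\<dots> = (\<Sum>e\<in>A. \<Sum>q\<in>Q. of_bool (fst q \<in> e \<and> snd q \<in> e))" by (rule sum.swap)
  also have "\<dots> = (\<Sum>e\<in>?B. \<Sum>q\<in>Q. of_bool (fst q \<in> e \<and> snd q \<in> e))"
    using finA by (intro sum.mono_neutral_right) (force intro!: sum.neutral)+
  also have "\<dots> \<le> (\<Sum>e\<in>?B. r\<^sup>2)"
  proof (rule sum_mono)
    fix e assume "e \<in> ?B"
    then have e: "finite e" "card e = r" using finite_subset[OF _ finV] by (auto simp: rsets_def)
    have "(\<Sum>q\<in>Q. of_bool (fst q \<in> e \<and> snd q \<in> e)) = card (Q \<inter> {q. fst q \<in> e \<and> snd q \<in> e})"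
      using finQ by (simp add: sum_of_bool_eq)
    also have "\<dots> \<le> card (e \<times> e)" using e by (intro card_mono) auto
    finally show "(\<Sum>q\<in>Q. of_bool (fst q \<in> e \<and> snd q \<in> e)) \<le> r\<^sup>2"
      using e by (simp add: card_cartesian_product power2_eq_square)
  qed
  finally show ?thesis by (simp add: mult.commute)
qed

lemma card_filter_eq_sum: "finite X \<Longrightarrow> real (card {e \<in> X. P e}) = (\<Sum>e\<in>X. of_bool (P e))"
  by (simp add: sum_of_bool_eq Int_def)

context
  fixes p :: real
  assumes p0: "0 \<le> p" and p1: "p \<le> 1/2"
begin

lemma p_le_1: "p \<le> 1" using p1 by simp

section \<open>Mean numbers of exceptional edges\<close>

lemma Ebin_members_le:
  assumes "\<And>X. X \<subseteq> A \<Longrightarrow> real (card {e \<in> A. P e X}) \<le> f X"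
  shows "Ebin A p (\<lambda>X. real (card {e \<in> X. P e (X - {e})})) \<le> 2 * p * Ebin A p f"
proof -
  have "Ebin A p (\<lambda>X. real (card {e \<in> X. P e (X - {e})})) = Ebin A p (\<lambda>X. \<Sum>e\<in>X. of_bool (P e (X - {e})))"
    using finA by (intro Ebin_cong) (auto simp: card_filter_eq_sum finite_subset[OF _ finA])
  also have "\<dots> \<le> 2 * p * Ebin A p (\<lambda>X. \<Sum>e\<in>A. of_bool (P e X))"
    by (rule Ebin_sum_members_le) (use finA p0 p1 in auto)
  also have "\<dots> \<le> 2 * p * Ebin A p f"
  proof (intro mult_left_mono Ebin_mono[OF p0 p_le_1])
    show "(\<Sum>e\<in>A. of_bool (P e X)) \<le> f X" if "X \<subseteq> A" for X
      using assms[OF that] unfolding card_filter_eq_sum[OF finA] .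
  qed (use p0 in simp)
  finally show ?thesis .
qed

text \<open>At most \<open>n * k\<close> ordered pairs share a component with fewer than
  \<open>k\<close> vertices, and a potential edge closing a cycle there contains one of
  them.\<close>

lemma Ebin_cyclic_edges: "Ebin A p (\<lambda>X. real (card (cyclic_edges k X))) \<le> 2 * p * (real n * k * N2)"
proof -
  have "Ebin A p (\<lambda>X. real (card (cyclic_edges k X))) \<le> 2 * p * Ebin A p (\<lambda>X. real n * k * N2)"
    unfolding cyclic_edges_def
  proof (rule Ebin_members_le)
    fix X assume X: "X \<subseteq> A"
    interpret uniform_edges V r X by (rule uniform[OF X])
    let ?Q = "SIGMA u:{u \<in> V. card (component X u) < k}. component X u - {u}"
    have c: "component X u \<subseteq> V" "finite (component X u)" if "u \<in> V" for u
      using component_subset[OF that X_sub] finite_subset[OF _ finV] by auto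
    have "{e \<in> A. \<exists>u\<in>e. \<exists>w\<in>e. u \<noteq> w \<and> w \<in> component X u \<and> card (component X u) < k} \<subseteq>
        {e \<in> A. \<exists>u\<in>e. \<exists>w\<in>e. (u, w) \<in> ?Q}"
      by (auto simp: rsets_def)
    then have "card {e \<in> A. \<exists>u\<in>e. \<exists>w\<in>e. u \<noteq> w \<and> w \<in> component X u \<and> card (component X u) < k} \<le>
        card {e \<in> A. \<exists>u\<in>e. \<exists>w\<in>e. (u, w) \<in> ?Q}"
      using finA by (intro card_mono) auto
    also have "\<dots> \<le> card ?Q * N2"
      using c(1) by (intro card_edges_with_pair_le) auto
    also have "card ?Q = (\<Sum>u\<in>{u \<in> V. card (component X u) < k}. card (component X u - {u}))"
      using finV c by (intro card_SigmaI) auto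
    also have "\<dots> \<le> (\<Sum>u\<in>{u \<in> V. card (component X u) < k}. k)"
      by (intro sum_mono) (use c in \<open>auto simp: card_Diff_singleton_if\<close>)
    also have "\<dots> \<le> n * k" using finV by (auto intro!: mult_right_mono card_mono)
    finally have "card {e \<in> A. \<exists>u\<in>e. \<exists>w\<in>e. u \<noteq> w \<and> w \<in> component X u \<and> card (component X u) < k} \<le> n * k * N2"
      by simp
    then show "real (card {e \<in> A. \<exists>u\<in>e. \<exists>w\<in>e. u \<noteq> w \<and> w \<in> component X u \<and> card (component X u) < k})
       \<le> real n * k * N2"
      by (simp only: of_nat_mult[symmetric] of_nat_le_iff)
  qed
  then show ?thesis using finA by (simp add: Ebin_const)
qed

lemma card_cyclic_verts:
  assumes X: "X \<subseteq> A"
  shows "card (cyclic_verts V k X) \<le> card (cyclic_edges k X) * (r * k)"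
proof -
  interpret uniform_edges V r X by (rule uniform[OF X])
  let ?C = "cyclic_edges k X" and ?s = "\<lambda>e. {a \<in> e. card (component X a) < k}"
  have sub: "?C \<subseteq> X" by (auto simp: cyclic_edges_def)
  then have finC: "finite ?C" by (rule finite_subset[OF _ finX])
  have "cyclic_verts V k X \<subseteq> (\<Union>e\<in>?C. \<Union>a\<in>?s e. component X a)"
  proof
    fix v assume "v \<in> cyclic_verts V k X"
    then obtain a e where a: "card (component X v) < k" "a \<in> component X v" "e \<in> ?C" "a \<in> e"
      by (auto simp: cyclic_verts_def)
    then have "component X a = component X v" by (simp add: component_eq)
    moreover have "v \<in> component X a" using a(2) by (rule component_sym)
    ultimately have "a \<in> ?s e" "v \<in> component X a" using a by simp_all
    then show "v \<in> (\<Union>e\<in>?C. \<Union>a\<in>?s e. component X a)" by (intro UN_I[OF a(3)] UN_I)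
  qed
  moreover have fin: "finite (component X a)" if "e \<in> ?C" "a \<in> e" for e a
  proof -
    have "a \<in> V" using that sub edges by blast
    then show ?thesis by (rule finite_subset[OF component_subset[OF _ X_sub] finV])
  qed
  moreover have fine: "finite e" if "e \<in> ?C" for e using that sub fin_edge by auto
  ultimately have "card (cyclic_verts V k X) \<le> card (\<Union>e\<in>?C. \<Union>a\<in>?s e. component X a)"
    using finC by (intro card_mono) auto
  also have "\<dots> \<le> (\<Sum>e\<in>?C. card (\<Union>a\<in>?s e. component X a))" by (rule card_UN_le[OF finC])
  also have "\<dots> \<le> (\<Sum>e\<in>?C. r * k)"
  proof (rule sum_mono)
    fix e assume e: "e \<in> ?C"
    have "card (\<Union>a\<in>?s e. component X a) \<le> (\<Sum>a\<in>?s e. card (component X a))"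
      using fine[OF e] by (intro card_UN_le) auto
    also have "\<dots> \<le> (\<Sum>a\<in>?s e. k)" by (intro sum_mono) auto
    also have "\<dots> \<le> card e * k" using fine[OF e] by (auto intro!: mult_right_mono card_mono)
    finally show "card (\<Union>a\<in>?s e. component X a) \<le> r * k" using e sub edges by auto
  qed
  finally show ?thesis by simp
qed

text \<open>A pendant edge must hit \<open>cyclic_verts\<close>, which has at most
  \<open>r * k\<close> vertices per cyclic edge, and each vertex lies in \<open>N\<close> potential
  edges.\<close>

lemma Ebin_pendant_cyclic:
  "Ebin A p (\<lambda>X. real (card (pendant_cyclic V k X))) \<le>
     2 * p * (real (r * k) * N * Ebin A p (\<lambda>X. real (card (cyclic_edges k X))))"
proof -
  have "Ebin A p (\<lambda>X. real (card (pendant_cyclic V k X))) \<le>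
      2 * p * Ebin A p (\<lambda>X. real (r * k) * N * real (card (cyclic_edges k X)))"
    unfolding pendant_cyclic_def
  proof (rule Ebin_members_le)
    fix X assume X: "X \<subseteq> A"
    let ?Z = "cyclic_verts V k X"
    have Z: "finite ?Z" "?Z \<subseteq> V" using finV by (auto simp: cyclic_verts_def)
    have "{e \<in> A. e \<inter> ?Z \<noteq> {}} = (\<Union>v\<in>?Z. {e \<in> A. v \<in> e})" by auto
    then have "card {e \<in> A. e \<inter> ?Z \<noteq> {}} \<le> (\<Sum>v\<in>?Z. card {e \<in> A. v \<in> e})"
      using card_UN_le[OF Z(1), of "\<lambda>v. {e \<in> A. v \<in> e}"] by simp
    also have "\<dots> = (\<Sum>v\<in>?Z. N)" using Z by (intro sum.cong refl card_star) auto
    also have "\<dots> = card ?Z * N" by simp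
    also have "\<dots> \<le> card (cyclic_edges k X) * (r * k) * N"
      by (intro mult_right_mono card_cyclic_verts[OF X]) auto
    finally have "card {e \<in> A. e \<inter> ?Z \<noteq> {}} \<le> r * k * N * card (cyclic_edges k X)"
      by (simp add: algebra_simps)
    then show "real (card {e \<in> A. e \<inter> ?Z \<noteq> {}}) \<le> real (r * k) * N * real (card (cyclic_edges k X))"
      by (simp only: of_nat_mult[symmetric] of_nat_le_iff)
  qed
  then show ?thesis unfolding Ebin_cmult .
qed

lemma apart_sub: "apart V k X \<subseteq> V \<times> V" and apart_irrefl: "(u, u) \<notin> apart V k X"
  by (auto simp: apart_def large_def)

lemma Ebin_bad_edges:
  "Ebin A p (\<lambda>X. real (card (bad_edges V k X))) \<le> 2 * p * (N2 * Ebin A p (\<lambda>X. real (card (apart V k X))))"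
proof -
  have "Ebin A p (\<lambda>X. real (card (bad_edges V k X))) \<le> 2 * p * Ebin A p (\<lambda>X. real N2 * real (card (apart V k X)))"
    unfolding bad_edges_def
  proof (rule Ebin_members_le)
    fix X assume X: "X \<subseteq> A"
    have "{e \<in> A. \<exists>u\<in>e. \<exists>w\<in>e. u \<in> large V k X \<and> w \<in> large V k X \<and> w \<notin> component X u} =
       {e \<in> A. \<exists>u\<in>e. \<exists>w\<in>e. (u, w) \<in> apart V k X}" by (auto simp: apart_def)
    then have "card {e \<in> A. \<exists>u\<in>e. \<exists>w\<in>e. u \<in> large V k X \<and> w \<in> large V k X \<and> w \<notin> component X u} \<le> card (apart V k X) * N2"
      using card_edges_with_pair_le[OF apart_sub apart_irrefl, of k X] by simp
    then show "real (card {e \<in> A. \<exists>u\<in>e. \<exists>w\<in>e. u \<in> large V k X \<and> w \<in> large V k X \<and> w \<notin> component X u})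
       \<le> real N2 * real (card (apart V k X))"
      by (simp only: of_nat_mult[symmetric] of_nat_le_iff mult.commute)
  qed
  then show ?thesis unfolding Ebin_cmult .
qed

section \<open>Concentration and means of the cut-off counts\<close>

lemma p_card_A: "p * card A = p * N * n / r"
proof -
  have "real r * real (card A) = real n * real N" using card_A_N by (metis of_nat_mult)
  then have "real (card A) = real n * real N / real r" using r3 by (simp add: field_simps)
  then show ?thesis by simp
qed

lemma large_deviation_bound:
  "Ebin A p (\<lambda>X. \<bar>real (card (large V k X)) - Ebin A p (\<lambda>X. real (card (large V k X)))\<bar>) \<le>
     real (r * k) * sqrt (p * N * n / r)"
  unfolding p_card_A[symmetric]
proof (rule Ebin_deviation[OF finA p0 p_le_1])
  fix e X assume e: "e \<in> A" "X \<subseteq> A - {e}"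
  then have "\<Union>X \<subseteq> V" "e \<subseteq> V" "card e = r" by (auto simp: rsets_def)
  then show "\<bar>real (card (large V k (insert e X))) - real (card (large V k X))\<bar> \<le> real (r * k)"
    using card_large_insert[OF finV, of X e k] by simp
qed simp

lemma large_second_moment:
  "Ebin A p (\<lambda>X. (real (card (large V k X)))\<^sup>2) \<le>
     (Ebin A p (\<lambda>X. real (card (large V k X))))\<^sup>2 + p * (real (r * k))\<^sup>2 * card A"
proof -
  let ?f = "\<lambda>X. real (card (large V k X))"
  define m where "m = Ebin A p ?f"
  have "Ebin A p (\<lambda>X. (?f X - m)\<^sup>2) \<le> p * (real (r * k))\<^sup>2 * card A"
    unfolding m_def
  proof (rule Ebin_variance[OF finA p0 p_le_1])
    fix e X assume e: "e \<in> A" "X \<subseteq> A - {e}"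
    then have "\<Union>X \<subseteq> V" "e \<subseteq> V" "card e = r" by (auto simp: rsets_def)
    then show "\<bar>?f (insert e X) - ?f X\<bar> \<le> real (r * k)"
      using card_large_insert[OF finV, of X e k] by simp
  qed
  moreover have "Ebin A p (\<lambda>X. (?f X - m)\<^sup>2) = Ebin A p (\<lambda>X. ((?f X)\<^sup>2 - 2 * m * ?f X) + m\<^sup>2)"
    by (rule Ebin_cong) (simp add: power2_eq_square algebra_simps)
  moreover have "\<dots> = Ebin A p (\<lambda>X. (?f X)\<^sup>2) - m\<^sup>2"
    unfolding Ebin_add Ebin_diff Ebin_cmult using finA by (simp add: Ebin_const m_def power2_eq_square)
  ultimately show ?thesis unfolding m_def by simp
qed

lemma attached_deviation:
  "Ebin A p (\<lambda>X. \<bar>real (card (attached V k j X)) - Ebin A p (\<lambda>X. real (card (attached V k j X)))\<bar>) \<le>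
     (1 + real r * (1 + 2 ^ k)) * sqrt (p * N * n / r)"
  unfolding p_card_A[symmetric]
proof (rule Ebin_deviation[OF finA p0 p_le_1])
  fix e X assume e: "e \<in> A" "X \<subseteq> A - {e}"
  then have "\<Union>X \<subseteq> V" "e \<subseteq> V" "card e = r" "e \<notin> X" by (auto simp: rsets_def)
  then show "\<bar>real (card (attached V k j (insert e X))) - real (card (attached V k j X))\<bar> \<le> 1 + real r * (1 + 2 ^ k)"
    using card_attached_insert[OF finV, of X e k j] by (simp add: distrib_left)
qed simp

text \<open>Given \<open>X\<close>, the potential edges with \<open>j\<close> large vertices are
  counted exactly by choosing \<open>j\<close> large and \<open>r - j\<close> other vertices; the
  error comes from replacing \<open>X - {e}\<close> by \<open>X\<close>.\<close>

lemma attached_mean: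
  assumes "j \<le> r"
  shows "\<bar>Ebin A p (\<lambda>X. real (card (attached V k j X))) -
    p * Ebin A p (\<lambda>X. real (card (large V k X) choose j) * real ((n - card (large V k X)) choose (r - j)))\<bar>
    \<le> p * p * card A"
proof -
  let ?g = "\<lambda>e X. of_bool (card (e \<inter> large V k X) = j) :: real"
  have "Ebin A p (\<lambda>X. real (card (attached V k j X))) = Ebin A p (\<lambda>X. \<Sum>e\<in>X. ?g e (X - {e}))"
    unfolding attached_def using finA by (intro Ebin_cong) (auto simp: card_filter_eq_sum finite_subset[OF _ finA])
  moreover have "(\<Sum>e\<in>A. ?g e X) = real (card (large V k X) choose j) * real ((n - card (large V k X)) choose (r - j))" for X
  proof -
    have "(\<Sum>e\<in>A. ?g e X) = real (card {e \<in> A. card (e \<inter> large V k X) = j})"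
      using finA by (simp add: card_filter_eq_sum)
    also have "{e \<in> A. card (e \<inter> large V k X) = j} = {e. e \<subseteq> V \<and> card e = r \<and> card (e \<inter> large V k X) = j}"
      by (auto simp: rsets_def)
    finally show ?thesis using card_subsets_meeting[OF finV large_subset assms, of k X] by simp
  qed
  ultimately show ?thesis
    using Ebin_sum_members_approx[OF finA p0 p_le_1, of ?g] by simp
qed

lemma card_edges_deviation:
  "Ebin A p (\<lambda>X. \<bar>real (card X) - p * N * n / r\<bar>) \<le> sqrt (p * N * n / r)"
proof -
  have "Ebin A p (\<lambda>X. real (card X)) = Ebin A p (\<lambda>X. real (card (X \<inter> UNIV)))" by simp
  also have "\<dots> = p * N * n / r" using Ebin_card[OF finA, of p UNIV] by (simp add: p_card_A)
  finally have m: "Ebin A p (\<lambda>X. real (card X)) = p * N * n / r" .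
  have "Ebin A p (\<lambda>X. \<bar>real (card X) - Ebin A p (\<lambda>X. real (card X))\<bar>) \<le> 1 * sqrt (p * card A)"
  proof (rule Ebin_deviation[OF finA p0 p_le_1])
    fix e X assume e: "e \<in> A" "X \<subseteq> A - {e}"
    then have "finite X" "e \<notin> X" using finite_subset[OF _ finA, of X] by auto
    then show "\<bar>real (card (insert e X)) - real (card X)\<bar> \<le> 1" by simp
  qed simp
  then show ?thesis unfolding m p_card_A by simp
qed

text \<open>The probability that some edge at a vertex meets a fixed set of \<open>t\<close> other vertices.\<close>

definition star_prob :: "nat \<Rightarrow> real" where
  "star_prob t = 1 - (1 - p) ^ (N - ((n - 1 - t) choose (r - 1)))"

section \<open>The recursion at one vertex\<close>

context
  fixes v :: 'a and k :: nat
  assumes v: "v \<in> V" and k: "k \<ge> 1"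
begin

lemma Ebin_star_split:
  "Ebin A p f = Ebin {e \<in> A. v \<notin> e} p (\<lambda>Y. Ebin {e \<in> A. v \<in> e} p (\<lambda>Z. f (Y \<union> Z)))"
proof -
  have "A = {e \<in> A. v \<notin> e} \<union> {e \<in> A. v \<in> e}" by auto
  then show ?thesis using Ebin_union[of "{e \<in> A. v \<notin> e}" "{e \<in> A. v \<in> e}" p f] finA by auto
qed

lemma Ebin_star_hit:
  assumes Y: "Y \<subseteq> {e \<in> A. v \<notin> e}"
  shows "Ebin {e \<in> A. v \<in> e} p (\<lambda>Z. 1 - of_bool (Z \<inter> {e. e \<inter> (large V k Y - {v}) \<noteq> {}} = {})) =
    star_prob (card (large V k Y - {v}))"
proof -
  let ?T = "large V k Y - {v}"
  have "{e \<in> A. v \<in> e} \<inter> {e. e \<inter> ?T \<noteq> {}} = {e \<in> A. v \<in> e \<and> e \<inter> ?T \<noteq> {}}" by auto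
  then have c: "card ({e \<in> A. v \<in> e} \<inter> {e. e \<inter> ?T \<noteq> {}}) = N - ((n - 1 - card ?T) choose (r - 1))"
    using card_star_meeting[OF v, of ?T] large_subset[of V k Y] by auto
  have fin: "finite {e \<in> A. v \<in> e}" using finA by simp
  show ?thesis
    unfolding Ebin_diff Ebin_avoid[OF fin] Ebin_const[OF fin] c star_prob_def ..
qed

lemma Ebin_star_prob:
  "Ebin {e \<in> A. v \<notin> e} p (\<lambda>Y. star_prob (card (large V k Y - {v}))) =
   Ebin A p (\<lambda>X. star_prob (card (large V k {e \<in> X. v \<notin> e} - {v})))"
proof -
  have "Ebin A p (\<lambda>X. star_prob (card (large V k (X \<inter> {e \<in> A. v \<notin> e}) - {v}))) =
      Ebin {e \<in> A. v \<notin> e} p (\<lambda>Y. star_prob (card (large V k Y - {v})))"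
    by (rule Ebin_restrict[OF finA]) auto
  moreover have "Ebin A p (\<lambda>X. star_prob (card (large V k (X \<inter> {e \<in> A. v \<notin> e}) - {v}))) =
      Ebin A p (\<lambda>X. star_prob (card (large V k {e \<in> X. v \<notin> e} - {v})))"
  proof (rule Ebin_cong)
    fix X assume "X \<subseteq> A"
    then have "X \<inter> {e \<in> A. v \<notin> e} = {e \<in> X. v \<notin> e}" by auto
    then show "star_prob (card (large V k (X \<inter> {e \<in> A. v \<notin> e}) - {v})) =
      star_prob (card (large V k {e \<in> X. v \<notin> e} - {v}))" by simp
  qed
  ultimately show ?thesis by simp
qed

lemma star_parts:
  assumes "Y \<subseteq> {e \<in> A. v \<notin> e}" "Z \<subseteq> {e \<in> A. v \<in> e}"
  shows "{e \<in> Y \<union> Z. v \<notin> e} = Y" "{e \<in> Y \<union> Z. v \<in> e} = Z" "uniform_edges V r (Y \<union> Z)"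
  using assms by (auto intro!: uniform)

lemma cavity_lower:
  "Ebin A p (\<lambda>X. star_prob (card (large V k {e \<in> X. v \<notin> e} - {v}))) \<le>
   Ebin A p (\<lambda>X. of_bool (v \<in> large V (k + 1) X))"
  unfolding Ebin_star_prob[symmetric]
proof (subst Ebin_star_split, rule Ebin_mono[OF p0 p_le_1])
  fix Y assume Y: "Y \<subseteq> {e \<in> A. v \<notin> e}"
  show "star_prob (card (large V k Y - {v})) \<le> Ebin {e \<in> A. v \<in> e} p (\<lambda>Z. of_bool (v \<in> large V (k + 1) (Y \<union> Z)))"
    unfolding Ebin_star_hit[OF Y, symmetric]
  proof (rule Ebin_mono[OF p0 p_le_1])
    fix Z assume Z: "Z \<subseteq> {e \<in> A. v \<in> e}"
    interpret uniform_edges V r "Y \<union> Z" by (rule star_parts(3)[OF Y Z])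
    have "v \<in> large V (k + 1) (Y \<union> Z)" if hit: "Z \<inter> {e. e \<inter> (large V k Y - {v}) \<noteq> {}} \<noteq> {}"
    proof -
      from hit obtain e u where e: "e \<in> Z" "u \<in> e" "u \<in> large V k Y" "u \<noteq> v" by blast
      then show ?thesis
        using star_lower[of e v u k] star_parts(1)[OF Y Z] Z by auto
    qed
    then show "1 - of_bool (Z \<inter> {e. e \<inter> (large V k Y - {v}) \<noteq> {}} = {}) \<le>
        (of_bool (v \<in> large V (k + 1) (Y \<union> Z)) :: real)" by auto
  qed
qed

lemma cavity_upper:
  assumes m: "m \<ge> 1"
  shows "Ebin A p (\<lambda>X. of_bool (v \<in> large V (m * r * k + 1) X)) \<le>
   Ebin A p (\<lambda>X. star_prob (card (large V k {e \<in> X. v \<notin> e} - {v}))) + p * N / m"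
proof -
  let ?S = "{e \<in> A. v \<in> e}"
  have finS: "finite ?S" using finA by simp
  have cS: "card (?S \<inter> UNIV) = N" using card_star[OF v] by simp
  have "Ebin A p (\<lambda>X. of_bool (v \<in> large V (m * r * k + 1) X)) =
      Ebin {e \<in> A. v \<notin> e} p (\<lambda>Y. Ebin ?S p (\<lambda>Z. of_bool (v \<in> large V (m * r * k + 1) (Y \<union> Z))))"
    by (rule Ebin_star_split)
  also have "\<dots> \<le> Ebin {e \<in> A. v \<notin> e} p (\<lambda>Y. star_prob (card (large V k Y - {v})) + p * N / m)"
  proof (rule Ebin_mono[OF p0 p_le_1])
    fix Y assume Y: "Y \<subseteq> {e \<in> A. v \<notin> e}"
    let ?h = "\<lambda>Z. 1 - of_bool (Z \<inter> {e. e \<inter> (large V k Y - {v}) \<noteq> {}} = {}) :: real"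
    \<comment> \<open>The term \<open>1 / m * card Z\<close> dominates the indicator that
      \<open>v\<close> has at least \<open>m\<close> edges, the case excluded in
      \<open>star_upper\<close>; its mean is \<open>p * N / m\<close>.\<close>
    have "Ebin ?S p (\<lambda>Z. of_bool (v \<in> large V (m * r * k + 1) (Y \<union> Z))) \<le>
        Ebin ?S p (\<lambda>Z. ?h Z + 1 / m * real (card (Z \<inter> UNIV)))"
    proof (rule Ebin_mono[OF p0 p_le_1])
      fix Z assume Z: "Z \<subseteq> ?S"
      interpret uniform_edges V r "Y \<union> Z" by (rule star_parts(3)[OF Y Z])
      have "v \<notin> large V (m * r * k + 1) (Y \<union> Z)"
        if "Z \<inter> {e. e \<inter> (large V k Y - {v}) \<noteq> {}} = {}" "card Z < m"
        using star_upper[OF v k, of m] star_parts(1,2)[OF Y Z] that Y by auto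
      moreover have "1 \<le> 1 / real m * real (card Z)" if "\<not> card Z < m"
        using that m by (simp add: field_simps)
      ultimately show "of_bool (v \<in> large V (m * r * k + 1) (Y \<union> Z)) \<le> ?h Z + 1 / m * real (card (Z \<inter> UNIV))"
        by (cases "card Z < m") (auto simp: of_bool_def add_increasing)
    qed
    also have "\<dots> = star_prob (card (large V k Y - {v})) + 1 / m * (p * N)"
      unfolding Ebin_add Ebin_cmult Ebin_star_hit[OF Y] Ebin_card[OF finS] cS ..
    finally show "Ebin ?S p (\<lambda>Z. of_bool (v \<in> large V (m * r * k + 1) (Y \<union> Z))) \<le>
      star_prob (card (large V k Y - {v})) + p * N / m" by simp
  qed
  also have "\<dots> = Ebin A p (\<lambda>X. star_prob (card (large V k {e \<in> X. v \<notin> e} - {v}))) + p * N / m"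
    unfolding Ebin_add Ebin_star_prob using finA by (simp add: Ebin_const)
  finally show ?thesis .
qed

text \<open>The recursion yields counts in the hypergraph without the star of \<open>v\<close>.
  Putting the star back edge by edge changes the count by at most \<open>r * k\<close> each time,
  and leaving out \<open>v\<close> itself accounts for the 1.\<close>

lemma large_star_diff:
  "Ebin A p (\<lambda>X. \<bar>real (card (large V k X)) - real (card (large V k {e \<in> X. v \<notin> e} - {v}))\<bar>) \<le>
     1 + real (r * k) * (p * N)"
proof -
  have "Ebin A p (\<lambda>X. \<bar>real (card (large V k X)) - real (card (large V k {e \<in> X. v \<notin> e} - {v}))\<bar>) \<le>
      Ebin A p (\<lambda>X. 1 + real (r * k) * real (card (X \<inter> {e. v \<in> e})))"
  proof (rule Ebin_mono[OF p0 p_le_1])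
    fix X assume X: "X \<subseteq> A"
    let ?Y = "{e \<in> X. v \<notin> e}" and ?Z = "X \<inter> {e. v \<in> e}"
    have gen: "\<bar>real (card (large V k (?Y \<union> Z))) - real (card (large V k ?Y))\<bar> \<le> real (r * k) * real (card Z)"
      if "finite Z" "Z \<subseteq> ?Z" for Z
      using that
    proof (induction Z rule: finite_induct)
      case (insert e Z)
      have "\<Union>(?Y \<union> Z) \<subseteq> V" "e \<subseteq> V" "card e = r" using insert X by (auto simp: rsets_def)
      then have "\<bar>real (card (large V k (insert e (?Y \<union> Z)))) - real (card (large V k (?Y \<union> Z)))\<bar> \<le> real (r * k)"
        using card_large_insert[OF finV, of "?Y \<union> Z" e k] by simp
      then show ?case using insert by (simp add: algebra_simps)
    qed simp
    have "?Y \<union> ?Z = X" by auto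
    then have "\<bar>real (card (large V k X)) - real (card (large V k ?Y))\<bar> \<le> real (r * k) * real (card ?Z)"
      using gen[of ?Z] finite_subset[OF X finA] by simp
    moreover have "finite (large V k ?Y)" by (rule finite_subset[OF large_subset finV])
    then have "\<bar>real (card (large V k ?Y)) - real (card (large V k ?Y - {v}))\<bar> \<le> 1"
      by (simp add: card_Diff_singleton_if of_nat_diff card_gt_0_iff Suc_le_eq) (auto simp: card_gt_0_iff Suc_le_eq of_nat_diff)
    ultimately show "\<bar>real (card (large V k X)) - real (card (large V k ?Y - {v}))\<bar> \<le> 1 + real (r * k) * real (card ?Z)"
      by linarith
  qed
  also have "\<dots> = 1 + real (r * k) * (p * card (A \<inter> {e. v \<in> e}))"
    unfolding Ebin_add Ebin_cmult Ebin_card[OF finA] using finA by (simp add: Ebin_const)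
  also have "A \<inter> {e. v \<in> e} = {e \<in> A. v \<in> e}" by auto
  finally show ?thesis using card_star[OF v] by simp
qed

end

end

section \<open>Separated pairs of large vertices\<close>

text \<open>The mean value theorem gives a density \<xi> at which the potential falls slowly, so
  that few pairs are \<open>apart\<close>. Write \<open>D\<close> and \<open>J\<close> for the mean
  numbers of separated and joined pairs and \<open>Q\<close> for the mean of the squared number of
  large vertices. As \<open>J\<close> is increasing, \<open>D p = Q p - J p \<le> Q p - J \<xi> = Q
  p - Q \<xi> + D \<xi>\<close>, and \<open>Q \<xi>\<close> is at least the squared mean at
  \<open>p'\<close>.\<close>

lemma Ebin_apart_sprinkle:
  fixes p p' :: real and k :: nat
  assumes "0 \<le> p'" "p' < p" "p \<le> 1" "k \<ge> 1"
  shows "Ebin A p (\<lambda>X. real (card (apart V k X))) \<le>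
    Ebin A p (\<lambda>X. (real (card (large V k X)))\<^sup>2) - (Ebin A p' (\<lambda>X. real (card (large V k X))))\<^sup>2
      + real (r\<^sup>2 * n) / (k * (p - p') * N2)"
proof -
  let ?\<Psi> = "potential V k"
  let ?joined = "\<lambda>X. {(u, w). u \<in> large V k X \<and> w \<in> large V k X \<and> w \<in> component X u}"
  have "\<exists>\<xi>>p'. \<xi> < p \<and> Ebin A p ?\<Psi> - Ebin A p' ?\<Psi> =
      (p - p') * (\<Sum>e\<in>A. Ebin A \<xi> (\<lambda>X. ?\<Psi> (insert e X) - ?\<Psi> (X - {e})))"
    using Ebin_has_derivative[OF finA, of ?\<Psi>] by (intro MVT2 assms)
  then obtain \<xi> where \<xi>: "p' < \<xi>" "\<xi> < p" and
    eq: "Ebin A p ?\<Psi> - Ebin A p' ?\<Psi> = (p - p') * (\<Sum>e\<in>A. Ebin A \<xi> (\<lambda>X. ?\<Psi> (insert e X) - ?\<Psi> (X - {e})))"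
    by auto
  have \<xi>01: "0 \<le> \<xi>" "\<xi> \<le> 1" using \<xi> assms by auto
  define B where "B = Ebin A \<xi> (\<lambda>X. real (card {e \<in> A. \<exists>u\<in>e. \<exists>w\<in>e. (u, w) \<in> apart V k X}))"
  have "(\<Sum>e\<in>A. Ebin A \<xi> (\<lambda>X. ?\<Psi> (insert e X) - ?\<Psi> (X - {e}))) \<le>
      (\<Sum>e\<in>A. Ebin A \<xi> (\<lambda>X. - of_bool (\<exists>u\<in>e. \<exists>w\<in>e. (u, w) \<in> apart V k X)))"
  proof (intro sum_mono Ebin_mono[OF \<xi>01])
    fix e X assume e: "e \<in> A" and X: "X \<subseteq> A"
    have sub: "\<Union>(insert e X) \<subseteq> V" using e X by (auto simp: rsets_def)
    show "?\<Psi> (insert e X) - ?\<Psi> (X - {e}) \<le> - of_bool (\<exists>u\<in>e. \<exists>w\<in>e. (u, w) \<in> apart V k X)"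
    proof (cases "\<exists>u\<in>e. \<exists>w\<in>e. (u, w) \<in> apart V k X")
      case True
      then obtain u w where uw: "u \<in> e" "w \<in> e" "u \<in> large V k X" "w \<in> large V k X" "w \<notin> component X u"
        by (auto simp: apart_def)
      \<comment> \<open>An edge already present would have joined \<open>u\<close> and
        \<open>w\<close>; so \<open>e\<close> is new and merges two large components.\<close>
      then have "e \<notin> X" using component_edge by metis
      then have "X - {e} = X" by auto
      moreover have "?\<Psi> (insert e X) \<le> ?\<Psi> X - 1"
        by (rule potential_drop[OF finV _ sub, of X e u k w]) (use uw assms in auto)
      ultimately show ?thesis using True by simp
    next
      case False
      have "?\<Psi> (insert e X) \<le> ?\<Psi> (X - {e})"
        by (rule potential_antimono[OF finV _ sub]) auto
      then show ?thesis using False by simp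
    qed
  qed
  also have "\<dots> = Ebin A \<xi> (\<lambda>X. \<Sum>e\<in>A. - of_bool (\<exists>u\<in>e. \<exists>w\<in>e. (u, w) \<in> apart V k X))"
    by (rule Ebin_sum[symmetric])
  also have "\<dots> = Ebin A \<xi> (\<lambda>X. (-1) * real (card {e \<in> A. \<exists>u\<in>e. \<exists>w\<in>e. (u, w) \<in> apart V k X}))"
    using finA by (intro Ebin_cong) (simp add: card_filter_eq_sum sum_negf)
  also have "\<dots> = - B" unfolding Ebin_cmult B_def by simp
  finally have "(p - p') * (\<Sum>e\<in>A. Ebin A \<xi> (\<lambda>X. ?\<Psi> (insert e X) - ?\<Psi> (X - {e}))) \<le> (p - p') * (- B)"
    using assms by (intro mult_left_mono) auto
  moreover have "- (real n / k) \<le> Ebin A p ?\<Psi>" "Ebin A p' ?\<Psi> \<le> 0"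
    using finA assms potential_bounds[OF finV, of k] by (auto intro!: Ebin_ge_const Ebin_le_const)
  ultimately have B: "(p - p') * B \<le> real n / k" using eq by linarith
  define D where "D = (\<lambda>q. Ebin A q (\<lambda>X. real (card (apart V k X))))"
  have "D \<xi> * N2 = Ebin A \<xi> (\<lambda>X. real N2 * real (card (apart V k X)))"
    unfolding D_def Ebin_cmult by simp
  also have "\<dots> \<le> Ebin A \<xi> (\<lambda>X. (real r)\<^sup>2 * real (card {e \<in> A. \<exists>u\<in>e. \<exists>w\<in>e. (u, w) \<in> apart V k X}))"
  proof (rule Ebin_mono[OF \<xi>01])
    fix X
    have "card (apart V k X) * N2 \<le> r\<^sup>2 * card {e \<in> A. \<exists>u\<in>e. \<exists>w\<in>e. (u, w) \<in> apart V k X}"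
      by (rule card_edges_with_pair_ge) (auto simp: apart_def large_def)
    then have "real (card (apart V k X) * N2) \<le> real (r\<^sup>2 * card {e \<in> A. \<exists>u\<in>e. \<exists>w\<in>e. (u, w) \<in> apart V k X})"
      by (rule of_nat_mono)
    then show "real N2 * real (card (apart V k X)) \<le> (real r)\<^sup>2 * real (card {e \<in> A. \<exists>u\<in>e. \<exists>w\<in>e. (u, w) \<in> apart V k X})"
      by (simp add: mult.commute)
  qed
  also have "\<dots> = (real r)\<^sup>2 * B" unfolding Ebin_cmult B_def ..
  also have "\<dots> \<le> (real r)\<^sup>2 * (real n / k / (p - p'))"
    using B assms by (intro mult_left_mono) (auto simp: pos_le_divide_eq mult_ac)
  finally have D\<xi>: "D \<xi> \<le> real (r\<^sup>2 * n) / (k * (p - p') * N2)"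
    using N2_pos assms by (simp add: field_simps)
  have split: "D q = Ebin A q (\<lambda>X. (real (card (large V k X)))\<^sup>2) - Ebin A q (\<lambda>X. real (card (?joined X)))" for q
    unfolding D_def Ebin_diff[symmetric]
  proof (rule Ebin_cong)
    fix X
    have fin: "finite (large V k X)" by (rule finite_subset[OF large_subset finV])
    have "large V k X \<times> large V k X = apart V k X \<union> ?joined X" "apart V k X \<inter> ?joined X = {}"
      by (auto simp: apart_def)
    moreover have "finite (apart V k X)" "finite (?joined X)"
      by (rule finite_subset[of _ "large V k X \<times> large V k X"]; use fin in \<open>auto simp: apart_def\<close>)+
    ultimately have "card (large V k X \<times> large V k X) = card (apart V k X) + card (?joined X)"
      by (simp add: card_Un_disjoint)
    then have "real (card (large V k X)) * real (card (large V k X)) = real (card (apart V k X)) + real (card (?joined X))"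
      unfolding card_cartesian_product by (simp only: of_nat_mult[symmetric] of_nat_add[symmetric])
    then show "real (card (apart V k X)) = (real (card (large V k X)))\<^sup>2 - real (card (?joined X))"
      by (simp add: power2_eq_square)
  qed
  have mono: "large V k X \<subseteq> large V k Y" "component X u \<subseteq> component Y u" if "X \<subseteq> Y" "Y \<subseteq> A" for X Y u
  proof -
    have "\<Union>Y \<subseteq> V" using that by (auto simp: rsets_def)
    then show "large V k X \<subseteq> large V k Y" using that finV by (intro large_mono) auto
    show "component X u \<subseteq> component Y u" using that by (intro component_mono)
  qed
  have "Ebin A \<xi> (\<lambda>X. real (card (?joined X))) \<le> Ebin A p (\<lambda>X. real (card (?joined X)))"
  proof (rule Ebin_mono_prob[OF finA])
    fix X Y :: "'a set set" assume XY: "X \<subseteq> Y" "Y \<subseteq> A"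
    have "?joined X \<subseteq> ?joined Y" using mono[OF XY] by blast
    moreover have "?joined Y \<subseteq> V \<times> V" by (auto simp: large_def)
    ultimately show "real (card (?joined X)) \<le> real (card (?joined Y))"
      using finV by (intro of_nat_mono card_mono) (auto intro: finite_subset)
  qed (use \<xi> \<xi>01 assms in auto)
  moreover have "(Ebin A p' (\<lambda>X. real (card (large V k X))))\<^sup>2 \<le> Ebin A \<xi> (\<lambda>X. (real (card (large V k X)))\<^sup>2)"
  proof -
    have "(Ebin A p' (\<lambda>X. real (card (large V k X))))\<^sup>2 \<le> Ebin A p' (\<lambda>X. (real (card (large V k X)))\<^sup>2)"
      using assms by (intro Ebin_square_le finA) auto
    also have "\<dots> \<le> Ebin A \<xi> (\<lambda>X. (real (card (large V k X)))\<^sup>2)"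
    proof (rule Ebin_mono_prob[OF finA])
      fix X Y :: "'a set set" assume XY: "X \<subseteq> Y" "Y \<subseteq> A"
      have "finite (large V k Y)" by (rule finite_subset[OF large_subset finV])
      then show "(real (card (large V k X)))\<^sup>2 \<le> (real (card (large V k Y)))\<^sup>2"
        using mono(1)[OF XY] by (intro power_mono of_nat_mono card_mono) auto
    qed (use \<xi> \<xi>01 assms in auto)
    finally show ?thesis .
  qed
  ultimately show ?thesis
    using split[of p] split[of \<xi>] D\<xi> unfolding D_def by linarith
qed

end

section \<open>Binomial ratios and the survival map\<close>

lemma power_diff_le:
  fixes x y :: real
  assumes "0 \<le> x" "x \<le> 1" "0 \<le> y" "y \<le> 1"
  shows "\<bar>x ^ q - y ^ q\<bar> \<le> q * \<bar>x - y\<bar>"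
  using norm_power_diff[of x y q] assms by simp

lemma product_diff_le:
  fixes a b x y :: real
  assumes "\<bar>a\<bar> \<le> 1" "\<bar>y\<bar> \<le> 1"
  shows "\<bar>a * b - x * y\<bar> \<le> \<bar>a - x\<bar> + \<bar>b - y\<bar>"
proof -
  have "a * b - x * y = a * (b - y) + (a - x) * y" by (simp add: algebra_simps)
  also have "\<bar>\<dots>\<bar> \<le> \<bar>a\<bar> * \<bar>b - y\<bar> + \<bar>a - x\<bar> * \<bar>y\<bar>"
    unfolding abs_mult[symmetric] by (rule abs_triangle_ineq)
  also have "\<dots> \<le> 1 * \<bar>b - y\<bar> + \<bar>a - x\<bar> * 1"
    using assms by (intro add_mono mult_mono) auto
  finally show ?thesis by simp
qed

section \<open>Ratios of binomial coefficients\<close>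

text \<open>The falling factorial of \<open>m\<close> over \<open>n ^ q\<close>: a product of
  \<open>q\<close> factors close to \<open>m / n\<close>. Quotients of binomial coefficients with
  equal lower index become quotients of such ratios.\<close>

definition falling_ratio :: "nat \<Rightarrow> nat \<Rightarrow> nat \<Rightarrow> real" where
  "falling_ratio n m q = real (m choose q) * fact q / real n ^ q"

lemma falling_ratio_eq_prod: "falling_ratio n m q = (\<Prod>i<q. (real m - real i) / n)"
proof -
  have "real (m choose q) * fact q = (\<Prod>i<q. real m - real i)"
    using gbinomial_mult_fact'[of "real m" q] by (simp add: binomial_gbinomial atLeast0LessThan)
  then show ?thesis by (simp add: falling_ratio_def prod_dividef)
qed

lemma falling_ratio_approx:
  assumes "m \<le> n" "q \<le> n" "n > 0"
  shows "\<bar>falling_ratio n m q - (real m / n) ^ q\<bar> \<le> (real q)\<^sup>2 / n"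
    and "0 \<le> falling_ratio n m q" and "falling_ratio n m q \<le> 1"
proof -
  have z: "norm ((real m - real i) / n) \<le> 1" if "i \<in> {..<q}" for i
  proof -
    have "\<bar>real m - real i\<bar> \<le> real n" using that assms by auto
    then show ?thesis using assms by simp
  qed
  have "norm ((\<Prod>i<q. (real m - real i) / n) - (\<Prod>i<q. real m / n)) \<le>
      (\<Sum>i<q. norm ((real m - real i) / n - real m / n))"
    by (rule norm_prod_diff) (use z assms in auto)
  also have "\<dots> = (\<Sum>i<q. real i / n)"
    by (intro sum.cong refl) (simp add: diff_divide_distrib[symmetric])
  also have "\<dots> \<le> (\<Sum>i<q. real q / n)"
    by (intro sum_mono divide_right_mono) auto
  also have "\<dots> = (real q)\<^sup>2 / n" by (simp add: power2_eq_square)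
  finally show "\<bar>falling_ratio n m q - (real m / n) ^ q\<bar> \<le> (real q)\<^sup>2 / n"
    by (simp add: falling_ratio_eq_prod)
  show "0 \<le> falling_ratio n m q" by (simp add: falling_ratio_def)
  have "norm (\<Prod>i<q. (real m - real i) / n) \<le> (\<Prod>i<q. 1)"
    unfolding prod_norm[symmetric] by (intro prod_mono) (use z in auto)
  then show "falling_ratio n m q \<le> 1" by (simp add: falling_ratio_eq_prod)
qed

text \<open>Compares \<open>b / B\<close> with \<open>c\<close> when \<open>B\<close> is near 1;
  knowing that the quotient \<open>H\<close> lies in \<open>[0, 1]\<close> replaces a lower bound on
  \<open>B\<close>.\<close>

lemma ratio_approx:
  fixes b B c H :: real
  assumes "H * B = b" "0 \<le> H" "H \<le> 1"
  shows "\<bar>H - c\<bar> \<le> \<bar>1 - B\<bar> + \<bar>b - c\<bar>"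
proof -
  have "H - c = H * (1 - B) + (b - c)" using assms(1) by (simp add: algebra_simps)
  also have "\<bar>\<dots>\<bar> \<le> \<bar>H * (1 - B)\<bar> + \<bar>b - c\<bar>" by (rule abs_triangle_ineq)
  also have "\<bar>H * (1 - B)\<bar> \<le> 1 * \<bar>1 - B\<bar>"
    unfolding abs_mult using assms by (intro mult_right_mono) auto
  finally show ?thesis by simp
qed

lemma star_ratio_approx:
  assumes "t < n" "q < n"
  shows "\<bar>real ((n - 1 - t) choose q) / real ((n - 1) choose q) - (1 - real t / n) ^ q\<bar> \<le> 2 * ((real q)\<^sup>2 + q) / n"
proof -
  let ?b = "falling_ratio n (n - 1 - t) q" and ?B = "falling_ratio n (n - 1) q"
  let ?H = "real ((n - 1 - t) choose q) / real ((n - 1) choose q)"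
  have pos: "(n - 1) choose q > 0" using assms by (simp add: zero_less_binomial_iff)
  have "((n - 1 - t) choose q) \<le> ((n - 1) choose q)" by (rule binomial_right_mono) simp
  then have H: "0 \<le> ?H" "?H \<le> 1" using pos by (auto simp: pos_divide_le_eq)
  have "?H * ?B = ?b" using pos by (simp add: falling_ratio_def)
  then have "\<bar>?H - (1 - real t / n) ^ q\<bar> \<le> \<bar>1 - ?B\<bar> + \<bar>?b - (1 - real t / n) ^ q\<bar>"
    by (rule ratio_approx[OF _ H])
  moreover have "\<bar>1 - ?B\<bar> \<le> (real q)\<^sup>2 / n + q / n"
  proof -
    have "\<bar>?B - (real (n - 1) / n) ^ q\<bar> \<le> (real q)\<^sup>2 / n"
      using assms by (intro falling_ratio_approx) auto
    moreover have "\<bar>(real (n - 1) / n) ^ q - 1 ^ q\<bar> \<le> q * \<bar>real (n - 1) / n - 1\<bar>"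
      using assms by (intro power_diff_le) auto
    moreover have "\<bar>real (n - 1) / n - 1\<bar> = 1 / n" using assms by (simp add: field_simps of_nat_diff)
    ultimately have "\<bar>?B - (real (n - 1) / n) ^ q\<bar> \<le> (real q)\<^sup>2 / n"
      "\<bar>(real (n - 1) / n) ^ q - 1\<bar> \<le> q / n" by simp_all
    then show ?thesis by linarith
  qed
  moreover have "\<bar>?b - (1 - real t / n) ^ q\<bar> \<le> (real q)\<^sup>2 / n + q / n"
  proof -
    have "\<bar>?b - (real (n - 1 - t) / n) ^ q\<bar> \<le> (real q)\<^sup>2 / n"
      using assms by (intro falling_ratio_approx) auto
    moreover have "\<bar>(real (n - 1 - t) / n) ^ q - (1 - real t / n) ^ q\<bar> \<le> q * \<bar>real (n - 1 - t) / n - (1 - real t / n)\<bar>"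
      using assms by (intro power_diff_le) auto
    moreover have "\<bar>real (n - 1 - t) / n - (1 - real t / n)\<bar> = 1 / n"
      using assms by (simp add: field_simps of_nat_diff)
    ultimately have "\<bar>?b - (real (n - 1 - t) / n) ^ q\<bar> \<le> (real q)\<^sup>2 / n"
      "\<bar>(real (n - 1 - t) / n) ^ q - (1 - real t / n) ^ q\<bar> \<le> q / n" by simp_all
    then show ?thesis by linarith
  qed
  ultimately show ?thesis by (simp add: add_divide_distrib)
qed

text \<open>Drawing \<open>r\<close> vertices without against with replacement. One error
  \<open>r\<^sup>2 / n\<close> comes from the denominator and two, with weight
  \<open>r choose j\<close>, from the factors of the numerator.\<close>

lemma hypergeometric_approx:
  assumes "t \<le> n" "j \<le> r" "r \<le> n" "n > 0"
  shows "\<bar>real (t choose j) * real ((n - t) choose (r - j)) / real (n choose r) -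
     real (r choose j) * (real t / n) ^ j * (1 - real t / n) ^ (r - j)\<bar> \<le> (1 + 2 * real (r choose j)) * (real r)\<^sup>2 / n"
proof -
  let ?H = "real (t choose j) * real ((n - t) choose (r - j)) / real (n choose r)"
  let ?B = "falling_ratio n n r" and ?x = "falling_ratio n t j" and ?y = "falling_ratio n (n - t) (r - j)"
  let ?c = "real (r choose j)"
  have pos: "n choose r > 0" using assms by (simp add: zero_less_binomial_iff)
  have "(t choose j) * ((n - t) choose (r - j)) \<le> (\<Sum>k\<le>r. (t choose k) * ((n - t) choose (r - k)))"
    using assms by (intro member_le_sum) auto
  also have "\<dots> = (t + (n - t)) choose r" by (rule vandermonde)
  finally have "(t choose j) * ((n - t) choose (r - j)) \<le> n choose r" using assms by simp
  then have "real (t choose j) * real ((n - t) choose (r - j)) \<le> real (n choose r)"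
    by (simp only: of_nat_mult[symmetric] of_nat_le_iff)
  then have H: "0 \<le> ?H" "?H \<le> 1" using pos by (auto simp: pos_divide_le_eq)
  have fac: "fact r = ?c * (fact j * fact (r - j))"
    using binomial_fact_lemma[OF assms(2)] by (metis mult.commute of_nat_fact of_nat_mult)
  have pw: "real n ^ r = real n ^ j * real n ^ (r - j)" using assms by (simp add: power_add[symmetric])
  have "?H * ?B = real (t choose j) * real ((n - t) choose (r - j)) * fact r / real n ^ r"
    using pos by (simp add: falling_ratio_def)
  also have "\<dots> = ?c * (?x * ?y)"
    unfolding falling_ratio_def fac pw by simp
  finally have "\<bar>?H - ?c * ((real t / n) ^ j * (1 - real t / n) ^ (r - j))\<bar> \<le>
      \<bar>1 - ?B\<bar> + \<bar>?c * (?x * ?y) - ?c * ((real t / n) ^ j * (1 - real t / n) ^ (r - j))\<bar>"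
    by (rule ratio_approx[OF _ H])
  moreover have "\<bar>1 - ?B\<bar> \<le> (real r)\<^sup>2 / n"
    using falling_ratio_approx(1)[of n n r] assms by simp
  moreover have "\<bar>?c * (?x * ?y) - ?c * ((real t / n) ^ j * (1 - real t / n) ^ (r - j))\<bar> \<le> ?c * (2 * ((real r)\<^sup>2 / n))"
  proof -
    have n1: "real (n - t) / n = 1 - real t / n" using assms by (simp add: field_simps of_nat_diff)
    have "\<bar>?x * ?y - (real t / n) ^ j * (1 - real t / n) ^ (r - j)\<bar> \<le>
        \<bar>?x - (real t / n) ^ j\<bar> + \<bar>?y - (1 - real t / n) ^ (r - j)\<bar>"
      using falling_ratio_approx(2,3)[of t n j] assms
      by (intro product_diff_le) (auto intro!: power_le_one simp: power_abs)
    also have "\<dots> \<le> (real j)\<^sup>2 / n + (real (r - j))\<^sup>2 / n"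
      using falling_ratio_approx(1)[of t n j] falling_ratio_approx(1)[of "n - t" n "r - j"] assms n1
      by (intro add_mono) auto
    also have "\<dots> \<le> (real r)\<^sup>2 / n + (real r)\<^sup>2 / n"
      using assms by (intro add_mono divide_right_mono power_mono) auto
    finally have "?c * \<bar>?x * ?y - (real t / n) ^ j * (1 - real t / n) ^ (r - j)\<bar> \<le> ?c * (2 * ((real r)\<^sup>2 / n))"
      by (intro mult_left_mono) auto
    then show ?thesis by (simp only: right_diff_distrib[symmetric] abs_mult abs_of_nat)
  qed
  ultimately show ?thesis by (simp add: algebra_simps add_divide_distrib)
qed

section \<open>The survival map and its largest fixed point\<close>

text \<open>The chance that a Poisson(d) number of edges, each with \<open>r - 1\<close> further
  vertices that survive independently with probability \<open>x\<close>, contains a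
  survivor.\<close>

definition survival_map :: "nat \<Rightarrow> real \<Rightarrow> real \<Rightarrow> real" where
  "survival_map r d x = 1 - F_map r d (1 - x)"

lemma exp_minus_diff_le:
  fixes x y :: real
  assumes "0 \<le> x" "0 \<le> y"
  shows "\<bar>exp (- x) - exp (- y)\<bar> \<le> \<bar>x - y\<bar>"
proof -
  have *: "exp (- a) - exp (- b) \<le> b - a" if "0 \<le> a" "a \<le> b" for a b :: real
  proof -
    have "exp (- a) - exp (- b) = exp (- a) * (1 - exp (- (b - a)))"
      by (simp add: algebra_simps exp_add[symmetric] exp_minus_inverse)
    also have "\<dots> \<le> 1 * (b - a)"
    proof (rule mult_mono)
      show "1 - exp (- (b - a)) \<le> b - a" using exp_ge_add_one_self[of "- (b - a)"] by linarith
    qed (use that in auto)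
    finally show ?thesis by simp
  qed
  show ?thesis
  proof (cases "x \<le> y")
    case True
    then show ?thesis using *[of x y] assms by (simp add: abs_if)
  next
    case False
    then show ?thesis using *[of y x] assms by (simp add: abs_if)
  qed
qed

lemma one_minus_power_bounds:
  fixes x :: real
  assumes "0 \<le> x" "x \<le> 1"
  shows "0 \<le> 1 - (1 - x) ^ q" "1 - (1 - x) ^ q \<le> 1"
  using assms by (auto intro: power_le_one)

lemma survival_map_lipschitz:
  assumes "0 \<le> d" "r \<ge> 1" "0 \<le> x" "x \<le> 1" "0 \<le> y" "y \<le> 1"
  shows "\<bar>survival_map r d x - survival_map r d y\<bar> \<le> d * (real r - 1) * \<bar>x - y\<bar>"
proof -
  let ?g = "\<lambda>x. d * (1 - (1 - x) ^ (r - 1))"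
  have "\<bar>survival_map r d x - survival_map r d y\<bar> = \<bar>exp (- ?g x) - exp (- ?g y)\<bar>"
    by (simp add: survival_map_def F_map_def abs_minus_commute)
  also have "\<dots> \<le> \<bar>?g x - ?g y\<bar>"
    using assms one_minus_power_bounds by (intro exp_minus_diff_le mult_nonneg_nonneg) auto
  also have "\<dots> = d * \<bar>(1 - x) ^ (r - 1) - (1 - y) ^ (r - 1)\<bar>"
    using assms by (simp add: right_diff_distrib[symmetric] abs_mult abs_minus_commute)
  also have "\<dots> \<le> d * (real (r - 1) * \<bar>(1 - x) - (1 - y)\<bar>)"
    using assms by (intro mult_left_mono power_diff_le) auto
  finally show ?thesis using assms by (simp add: of_nat_diff abs_minus_commute mult_ac)
qed

lemma survival_map_mono:
  assumes "0 \<le> d" "0 \<le> x" "x \<le> y" "y \<le> 1"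
  shows "survival_map r d x \<le> survival_map r d y"
proof -
  have "(1 - y) ^ (r - 1) \<le> (1 - x) ^ (r - 1)" using assms by (intro power_mono) auto
  then have "d * (1 - (1 - x) ^ (r - 1)) \<le> d * (1 - (1 - y) ^ (r - 1))" using assms by (intro mult_left_mono) auto
  then show ?thesis by (simp add: survival_map_def F_map_def)
qed

text \<open>The map is at most 1 at 1, so a point above \<open>rho_star r d\<close> where it is not
  below the diagonal would yield, by continuity, a fixed point above the largest one.\<close>

lemma survival_map_less:
  assumes d: "0 < d" and r: "r \<ge> 2" and x: "rho_star r d < x" "x \<le> 1"
  shows "survival_map r d x < x"
proof (rule ccontr)
  assume "\<not> ?thesis"
  then have ge: "x \<le> survival_map r d x" by simp
  have nn: "0 \<le> rho_star r d" using rho_star_greatest(2)[of d r] d by simp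
  have "continuous_on {x..1} (\<lambda>x. survival_map r d x - x)"
    unfolding survival_map_def F_map_def by (intro continuous_intros)
  moreover have "survival_map r d 1 - 1 \<le> 0" by (simp add: survival_map_def F_map_def)
  ultimately obtain z where z: "x \<le> z" "z \<le> 1" "survival_map r d z - z = 0"
    using IVT2'[of "\<lambda>x. survival_map r d x - x" 1 0 x] ge x by auto
  then have "1 - z = F_map r d (1 - z)" by (simp add: survival_map_def)
  then have "z \<le> rho_star r d" using rho_star_greatest(4)[of d z r] d z by simp
  then show False using x z by simp
qed

lemma rho_star_fixed:
  assumes "0 < d"
  shows "survival_map r d (rho_star r d) = rho_star r d"
  using rho_star_greatest(1)[of d r] assms by (simp add: survival_map_def)

text \<open>\<open>y = F_map r d y\<close> can be solved for \<open>d\<close>, and the solution is strictly decreasing in \<open>y\<close>;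
  this gives the left continuity of \<open>rho_star\<close> in \<open>d\<close>.\<close>

lemma ln_ratio_decreasing:
  fixes y z :: real
  assumes "0 < y" "y < z" "z < 1"
  shows "- ln z * (1 - y) < - ln y * (1 - z)"
proof -
  define t where "t = (z - y) / (1 - y)"
  have t: "0 < t" "t < 1" using assms by (auto simp: t_def field_simps)
  have "1 - t = (1 - z) / (1 - y)" using assms by (simp add: t_def field_simps)
  \<comment> \<open>The claim is strict concavity of \<open>ln\<close> on the segment from
    \<open>y\<close> to 1, with \<open>z\<close> as the convex combination.\<close>
  have zt: "z = (1 - t) * y + t * 1"
  proof -
    have "t * (1 - y) = z - y" using assms by (simp add: t_def)
    then show ?thesis by (simp add: algebra_simps)
  qed
  have "(1 - t) * ln y < ln z"
  proof -
    have strict: "ln u < u - 1" if "0 < u" "u \<noteq> 1" for u :: real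
      using ln_le_minus_one[of u] ln_eq_minus_one[of u] that by force
    have "ln (y / z) < y / z - 1" using assms by (intro strict) auto
    then have a: "ln z - ln y > 1 - y / z" using assms by (simp add: ln_div)
    have "ln (1 / z) < 1 / z - 1" using assms by (intro strict) auto
    then have b: "- ln z < 1 / z - 1" using assms by (simp add: ln_div)
    have "t * (- ln z) < t * (1 / z - 1)" by (rule mult_strict_left_mono[OF b t(1)])
    moreover have "(1 - t) * (1 - y / z) < (1 - t) * (ln z - ln y)"
      by (rule mult_strict_left_mono[OF a]) (use t in simp)
    moreover have "(1 - t) * (1 - y / z) = t * (1 / z - 1)"
      using zt assms by (simp add: field_simps)
    ultimately show ?thesis by (simp add: algebra_simps)
  qed
  then have "(1 - t) * ln y * (1 - y) < ln z * (1 - y)" using assms by (intro mult_strict_right_mono) auto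
  moreover have "(1 - t) * (1 - y) = 1 - z" using zt by (simp add: algebra_simps)
  then have "(1 - t) * ln y * (1 - y) = ln y * (1 - z)" by (metis mult.assoc mult.commute)
  ultimately show ?thesis by linarith
qed

lemma rho_star_left_continuous:
  assumes d: "0 < d" and r: "r \<ge> 2" and x: "0 < x" "x < rho_star r d"
  obtains d' where "0 < d'" "d' < d" "x \<le> rho_star r d'"
proof -
  let ?q = "r - 1" and ?y = "1 - rho_star r d" and ?z = "1 - x"
  \<comment> \<open>The density at which \<open>?z\<close> solves \<open>?z = F_map r d' ?z\<close>;
    then \<open>x\<close> is a solution for \<open>d'\<close> and so at most
    \<open>rho_star r d'\<close>.\<close>
  define d' where "d' = - ln ?z / (1 - ?z ^ ?q)"
  have yF: "?y = F_map r d ?y" using rho_star_greatest(1)[of d r] d by simp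
  then have y0: "0 < ?y" by (metis F_map_def exp_gt_zero)
  have z: "?y < ?z" "?z < 1" "0 < ?z" using x y0 by auto
  have q: "?q > 0" using r by simp
  have zq: "?y ^ ?q < ?z ^ ?q" "?z ^ ?q < 1" "0 < ?y ^ ?q"
    using z y0 q by (auto intro!: power_strict_mono simp: power_less_one_iff)
  have "ln ?y = - d * (1 - ?y ^ ?q)"
    using yF unfolding F_map_def by (metis ln_exp)
  then have lny: "- ln ?y = d * (1 - ?y ^ ?q)" by simp
  \<comment> \<open>Monotonicity is applied to the powers, since \<open>1 - ?y ^ ?q\<close> occurs
    in the equation; the factor \<open>?q\<close> from the logarithms cancels.\<close>
  have "- ln (?z ^ ?q) * (1 - ?y ^ ?q) < - ln (?y ^ ?q) * (1 - ?z ^ ?q)"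
    using zq by (intro ln_ratio_decreasing)
  then have "real ?q * (- ln ?z * (1 - ?y ^ ?q)) < real ?q * (- ln ?y * (1 - ?z ^ ?q))"
    using z y0 unfolding ln_realpow by (simp only: mult_minus_left mult_minus_right mult.assoc ln_realpow)
  then have "- ln ?z * (1 - ?y ^ ?q) < - ln ?y * (1 - ?z ^ ?q)" using q by simp
  also have "\<dots> = d * (1 - ?z ^ ?q) * (1 - ?y ^ ?q)" unfolding lny by simp
  finally have "- ln ?z < d * (1 - ?z ^ ?q)"
  proof (rule mult_right_less_imp_less)
    show "0 \<le> 1 - ?y ^ ?q" using zq by linarith
  qed
  then have 1: "d' < d" unfolding d'_def using zq by (subst pos_divide_less_eq) auto
  have "ln ?z < 0" using z by simp
  then have 2: "0 < d'" unfolding d'_def using zq by (intro divide_pos_pos) auto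
  have "- d' * (1 - ?z ^ ?q) = ln ?z" unfolding d'_def using zq by simp
  then have "?z = F_map r d' ?z" unfolding F_map_def using z by simp
  then have "x \<le> rho_star r d'" using rho_star_greatest(4)[of d' x r] 2 z by simp
  then show ?thesis using that 1 2 by blast
qed

section \<open>The star probability in the limit\<close>

text \<open>Puts the star probability into the shape of \<open>F_map\<close>, with the exact rate
  \<open>- N * ln (1 - p)\<close> in place of \<open>d\<close> and a ratio of binomial coefficients
  in place of the power.\<close>

lemma one_minus_power_eq_exp:
  fixes p :: real and C N :: nat
  assumes "0 < p" "p \<le> 1/2" "C \<le> N"
  shows "(1 - p) ^ (N - C) = exp (- (- real N * ln (1 - p)) * (1 - real C / N))"
proof (cases "N = 0")
  case False
  have "exp (- (- real N * ln (1 - p)) * (1 - real C / N)) = exp (real (N - C) * ln (1 - p))"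
    using False assms by (simp add: field_simps of_nat_diff)
  also have "\<dots> = (1 - p) ^ (N - C)"
    using assms by (simp only: exp_of_nat_mult) simp
  finally show ?thesis by simp
qed (use assms in simp)

lemma ln_one_minus_bounds:
  fixes p :: real
  assumes "0 \<le> p" "p \<le> 1/2"
  shows "p \<le> - ln (1 - p)" "- ln (1 - p) \<le> p + 2 * p\<^sup>2"
proof -
  show "p \<le> - ln (1 - p)" using ln_le_minus_one[of "1 - p"] assms by simp
  have "- ln (1 - p) = ln (1 / (1 - p))" using assms by (simp add: ln_div)
  also have "\<dots> \<le> 1 / (1 - p) - 1" using assms by (intro ln_le_minus_one) auto
  also have "\<dots> = p / (1 - p)" using assms by (simp add: field_simps)
  also have "\<dots> \<le> p + 2 * p\<^sup>2"
  proof -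
    have "p \<le> (p + 2 * p\<^sup>2) * (1 - p)"
    proof -
      have "(p + 2 * p\<^sup>2) * (1 - p) - p = p\<^sup>2 * (1 - 2 * p)" by (simp add: algebra_simps power2_eq_square)
      moreover have "0 \<le> p\<^sup>2 * (1 - 2 * p)" using assms by (intro mult_nonneg_nonneg) auto
      ultimately show ?thesis by linarith
    qed
    then show ?thesis using assms by (simp add: pos_divide_le_eq)
  qed
  finally show "- ln (1 - p) \<le> p + 2 * p\<^sup>2" .
qed

text \<open>The three errors: \<open>p * N\<close> against \<open>d\<close>, the logarithm against
  its linear term, and sampling without replacement.\<close>

lemma (in vertex_set) star_prob_approx:
  fixes p d :: real and t :: nat
  assumes p: "0 < p" "p \<le> 1/2" and d: "0 \<le> d" and t: "t < n"
  shows "\<bar>star_prob p t - survival_map r d (t / n)\<bar> \<le>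
     \<bar>p * N - d\<bar> + 2 * p * (p * N) + d * (2 * ((real (r - 1))\<^sup>2 + real (r - 1)) / n)"
proof -
  let ?C = "(n - 1 - t) choose (r - 1)" and ?q = "r - 1"
  let ?H = "real ?C / N" and ?h = "(1 - real t / n) ^ ?q"
  define a where "a = - real N * ln (1 - p)"
  have CN: "?C \<le> N" by (rule binomial_right_mono) simp
  have H: "0 \<le> ?H" "?H \<le> 1" using CN N_pos by (auto simp: pos_divide_le_eq)
  have h: "0 \<le> 1 - ?h" "1 - ?h \<le> 1"
    using t one_minus_power_bounds[of "real t / n" ?q] by auto
  have "real N * p \<le> real N * (- ln (1 - p))" "real N * (- ln (1 - p)) \<le> real N * (p + 2 * p\<^sup>2)"
    by (rule mult_left_mono; use ln_one_minus_bounds[of p] p in simp)+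
  then have "p * N \<le> a" "a \<le> p * N + 2 * p * (p * N)"
    unfolding a_def by (simp_all add: algebra_simps power2_eq_square)
  moreover have "0 \<le> p * N" using p by simp
  ultimately have a: "\<bar>a - p * N\<bar> \<le> 2 * p * (p * N)" "0 \<le> a" by linarith+
  have "\<bar>star_prob p t - survival_map r d (t / n)\<bar> = \<bar>exp (- (a * (1 - ?H))) - exp (- (d * (1 - ?h)))\<bar>"
    using one_minus_power_eq_exp[OF p CN] p
    by (simp add: star_prob_def survival_map_def F_map_def a_def abs_minus_commute)
  also have "\<dots> \<le> \<bar>a * (1 - ?H) - d * (1 - ?h)\<bar>"
    using a d H h by (intro exp_minus_diff_le mult_nonneg_nonneg) auto
  also have "a * (1 - ?H) - d * (1 - ?h) = (a - d) * (1 - ?H) + d * (?h - ?H)"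
    by (simp only: algebra_simps)
  also have "\<bar>\<dots>\<bar> \<le> \<bar>(a - d) * (1 - ?H)\<bar> + \<bar>d * (?h - ?H)\<bar>" by (rule abs_triangle_ineq)
  also have "\<bar>(a - d) * (1 - ?H)\<bar> \<le> \<bar>a - d\<bar> * 1"
    unfolding abs_mult using H by (intro mult_left_mono) auto
  also have "\<bar>a - d\<bar> * 1 \<le> \<bar>p * N - d\<bar> + \<bar>a - p * N\<bar>"
    using abs_triangle_ineq[of "p * N - d" "a - p * N"] by simp
  also have "\<dots> \<le> \<bar>p * N - d\<bar> + 2 * p * (p * N)" by (rule add_left_mono[OF a(1)])
  also have "\<bar>d * (?h - ?H)\<bar> \<le> d * (2 * ((real ?q)\<^sup>2 + real ?q) / n)"
    unfolding abs_mult using d star_ratio_approx[of t n ?q] t nr r3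
    by (intro mult_mono) (auto simp: abs_minus_commute)
  finally show ?thesis by simp
qed

section \<open>Size of the set of large vertices\<close>

locale sparse_hypergraph =
  fixes r :: nat and d :: real and dn :: "nat \<Rightarrow> real"
  assumes r3: "r \<ge> 3" and d_pos: "d > 0" and dn_lim: "dn \<longlonglongrightarrow> d"
begin

abbreviation "\<rho> \<equiv> rho_star r d"

definition p :: "nat \<Rightarrow> real" where
  "p n = dn n / real ((n - 1) choose (r - 1))"

abbreviation rs :: "nat \<Rightarrow> nat set set" where "rs n \<equiv> rsets {1..n} r"
abbreviation L :: "nat \<Rightarrow> nat \<Rightarrow> nat set set \<Rightarrow> nat set" where "L k n \<equiv> large {1..n} k"

definition E :: "nat \<Rightarrow> (nat set set \<Rightarrow> real) \<Rightarrow> real" where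
  "E n f = Ebin (rs n) (p n) f"

text \<open>Holds for all large \<open>n\<close>. As \<open>0 < p n \<le> 1/2\<close>, the parameter
  of \<open>bernoulli_pmf\<close> is not clamped and the estimates with the factor 2 apply.\<close>

definition good :: "nat \<Rightarrow> bool" where
  "good n \<longleftrightarrow> n \<ge> r \<and> 0 < p n \<and> p n \<le> 1/2 \<and> d/2 < dn n \<and> dn n < 2 * d"

lemma rho_bounds: "0 \<le> \<rho>" "\<rho> \<le> 1"
  using rho_star_greatest(2,3)[of d r] d_pos by auto

lemma vertex_set_interval: "n \<ge> r \<Longrightarrow> vertex_set {1..n} r"
  by unfold_locales (use r3 in auto)

lemma binomial_large:
  assumes "n \<ge> r"
  shows "real (n - 1) / real (r - 1) \<le> real ((n - 1) choose (r - 1))"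
proof -
  interpret VS: vertex_set "{1..n}" r by (rule vertex_set_interval[OF assms])
  have "(n - 1) * 1 \<le> (n - 1) * ((n - 2) choose (r - 2))"
    using VS.N2_pos by (intro mult_left_mono) (auto simp: Suc_le_eq)
  also have "\<dots> = (r - 1) * ((n - 1) choose (r - 1))" using VS.N2_N by simp
  finally have "real (n - 1) \<le> real (r - 1) * real ((n - 1) choose (r - 1))"
    by (simp only: of_nat_mult[symmetric] of_nat_le_iff mult_1_right)
  then show ?thesis using r3 by (simp add: pos_divide_le_eq mult.commute)
qed

lemma p_lim: "p \<longlonglongrightarrow> 0"
proof -
  have "filterlim (\<lambda>n. real (n - 1) / real (r - 1)) at_top sequentially"
    using r3 by real_asymp
  then have "filterlim (\<lambda>n. real ((n - 1) choose (r - 1))) at_top sequentially"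
    by (rule filterlim_at_top_mono[OF _ eventually_mono[OF eventually_ge_at_top[of r] binomial_large]])
  then show ?thesis
    unfolding p_def[abs_def] by (intro real_tendsto_divide_at_top[OF dn_lim])
qed

lemma eventually_good: "eventually good sequentially"
proof -
  have "eventually (\<lambda>n. d/2 < dn n) sequentially" "eventually (\<lambda>n. dn n < 2 * d) sequentially"
    using order_tendstoD(1)[OF dn_lim, of "d/2"] order_tendstoD(2)[OF dn_lim, of "2 * d"] d_pos by simp_all
  moreover have "eventually (\<lambda>n. p n < 1/2) sequentially" using order_tendstoD(2)[OF p_lim, of "1/2"] by simp
  ultimately show ?thesis using eventually_ge_at_top[of r]
  proof eventually_elim
    case (elim n)
    interpret VS: vertex_set "{1..n}" r by (rule vertex_set_interval) fact
    have "0 < dn n" using elim d_pos by simp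
    then have "0 < p n" using VS.N_pos by (simp add: p_def)
    then show ?case using elim by (simp add: good_def)
  qed
qed

lemma goodD:
  assumes "good n"
  shows "vertex_set {1..n} r" "0 \<le> p n" "0 < p n" "p n \<le> 1/2" "p n \<le> 1"
    "p n * real ((n - 1) choose (r - 1)) = dn n" "0 < dn n" "dn n < 2 * d" "n \<ge> 3" "n > 0"
proof -
  show v: "vertex_set {1..n} r" using assms by (intro vertex_set_interval) (simp add: good_def)
  interpret VS: vertex_set "{1..n}" r by (rule v)
  show "p n * real ((n - 1) choose (r - 1)) = dn n" using VS.N_pos by (simp add: p_def)
qed (use assms r3 d_pos in \<open>auto simp: good_def\<close>)

lemma E_mono:
  assumes "good n" "\<And>X. X \<subseteq> rs n \<Longrightarrow> f X \<le> g X"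
  shows "E n f \<le> E n g"
  unfolding E_def by (rule Ebin_mono) (use goodD[OF assms(1)] assms(2) in auto)

lemma E_add: "E n (\<lambda>X. f X + g X) = E n f + E n g"
  and E_cmult: "E n (\<lambda>X. c * f X) = c * E n f"
  and E_diff: "E n (\<lambda>X. f X - g X) = E n f - E n g"
  by (simp_all add: E_def Ebin_add Ebin_cmult Ebin_diff)

lemma finite_A: "finite (rs n)"
  by (rule finite_subset[of _ "Pow {1..n}"]) (auto simp: rsets_def)

lemma E_const: "E n (\<lambda>X. c) = c"
  unfolding E_def by (rule Ebin_const[OF finite_A])

lemma E_abs_diff:
  assumes "good n"
  shows "\<bar>E n f - c\<bar> \<le> E n (\<lambda>X. \<bar>f X - c\<bar>)"
proof -
  have "E n f - c = E n (\<lambda>X. f X - c)" by (simp add: E_diff E_const)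
  then show ?thesis unfolding E_def using Ebin_abs_le goodD[OF assms] by metis
qed

text \<open>The mean of \<open>f k n\<close> is \<open>o(n)\<close> when first \<open>n\<close> and then \<open>k\<close> tends to infinity.\<close>

definition negl :: "(nat \<Rightarrow> nat \<Rightarrow> nat set set \<Rightarrow> real) \<Rightarrow> bool" where
  "negl f \<longleftrightarrow> (\<forall>\<epsilon>>0. \<exists>K. \<forall>k\<ge>K. \<forall>\<^sub>F n in sequentially. E n (f k n) \<le> \<epsilon> * real n)"

text \<open>The general way to show that an error is negligible: for each fixed \<open>k\<close> the
  part \<open>b k n\<close> vanishes as \<open>n\<close> grows, however badly it depends on
  \<open>k\<close>, and the rest is controlled by an error already known to be negligible.\<close>

lemma negl_bound:
  fixes b :: "nat \<Rightarrow> nat \<Rightarrow> real" and c :: real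
  assumes le: "\<And>k. k \<ge> 1 \<Longrightarrow> \<forall>\<^sub>F n in sequentially. E n (f k n) \<le> b k n * n + c * E n (g k n)"
    and b: "\<And>k. (\<lambda>n. b k n) \<longlonglongrightarrow> 0" and c: "0 \<le> c" and g: "negl g"
  shows "negl f"
  unfolding negl_def
proof (intro allI impI)
  fix \<epsilon> :: real assume e: "\<epsilon> > 0"
  have "\<epsilon> / (2 * (c + 1)) > 0" using e c by simp
  from g[unfolded negl_def, rule_format, OF this]
  obtain K where K: "\<And>k. k \<ge> K \<Longrightarrow> \<forall>\<^sub>F n in sequentially. E n (g k n) \<le> \<epsilon> / (2 * (c + 1)) * n"
    by blast
  have "\<forall>\<^sub>F n in sequentially. E n (f k n) \<le> \<epsilon> * n" if k: "k \<ge> max K 1" for k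
  proof -
    have "\<forall>\<^sub>F n in sequentially. b k n < \<epsilon> / 2" using order_tendstoD(2)[OF b, of "\<epsilon> / 2"] e by simp
    moreover have "\<forall>\<^sub>F n in sequentially. E n (f k n) \<le> b k n * n + c * E n (g k n)" using le k by simp
    moreover have "\<forall>\<^sub>F n in sequentially. E n (g k n) \<le> \<epsilon> / (2 * (c + 1)) * n" using K k by simp
    ultimately show ?thesis
    proof eventually_elim
      case 4: (elim n)
      have "c * E n (g k n) \<le> c * (\<epsilon> / (2 * (c + 1)) * n)" using 4 c by (intro mult_left_mono) auto
      also have "\<dots> = c / (c + 1) * (\<epsilon> / 2 * n)" by simp
      also have "\<dots> \<le> 1 * (\<epsilon> / 2 * n)" using c e by (intro mult_right_mono) auto
      finally have "c * E n (g k n) \<le> \<epsilon> / 2 * n" by simp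
      moreover have "b k n * n \<le> \<epsilon> / 2 * n" using 4 by (intro mult_right_mono) auto
      ultimately show ?case using 4 by (simp add: algebra_simps)
    qed
  qed
  then show "\<exists>K. \<forall>k\<ge>K. \<forall>\<^sub>F n in sequentially. E n (f k n) \<le> \<epsilon> * n" by blast
qed

lemma negl_zero: "negl (\<lambda>k n X. 0)"
  by (auto simp: negl_def E_const)

lemma negl_tendsto:
  fixes b :: "nat \<Rightarrow> nat \<Rightarrow> real"
  assumes "\<And>k. k \<ge> 1 \<Longrightarrow> \<forall>\<^sub>F n in sequentially. E n (f k n) \<le> b k n * n" "\<And>k. (\<lambda>n. b k n) \<longlonglongrightarrow> 0"
  shows "negl f"
  by (rule negl_bound[OF _ assms(2) order_refl negl_zero]) (use assms(1) in simp)

lemma negl_cmult: "negl f \<Longrightarrow> 0 \<le> c \<Longrightarrow> negl (\<lambda>k n X. c * f k n X)"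
  by (rule negl_bound[where b = "\<lambda>_ _. 0" and c = c]) (auto simp: E_cmult)

lemma negl_add:
  assumes "negl f" "negl g"
  shows "negl (\<lambda>k n X. f k n X + g k n X)"
  unfolding negl_def
proof (intro allI impI)
  fix \<epsilon> :: real assume "\<epsilon> > 0"
  then have "\<epsilon> / 2 > 0" by simp
  from assms(1)[unfolded negl_def, rule_format, OF this] assms(2)[unfolded negl_def, rule_format, OF this]
  obtain K1 K2 where K: "\<And>k. k \<ge> K1 \<Longrightarrow> \<forall>\<^sub>F n in sequentially. E n (f k n) \<le> \<epsilon> / 2 * n"
    "\<And>k. k \<ge> K2 \<Longrightarrow> \<forall>\<^sub>F n in sequentially. E n (g k n) \<le> \<epsilon> / 2 * n"
    by blast
  have "\<forall>\<^sub>F n in sequentially. E n (\<lambda>X. f k n X + g k n X) \<le> \<epsilon> * n" if "k \<ge> max K1 K2" for k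
    using eventually_conj[OF K(1)[of k] K(2)[of k]] that
    by (auto elim!: eventually_mono simp: E_add)
  then show "\<exists>K. \<forall>k\<ge>K. \<forall>\<^sub>F n in sequentially. E n (\<lambda>X. f k n X + g k n X) \<le> \<epsilon> * n" by blast
qed

lemma negl_mono:
  assumes "\<And>k n X. k \<ge> 1 \<Longrightarrow> good n \<Longrightarrow> X \<subseteq> rs n \<Longrightarrow> f k n X \<le> g k n X" "negl g"
  shows "negl f"
proof -
  have "\<forall>\<^sub>F n in sequentially. E n (f k n) \<le> 0 * real n + 1 * E n (g k n)" if "k \<ge> 1" for k
    using eventually_good
  proof eventually_elim
    case (elim n)
    then show ?case using E_mono[OF elim, of "f k n" "g k n"] assms(1)[OF that elim] by simp
  qed
  then show ?thesis
    by (rule negl_bound[where b = "\<lambda>_ _. 0" and c = 1 and g = g]) (use assms(2) in auto)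
qed

lemma negl_scale_index:
  assumes "negl f"
  shows "negl (\<lambda>k. f (r * k))"
  unfolding negl_def
proof (intro allI impI)
  fix \<epsilon> :: real assume "\<epsilon> > 0"
  from assms[unfolded negl_def, rule_format, OF this]
  obtain K where K: "\<And>k. k \<ge> K \<Longrightarrow> \<forall>\<^sub>F n in sequentially. E n (f k n) \<le> \<epsilon> * n"
    by blast
  have "k \<le> r * k" for k using r3 by simp
  then show "\<exists>K. \<forall>k\<ge>K. \<forall>\<^sub>F n in sequentially. E n (f (r * k) n) \<le> \<epsilon> * n"
    using K order_trans by blast
qed

text \<open>For quantities free of the cut-off, such as the size of the core, the iterated limit is
  an ordinary one.\<close>

lemma negl_const_index:
  assumes "negl (\<lambda>k. f)" "\<And>n X. 0 \<le> f n X"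
  shows "(\<lambda>n. E n (f n) / n) \<longlonglongrightarrow> 0"
proof (rule tendstoI)
  fix \<epsilon> :: real assume "\<epsilon> > 0"
  then have "\<epsilon> / 2 > 0" by simp
  from assms(1)[unfolded negl_def, rule_format, OF this]
  have "\<forall>\<^sub>F n in sequentially. E n (f n) \<le> \<epsilon> / 2 * n" by blast
  then show "\<forall>\<^sub>F n in sequentially. dist (E n (f n) / n) 0 < \<epsilon>"
    using eventually_good
  proof eventually_elim
    case (elim n)
    have "0 \<le> E n (f n)" unfolding E_def
      by (rule Ebin_nonneg) (use goodD[OF elim(2)] assms(2) in auto)
    moreover have "E n (f n) / n \<le> \<epsilon> / 2"
      using elim(1) goodD(10)[OF elim(2)] by (subst pos_divide_le_eq) auto
    then have "E n (f n) / n < \<epsilon>" using \<open>\<epsilon> > 0\<close> by linarith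
    ultimately show ?case by (simp add: dist_real_def)
  qed
qed

text \<open>The fluctuation, relative to \<open>n\<close>, of a count on which one edge has bounded
  effect; \<open>dn n * n / r\<close> is the expected number of edges.\<close>

definition fluct :: "nat \<Rightarrow> real" where
  "fluct n = sqrt (dn n * n / r) / n"

lemma fluct_lim: "fluct \<longlonglongrightarrow> 0"
proof -
  have "(\<lambda>n. sqrt (dn n / r) * (1 / sqrt (real n))) \<longlonglongrightarrow> sqrt (d / r) * 0"
    by (intro tendsto_mult tendsto_real_sqrt tendsto_divide dn_lim tendsto_const) (use r3 in simp, real_asymp)
  moreover have "\<forall>\<^sub>F n in sequentially. sqrt (dn n / r) * (1 / sqrt (real n)) = fluct n"
    using eventually_gt_at_top[of 0]
  proof eventually_elim
    case (elim n)
    have "sqrt (dn n * n / r) = sqrt (dn n / r) * sqrt n"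
      by (simp add: real_sqrt_mult[symmetric])
    moreover have "sqrt (real n) / n = 1 / sqrt n" using elim by (simp add: real_div_sqrt field_simps)
    ultimately show ?case unfolding fluct_def by (metis times_divide_eq_right)
  qed
  ultimately show ?thesis by (simp add: filterlim_cong[OF refl refl])
qed

lemma fluct_mult: "n > 0 \<Longrightarrow> fluct n * n = sqrt (dn n * n / r)"
  by (simp add: fluct_def)

section \<open>The fraction of k-large vertices\<close>

definition s :: "nat \<Rightarrow> nat \<Rightarrow> real" where
  "s k n = E n (\<lambda>X. real (card (L k n X))) / n"

lemma card_L_le: "card (L k n X) \<le> n"
  using card_mono[OF _ large_subset[of "{1..n}" k X]] by simp

lemma finite_L: "finite (L k n X)"
  by (rule finite_subset[OF large_subset]) simp

lemma s_bounds:
  assumes "good n"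
  shows "0 \<le> s k n" "s k n \<le> 1"
proof -
  have "0 \<le> E n (\<lambda>X. real (card (L k n X)))" "E n (\<lambda>X. real (card (L k n X))) \<le> n"
    unfolding E_def using goodD[OF assms] finite_A card_L_le
    by (auto intro!: Ebin_nonneg Ebin_le_const)
  then show "0 \<le> s k n" "s k n \<le> 1" using goodD(10)[OF assms] by (auto simp: s_def)
qed

lemma s_antimono:
  assumes "good n" "k \<le> l"
  shows "s l n \<le> s k n"
  unfolding s_def
proof (intro divide_right_mono E_mono[OF assms(1)] of_nat_mono card_mono finite_L)
  show "L l n X \<subseteq> L k n X" for X by (rule large_antimono[OF assms(2)])
qed simp

lemma E_large: "good n \<Longrightarrow> E n (\<lambda>X. real (card (L k n X))) = s k n * n"
  using goodD(10)[of n] by (simp add: s_def)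

lemma large_deviation:
  assumes "good n"
  shows "E n (\<lambda>X. \<bar>real (card (L k n X)) - s k n * n\<bar>) \<le> real (r * k) * fluct n * n"
proof -
  interpret VS: vertex_set "{1..n}" r by (rule goodD[OF assms])
  have c: "card {1..n} = n" by simp
  show ?thesis
    using VS.large_deviation_bound[OF goodD(2,4)[OF assms], of k]
    unfolding c goodD(6)[OF assms] E_def[symmetric] E_large[OF assms] mult.assoc fluct_mult[OF goodD(10)[OF assms]] .
qed

definition star_err :: "nat \<Rightarrow> real" where
  "star_err n = \<bar>dn n - d\<bar> + 2 * p n * dn n + d * (2 * ((real (r - 1))\<^sup>2 + real (r - 1)) / n)"

definition cavity_err :: "nat \<Rightarrow> nat \<Rightarrow> real" where
  "cavity_err k n = star_err n + d * (real r - 1) * (real (r * k) * fluct n + (1 + real (r * k) * dn n) / n)"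

lemma cavity_err_lim: "cavity_err k \<longlonglongrightarrow> 0"
proof -
  have "star_err \<longlonglongrightarrow> \<bar>d - d\<bar> + 2 * 0 * d + d * 0"
    unfolding star_err_def[abs_def] by (intro tendsto_intros dn_lim p_lim lim_const_over_n)
  moreover have "(\<lambda>n. (1 + real (r * k) * dn n) / n) \<longlonglongrightarrow> 0"
  proof -
    have "(\<lambda>n. (1 + real (r * k) * dn n) * (1 / n)) \<longlonglongrightarrow> (1 + real (r * k) * d) * 0"
      by (intro tendsto_intros dn_lim lim_const_over_n)
    then show ?thesis by simp
  qed
  ultimately have "cavity_err k \<longlonglongrightarrow> (\<bar>d - d\<bar> + 2 * 0 * d + d * 0) + d * (real r - 1) * (real (r * k) * 0 + 0)"
    unfolding cavity_err_def[abs_def] by (intro tendsto_intros fluct_lim)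
  then show ?thesis by simp
qed

text \<open>Replaces the random argument of the star probability by a mean: the Lipschitz bound for
  the survival map reduces this to \<open>large_star_diff\<close> and the concentration of the
  number of large vertices.\<close>

lemma cavity_approx:
  assumes g: "good n" and v: "v \<in> {1..n}" and k: "k \<ge> 1"
  shows "\<bar>E n (\<lambda>X. vertex_set.star_prob {1..n} r (p n) (card (L k n {e \<in> X. v \<notin> e} - {v}))) - survival_map r d (s k n)\<bar>
     \<le> cavity_err k n"
proof -
  interpret VS: vertex_set "{1..n}" r by (rule goodD[OF g])
  let ?Y = "\<lambda>X. card (L k n {e \<in> X. v \<notin> e} - {v})" and ?l = "d * (real r - 1)"
  let ?\<phi> = "survival_map r d"
  have n: "n > 0" using goodD(10)[OF g] .
  have l: "0 \<le> ?l" using d_pos r3 by simp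
  have "\<bar>E n (\<lambda>X. VS.star_prob (p n) (?Y X)) - ?\<phi> (s k n)\<bar> \<le> E n (\<lambda>X. \<bar>VS.star_prob (p n) (?Y X) - ?\<phi> (s k n)\<bar>)"
    by (rule E_abs_diff[OF g])
  also have "\<dots> \<le> E n (\<lambda>X. star_err n + ?l / n *
      (\<bar>real (card (L k n X)) - real (?Y X)\<bar> + \<bar>real (card (L k n X)) - s k n * n\<bar>))"
  proof (rule E_mono[OF g])
    fix X
    have "?Y X \<le> card ({1..n} - {v})"
      using large_subset[of "{1..n}" k "{e \<in> X. v \<notin> e}"] by (intro card_mono) auto
    also have "\<dots> = n - 1" using v by simp
    finally have Y: "?Y X < n" using n by simp
    have "\<bar>VS.star_prob (p n) (?Y X) - ?\<phi> (?Y X / n)\<bar> \<le> star_err n"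
      using VS.star_prob_approx[OF goodD(3,4)[OF g], of d "?Y X"] d_pos Y goodD(6)[OF g]
      by (simp add: star_err_def)
    moreover have "\<bar>?\<phi> (?Y X / n) - ?\<phi> (s k n)\<bar> \<le> ?l * \<bar>?Y X / n - s k n\<bar>"
      using d_pos r3 Y s_bounds[OF g] n by (intro survival_map_lipschitz) (auto simp: pos_divide_le_eq)
    moreover have "?l * \<bar>?Y X / n - s k n\<bar> \<le> ?l / n *
      (\<bar>real (card (L k n X)) - real (?Y X)\<bar> + \<bar>real (card (L k n X)) - s k n * n\<bar>)"
    proof -
      have "?Y X / n - s k n = (real (?Y X) - s k n * n) / n"
        using n by (simp add: diff_divide_distrib)
      then have "\<bar>?Y X / n - s k n\<bar> = \<bar>real (?Y X) - s k n * n\<bar> / n" by (simp only: abs_divide abs_of_nat)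
      also have "\<dots> \<le> (\<bar>real (card (L k n X)) - real (?Y X)\<bar> + \<bar>real (card (L k n X)) - s k n * n\<bar>) / n"
        by (intro divide_right_mono) auto
      finally have "?l * \<bar>?Y X / n - s k n\<bar> \<le>
          ?l * ((\<bar>real (card (L k n X)) - real (?Y X)\<bar> + \<bar>real (card (L k n X)) - s k n * n\<bar>) / n)"
        using l by (rule mult_left_mono)
      then show ?thesis by (simp only: times_divide_eq_left times_divide_eq_right)
    qed
    ultimately show "\<bar>VS.star_prob (p n) (?Y X) - ?\<phi> (s k n)\<bar> \<le> star_err n + ?l / n *
      (\<bar>real (card (L k n X)) - real (?Y X)\<bar> + \<bar>real (card (L k n X)) - s k n * n\<bar>)"
      by linarith
  qed
  also have "\<dots> = star_err n + ?l / n *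
      (E n (\<lambda>X. \<bar>real (card (L k n X)) - real (?Y X)\<bar>) + E n (\<lambda>X. \<bar>real (card (L k n X)) - s k n * n\<bar>))"
    unfolding E_add E_cmult E_const ..
  also have "\<dots> \<le> star_err n + ?l / n * ((1 + real (r * k) * dn n) + real (r * k) * fluct n * n)"
    using VS.large_star_diff[OF goodD(2,4)[OF g], of v k] v k goodD(6)[OF g] large_deviation[OF g, of k] l n
    by (intro add_left_mono mult_left_mono add_mono) (auto simp: E_def)
  also have "\<dots> = cavity_err k n"
    unfolding cavity_err_def using n by (simp add: field_simps)
  finally show ?thesis .
qed

lemma E_card_large_sum: "E n (\<lambda>X. real (card (L k n X))) = (\<Sum>v\<in>{1..n}. E n (\<lambda>X. of_bool (v \<in> L k n X)))"
proof -
  have "real (card (L k n X)) = (\<Sum>v\<in>{1..n}. of_bool (v \<in> L k n X))" for X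
    using large_subset[of "{1..n}" k X] by (simp add: sum_of_bool_eq Int_absorb1 Int_def[symmetric])
  then show ?thesis unfolding E_def by (simp only: Ebin_sum)
qed

lemma s_step_lower:
  assumes g: "good n" and k: "k \<ge> 1"
  shows "survival_map r d (s k n) - cavity_err k n \<le> s (k + 1) n"
proof -
  interpret VS: vertex_set "{1..n}" r by (rule goodD[OF g])
  let ?c = "survival_map r d (s k n) - cavity_err k n"
  have "real n * ?c = (\<Sum>v\<in>{1..n}. ?c)" by simp
  also have "\<dots> \<le> (\<Sum>v\<in>{1..n}. E n (\<lambda>X. of_bool (v \<in> L (k + 1) n X)))"
  proof (rule sum_mono)
    fix v assume v: "v \<in> {1..n}"
    show "?c \<le> E n (\<lambda>X. of_bool (v \<in> L (k + 1) n X))"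
      using VS.cavity_lower[OF goodD(2,4)[OF g] v k] cavity_approx[OF g v k] unfolding E_def by linarith
  qed
  also have "\<dots> = s (k + 1) n * n" using E_card_large_sum E_large[OF g] by metis
  finally show ?thesis using goodD(10)[OF g] by (simp add: mult.commute)
qed

lemma s_step_upper:
  assumes g: "good n" and k: "k \<ge> 1" and m: "m \<ge> 1"
  shows "s (m * r * k + 1) n \<le> survival_map r d (s k n) + cavity_err k n + 2 * d / m"
proof -
  interpret VS: vertex_set "{1..n}" r by (rule goodD[OF g])
  let ?c = "survival_map r d (s k n) + cavity_err k n + 2 * d / m"
  have "s (m * r * k + 1) n * n = (\<Sum>v\<in>{1..n}. E n (\<lambda>X. of_bool (v \<in> L (m * r * k + 1) n X)))"
    using E_card_large_sum E_large[OF g] by metis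
  also have "\<dots> \<le> (\<Sum>v\<in>{1..n}. ?c)"
  proof (rule sum_mono)
    fix v assume v: "v \<in> {1..n}"
    have "dn n / m \<le> 2 * d / m" using goodD(8)[OF g] m by (intro divide_right_mono) auto
    then show "E n (\<lambda>X. of_bool (v \<in> L (m * r * k + 1) n X)) \<le> ?c"
      using VS.cavity_upper[OF goodD(2,4)[OF g] v k m] cavity_approx[OF g v k] goodD(6)[OF g]
      unfolding E_def by simp
  qed
  also have "\<dots> = ?c * n" by simp
  finally show ?thesis using goodD(10)[OF g] by simp
qed

lemma s_one: "good n \<Longrightarrow> s 1 n = 1"
proof -
  assume g: "good n"
  have "E n (\<lambda>X. real (card (L 1 n X))) = E n (\<lambda>X. real n)"
    unfolding E_def
  proof (rule Ebin_cong)
    fix X assume "X \<subseteq> rs n"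
    then have "L 1 n X = {1..n}" by (intro large_one) (auto simp: rsets_def)
    then show "real (card (L 1 n X)) = real n" by simp
  qed
  then show "s 1 n = 1" using goodD(10)[OF g] by (simp add: s_def E_const)
qed

text \<open>Induction from \<open>s 1 n = 1 \<ge> \<rho>\<close>: \<rho> is a fixed point of a
  monotone map, so a deficit below \<rho> grows at most by the Lipschitz constant in each step. This
  amplification is harmless because \<open>k\<close> is fixed while \<open>n\<close> tends to
  infinity.\<close>

lemma s_lower:
  assumes "k \<ge> 1" "\<epsilon> > 0"
  shows "\<forall>\<^sub>F n in sequentially. \<rho> - \<epsilon> \<le> s k n"
  using assms
proof (induction k arbitrary: \<epsilon> rule: nat_induct_at_least)
  case base
  then show ?case using eventually_good by (rule_tac eventually_mono) (use rho_bounds s_one in fastforce)+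
next
  case (Suc k)
  let ?l = "d * (real r - 1)"
  have l: "?l > 0" using d_pos r3 by simp
  \<comment> \<open>Half of \<epsilon> pays for the amplified deficit of level \<open>k\<close>,
    half for \<open>cavity_err\<close>.\<close>
  define \<delta> where "\<delta> = \<epsilon> / (2 * ?l)"
  have \<delta>: "\<delta> > 0" "?l * \<delta> = \<epsilon> / 2"
  proof -
    have "l * (\<epsilon> / (2 * l)) = \<epsilon> / 2" if "l > 0" for l :: real using that by simp
    then show "?l * \<delta> = \<epsilon> / 2" using l unfolding \<delta>_def by blast
    show "\<delta> > 0" unfolding \<delta>_def using l Suc.prems by (intro divide_pos_pos) auto
  qed
  have "\<forall>\<^sub>F n in sequentially. cavity_err k n < \<epsilon> / 2"
    using order_tendstoD(2)[OF cavity_err_lim, of "\<epsilon> / 2"] Suc.prems by simp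
  then show ?case using Suc.IH[OF \<delta>(1)] eventually_good
  proof eventually_elim
    case (elim n)
    have "\<rho> - ?l * \<delta> \<le> survival_map r d (s k n)"
    proof (cases "\<rho> \<le> s k n")
      case True
      then have "survival_map r d \<rho> \<le> survival_map r d (s k n)"
        using rho_bounds s_bounds[OF elim(3)] d_pos by (intro survival_map_mono) auto
      moreover have "0 \<le> ?l * \<delta>" by (rule less_imp_le[OF mult_pos_pos[OF l \<delta>(1)]])
      ultimately show ?thesis using rho_star_fixed[OF d_pos, of r] by linarith
    next
      case False
      have "\<bar>survival_map r d \<rho> - survival_map r d (s k n)\<bar> \<le> ?l * \<bar>\<rho> - s k n\<bar>"
        using rho_bounds s_bounds[OF elim(3)] d_pos r3 by (intro survival_map_lipschitz) auto
      also have "\<dots> \<le> ?l * \<delta>" using False elim l by (intro mult_left_mono) auto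
      finally show ?thesis using rho_star_fixed[OF d_pos, of r] by linarith
    qed
    then show ?case using s_step_lower[OF elim(3) Suc.hyps] elim(1) \<delta>(2) by simp
  qed
qed

text \<open>Let \<sigma> be the infimum of the bounds that some level eventually satisfies. If
  \<sigma> exceeded \<rho>, the survival map would lie strictly below the diagonal at \<sigma>, and
  one more step of the recursion would give a bound below \<sigma>.\<close>

lemma s_upper:
  assumes "\<epsilon> > 0"
  shows "\<exists>K\<ge>1. \<forall>\<^sub>F n in sequentially. s K n \<le> \<rho> + \<epsilon>"
proof -
  let ?U = "{u. 0 \<le> u \<and> u \<le> 1 \<and> (\<exists>K\<ge>1. \<forall>\<^sub>F n in sequentially. s K n \<le> u)}"
  let ?l = "d * (real r - 1)"
  have l: "?l > 0" using d_pos r3 by simp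
  have "\<forall>\<^sub>F n in sequentially. s 1 n \<le> 1"
    by (rule eventually_mono[OF eventually_good]) (simp only: s_one order_refl)
  then have one: "1 \<in> ?U" by (auto intro!: exI[of _ 1])
  have bdd: "bdd_below ?U" by (auto intro!: bdd_belowI[of _ 0])
  define \<sigma> where "\<sigma> = Inf ?U"
  have \<sigma>: "0 \<le> \<sigma>" "\<sigma> \<le> 1"
    unfolding \<sigma>_def using one bdd by (auto intro!: cInf_greatest cInf_lower)
  have "\<sigma> \<le> \<rho>"
  proof (rule ccontr)
    assume "\<not> \<sigma> \<le> \<rho>"
    then have less: "survival_map r d \<sigma> < \<sigma>" using survival_map_less[OF d_pos, of r \<sigma>] r3 \<sigma> by simp
    \<comment> \<open>A quarter of the gap: one \<open>c\<close> each for passing from \<sigma> to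
      \<open>u\<close>, for \<open>cavity_err\<close> and for the Markov term
      \<open>2 * d / m\<close>; the fourth is the gain.\<close>
    define c where "c = (\<sigma> - survival_map r d \<sigma>) / 4"
    have c: "c > 0" "survival_map r d \<sigma> = \<sigma> - 4 * c" using less unfolding c_def by (simp, argo)
    have "\<sigma> < \<sigma> + c / ?l" using c l by simp
    then obtain u where u: "u \<in> ?U" "u < \<sigma> + c / ?l"
      using cInf_lessD[of ?U "\<sigma> + c / ?l"] one unfolding \<sigma>_def by blast
    then obtain K where K: "K \<ge> 1" "\<forall>\<^sub>F n in sequentially. s K n \<le> u" by auto
    have "\<sigma> \<le> u" unfolding \<sigma>_def using u bdd by (intro cInf_lower)
    have "\<bar>survival_map r d u - survival_map r d \<sigma>\<bar> \<le> ?l * \<bar>u - \<sigma>\<bar>"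
      using u \<sigma> d_pos r3 by (intro survival_map_lipschitz) auto
    also have "\<dots> \<le> ?l * (c / ?l)" using u \<open>\<sigma> \<le> u\<close> l by (intro mult_left_mono) auto
    also have "?l * (c / ?l) = c"
    proof -
      have "x * (c / x) = c" if "x > 0" for x :: real using that by simp
      then show ?thesis using l .
    qed
    finally have \<phi>u: "survival_map r d u \<le> \<sigma> - 3 * c" using c(2) by linarith
    obtain m :: nat where m: "real m > 2 * d / c" using reals_Archimedean2 by blast
    have "2 * d / c > 0" using d_pos c by simp
    then have m0: "m \<ge> 1" using m by (cases m) auto
    have mc: "2 * d / m < c" using m m0 c by (simp add: field_simps)
    have "\<forall>\<^sub>F n in sequentially. cavity_err K n < c"
      using order_tendstoD(2)[OF cavity_err_lim] c by simp
    then have "\<forall>\<^sub>F n in sequentially. s (m * r * K + 1) n \<le> \<sigma> - c" using K(2) eventually_good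
    proof eventually_elim
      case (elim n)
      have "survival_map r d (s K n) \<le> survival_map r d u"
        using elim s_bounds[OF elim(3)] u d_pos by (intro survival_map_mono) auto
      then show ?case using s_step_upper[OF elim(3) K(1) m0] elim(1) mc \<phi>u by linarith
    qed
    moreover have "0 \<le> \<sigma> - c"
    proof -
      have "0 \<le> survival_map r d \<sigma>"
        unfolding survival_map_def F_map_def using \<sigma> d_pos one_minus_power_bounds[of \<sigma> "r - 1"] by simp
      then show ?thesis using c by simp
    qed
    ultimately have "\<sigma> - c \<in> ?U" using \<sigma> c by (auto intro!: exI[of _ "m * r * K + 1"])
    then have "\<sigma> \<le> \<sigma> - c" unfolding \<sigma>_def using bdd by (intro cInf_lower)
    then show False using c by simp
  qed
  then have "Inf ?U < \<rho> + \<epsilon>" using assms unfolding \<sigma>_def by simp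
  then obtain u where "u \<in> ?U" "u < \<rho> + \<epsilon>" using cInf_lessD[of ?U "\<rho> + \<epsilon>"] one by blast
  then obtain K where "K \<ge> 1" "\<forall>\<^sub>F n in sequentially. s K n \<le> u" by auto
  then show ?thesis using \<open>u < \<rho> + \<epsilon>\<close> by (auto intro!: exI[of _ K] elim: eventually_mono)
qed

text \<open>Monotonicity in the cut-off extends the upper bound from one level to all higher
  ones.\<close>

lemma s_limit:
  assumes "\<epsilon> > 0"
  shows "\<exists>K\<ge>1. \<forall>k\<ge>K. \<forall>\<^sub>F n in sequentially. \<bar>s k n - \<rho>\<bar> \<le> \<epsilon>"
proof -
  obtain K where K: "K \<ge> 1" "\<forall>\<^sub>F n in sequentially. s K n \<le> \<rho> + \<epsilon>" using s_upper[OF assms] by auto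
  have "\<forall>\<^sub>F n in sequentially. \<bar>s k n - \<rho>\<bar> \<le> \<epsilon>" if "k \<ge> K" for k
  proof -
    have "\<forall>\<^sub>F n in sequentially. \<rho> - \<epsilon> \<le> s k n" using s_lower[of k \<epsilon>] that K assms by simp
    then show ?thesis using K(2) eventually_good
    proof eventually_elim
      case (elim n)
      then show ?case using s_antimono[OF elim(3) that] by linarith
    qed
  qed
  then show ?thesis using K by blast
qed

lemma negl_large: "negl (\<lambda>k n X. \<bar>real (card (L k n X)) - \<rho> * n\<bar>)"
proof (rule negl_bound[where b = "\<lambda>k n. real (r * k) * fluct n" and c = 1 and g = "\<lambda>k n X. \<bar>s k n - \<rho>\<bar> * n"])
  show "(\<lambda>n. real (r * k) * fluct n) \<longlonglongrightarrow> 0" for k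
    using tendsto_mult[OF tendsto_const fluct_lim, of "real (r * k)"] by simp
  show "negl (\<lambda>k n X. \<bar>s k n - \<rho>\<bar> * real n)"
    unfolding negl_def E_const
  proof (intro allI impI)
    fix \<epsilon> :: real assume "\<epsilon> > 0"
    then obtain K where K: "\<And>k. k \<ge> K \<Longrightarrow> \<forall>\<^sub>F n in sequentially. \<bar>s k n - \<rho>\<bar> \<le> \<epsilon>" using s_limit by blast
    then show "\<exists>K. \<forall>k\<ge>K. \<forall>\<^sub>F n in sequentially. \<bar>s k n - \<rho>\<bar> * real n \<le> \<epsilon> * real n"
    proof (intro exI[of _ K] allI impI)
      fix k assume "K \<le> k"
      from K[OF this] show "\<forall>\<^sub>F n in sequentially. \<bar>s k n - \<rho>\<bar> * real n \<le> \<epsilon> * real n"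
        by (rule eventually_mono) (auto intro!: mult_right_mono)
    qed
  qed
  fix k :: nat
  show "\<forall>\<^sub>F n in sequentially. E n (\<lambda>X. \<bar>real (card (L k n X)) - \<rho> * n\<bar>) \<le>
      real (r * k) * fluct n * n + 1 * E n (\<lambda>X. \<bar>s k n - \<rho>\<bar> * n)"
    using eventually_good
  proof eventually_elim
    case (elim n)
    have "E n (\<lambda>X. \<bar>real (card (L k n X)) - \<rho> * n\<bar>) \<le>
        E n (\<lambda>X. \<bar>real (card (L k n X)) - s k n * n\<bar> + \<bar>s k n - \<rho>\<bar> * n)"
    proof (rule E_mono[OF elim])
      fix X
      have "\<bar>s k n - \<rho>\<bar> * n = \<bar>s k n * n - \<rho> * n\<bar>"
        by (simp add: abs_mult left_diff_distrib[symmetric])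
      then show "\<bar>real (card (L k n X)) - \<rho> * n\<bar> \<le> \<bar>real (card (L k n X)) - s k n * n\<bar> + \<bar>s k n - \<rho>\<bar> * n"
        by linarith
    qed
    then show ?case using large_deviation[OF elim, of k] by (simp add: E_add E_const)
  qed
qed simp

section \<open>Size of the loose core\<close>

text \<open>The limiting number, per vertex, of edges with exactly \<open>j\<close> of their
  \<open>r\<close> vertices in the giant component: the edge density \<open>d / r\<close> times a
  binomial probability with parameters \<open>r\<close> and \<rho>.\<close>

definition \<gamma> :: "nat \<Rightarrow> real" where
  "\<gamma> j = d / r * (real (r choose j) * \<rho> ^ j * (1 - \<rho>) ^ (r - j))"

lemma negl_edges: "negl (\<lambda>k n X. \<bar>real (card X) - d / r * n\<bar>)"
proof (rule negl_tendsto[where b = "\<lambda>k n. fluct n + \<bar>dn n - d\<bar> / r"])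
  show "(\<lambda>n. fluct n + \<bar>dn n - d\<bar> / r) \<longlonglongrightarrow> 0"
  proof -
    have "(\<lambda>n. fluct n + \<bar>dn n - d\<bar> / r) \<longlonglongrightarrow> 0 + \<bar>d - d\<bar> / r"
      using r3 by (intro tendsto_intros fluct_lim dn_lim) auto
    then show ?thesis by simp
  qed
  fix k :: nat
  show "\<forall>\<^sub>F n in sequentially. E n (\<lambda>X. \<bar>real (card X) - d / r * n\<bar>) \<le> (fluct n + \<bar>dn n - d\<bar> / r) * n"
    using eventually_good
  proof eventually_elim
    case (elim n)
    interpret VS: vertex_set "{1..n}" r by (rule goodD[OF elim])
    have c: "card {1..n} = n" by simp
    have dev: "E n (\<lambda>X. \<bar>real (card X) - dn n * n / r\<bar>) \<le> fluct n * n"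
      using VS.card_edges_deviation[OF goodD(2,4)[OF elim]]
      unfolding c goodD(6)[OF elim] E_def[symmetric] fluct_mult[OF goodD(10)[OF elim]] .
    have "E n (\<lambda>X. \<bar>real (card X) - d / r * n\<bar>) \<le> E n (\<lambda>X. \<bar>real (card X) - dn n * n / r\<bar> + \<bar>dn n - d\<bar> / r * n)"
    proof (rule E_mono[OF elim])
      fix X
      have "dn n * n / r - d / r * n = (dn n - d) / r * n" by (simp add: diff_divide_distrib left_diff_distrib)
      then have "\<bar>dn n * n / r - d / r * n\<bar> = \<bar>dn n - d\<bar> / r * n" by (simp add: abs_mult)
      then show "\<bar>real (card X) - d / r * n\<bar> \<le> \<bar>real (card X) - dn n * n / r\<bar> + \<bar>dn n - d\<bar> / r * n"
        by linarith
    qed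
    then show ?case using dev by (simp add: E_add E_const distrib_right)
  qed
qed

text \<open>Passes from the count to its mean by Efron-Stein, from the mean to a count of potential
  edges by \<open>attached_mean\<close>, and from there to \<open>\<gamma> j\<close> because the
  number of large vertices is close to \<open>\<rho> * n\<close>.\<close>

lemma negl_attached:
  assumes j: "j \<le> r"
  shows "negl (\<lambda>k n X. \<bar>real (card (attached {1..n} k j X)) - \<gamma> j * n\<bar>)"
proof -
  define c where "c = (1 + 2 * real (r choose j)) * (real r)\<^sup>2"
  define b where "b = (\<lambda>k n. (1 + real r * (1 + 2 ^ k)) * fluct n + p n * dn n / r + (\<bar>dn n - d\<bar> / r + d / r * (c / n)))"
  have b_lim: "b k \<longlonglongrightarrow> 0" for k
  proof -
    have "b k \<longlonglongrightarrow> (1 + real r * (1 + 2 ^ k)) * 0 + 0 * d / r + (\<bar>d - d\<bar> / r + d / r * 0)"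
      unfolding b_def using r3 by (intro tendsto_intros fluct_lim dn_lim p_lim lim_const_over_n) auto
    then show ?thesis by simp
  qed
  show ?thesis
  proof (rule negl_bound[where b = b and c = "d * real (r choose j)" and g = "\<lambda>k n X. \<bar>real (card (L k n X)) - \<rho> * n\<bar>"])
    show "negl (\<lambda>k n X. \<bar>real (card (L k n X)) - \<rho> * real n\<bar>)" by (rule negl_large)
    fix k :: nat
    show "\<forall>\<^sub>F n in sequentially. E n (\<lambda>X. \<bar>real (card (attached {1..n} k j X)) - \<gamma> j * n\<bar>)
      \<le> b k n * n + d * real (r choose j) * E n (\<lambda>X. \<bar>real (card (L k n X)) - \<rho> * n\<bar>)"
      using eventually_good
    proof eventually_elim
      case g: (elim n)
      interpret VS: vertex_set "{1..n}" r by (rule goodD[OF g])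
      have cn: "card {1..n} = n" by simp
      have n: "n > 0" "r \<le> n" using goodD(10)[OF g] g by (auto simp: good_def)
      let ?a = "\<lambda>X. real (card (attached {1..n} k j X))"
      let ?h = "\<lambda>X. p n * (real (card (L k n X) choose j) * real ((n - card (L k n X)) choose (r - j)))"
      have rsn: "p n * real (card (rs n)) = dn n * n / r"
        using VS.p_card_A[OF goodD(2,4)[OF g]] unfolding cn goodD(6)[OF g] .
      have d1: "E n (\<lambda>X. \<bar>?a X - E n ?a\<bar>) \<le> (1 + real r * (1 + 2 ^ k)) * fluct n * n"
        using VS.attached_deviation[OF goodD(2,4)[OF g], of k j]
        unfolding cn goodD(6)[OF g] E_def[symmetric] mult.assoc fluct_mult[OF n(1)] .
      have "\<bar>E n ?a - E n ?h\<bar> \<le> p n * p n * card (rs n)"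
        using VS.attached_mean[OF goodD(2,4)[OF g] j, of k]
        unfolding cn E_def[symmetric] E_cmult .
      then have d2: "\<bar>E n ?a - E n ?h\<bar> \<le> p n * dn n / r * n"
        using rsn by (simp add: mult.assoc)
      \<comment> \<open>A bound for each \<open>X\<close>, so that the deviation of the number of
        large vertices enters linearly and \<open>negl_large\<close> applies.\<close>
      have d3: "\<bar>?h X - \<gamma> j * n\<bar> \<le> (\<bar>dn n - d\<bar> / r + d / r * (c / n)) * n +
          d * real (r choose j) * \<bar>real (card (L k n X)) - \<rho> * n\<bar>" for X
      proof -
        define t where "t = card (L k n X)"
        define H where "H = real (t choose j) * real ((n - t) choose (r - j)) / real (n choose r)"
        define bt where "bt = real (r choose j) * (real t / n) ^ j * (1 - real t / n) ^ (r - j)"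
        define br where "br = real (r choose j) * \<rho> ^ j * (1 - \<rho>) ^ (r - j)"
        have t: "t \<le> n" unfolding t_def by (rule card_L_le)
        have tn: "0 \<le> real t / n" "real t / n \<le> 1" using t n by auto
        have pos: "n choose r > 0" using n by (simp add: zero_less_binomial_iff)
        have Hb: "\<bar>H - bt\<bar> \<le> c / n"
          unfolding H_def bt_def c_def using hypergeometric_approx[OF t j n(2,1)] by simp
        have H1: "0 \<le> H" "H \<le> 1"
        proof -
          show "0 \<le> H" by (simp add: H_def)
          have "(t choose j) * ((n - t) choose (r - j)) \<le> (\<Sum>k\<le>r. (t choose k) * ((n - t) choose (r - k)))"
            using j by (intro member_le_sum) auto
          also have "\<dots> = (t + (n - t)) choose r" by (rule vandermonde)
          finally have "real (t choose j) * real ((n - t) choose (r - j)) \<le> real (n choose r)"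
            using t by (simp only: of_nat_mult[symmetric] of_nat_le_iff le_add_diff_inverse)
          then show "H \<le> 1" unfolding H_def using pos by (simp add: pos_divide_le_eq)
        qed
        have "\<bar>(real t / n) ^ j * (1 - real t / n) ^ (r - j) - \<rho> ^ j * (1 - \<rho>) ^ (r - j)\<bar> \<le>
            \<bar>(real t / n) ^ j - \<rho> ^ j\<bar> + \<bar>(1 - real t / n) ^ (r - j) - (1 - \<rho>) ^ (r - j)\<bar>"
          using tn rho_bounds by (intro product_diff_le) (auto simp: power_abs intro!: power_le_one)
        also have "\<dots> \<le> real j * \<bar>real t / n - \<rho>\<bar> + real (r - j) * \<bar>(1 - real t / n) - (1 - \<rho>)\<bar>"
          using tn rho_bounds by (intro add_mono power_diff_le) auto
        also have "\<dots> = real r * \<bar>real t / n - \<rho>\<bar>"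
          using j by (simp add: of_nat_diff abs_minus_commute algebra_simps)
        finally have "real (r choose j) * \<bar>(real t / n) ^ j * (1 - real t / n) ^ (r - j) - \<rho> ^ j * (1 - \<rho>) ^ (r - j)\<bar> \<le>
            real (r choose j) * (real r * \<bar>real t / n - \<rho>\<bar>)" by (rule mult_left_mono) simp
        then have bb: "\<bar>bt - br\<bar> \<le> real (r choose j) * (real r * \<bar>real t / n - \<rho>\<bar>)"
          unfolding bt_def br_def mult.assoc right_diff_distrib[symmetric] abs_mult abs_of_nat .
        have "?h X = dn n * n / r * H"
        proof -
          have "p n * real (n choose r) = dn n * n / r" using rsn VS.card_A cn by simp
          moreover have "real (t choose j) * real ((n - t) choose (r - j)) = real (n choose r) * H"
            unfolding H_def using pos by simp
          ultimately show ?thesis unfolding t_def by (metis mult.assoc)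
        qed
        moreover have "\<gamma> j = d / r * br" by (simp add: \<gamma>_def br_def mult.assoc)
        ultimately have "?h X - \<gamma> j * n = (dn n - d) / r * n * H + d / r * n * ((H - bt) + (bt - br))"
          by (simp add: algebra_simps diff_divide_distrib)
        also have "\<bar>\<dots>\<bar> \<le> \<bar>(dn n - d) / r * n * H\<bar> + \<bar>d / r * n * ((H - bt) + (bt - br))\<bar>" by (rule abs_triangle_ineq)
        also have "\<bar>(dn n - d) / r * n * H\<bar> \<le> \<bar>dn n - d\<bar> / r * n * 1"
        proof -
          have "\<bar>(dn n - d) / r * n * H\<bar> = \<bar>dn n - d\<bar> / r * n * H" using H1 by (simp add: abs_mult)
          also have "\<dots> \<le> \<bar>dn n - d\<bar> / r * n * 1" using H1 by (intro mult_left_mono) auto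
          finally show ?thesis .
        qed
        also have "\<bar>d / r * n * ((H - bt) + (bt - br))\<bar> \<le> d / r * n * (c / n + real (r choose j) * (real r * \<bar>real t / n - \<rho>\<bar>))"
        proof -
          have "\<bar>(H - bt) + (bt - br)\<bar> \<le> c / n + real (r choose j) * (real r * \<bar>real t / n - \<rho>\<bar>)"
            by (rule order_trans[OF abs_triangle_ineq add_mono[OF Hb bb]])
          then have "d / r * n * \<bar>(H - bt) + (bt - br)\<bar> \<le> d / r * n * (c / n + real (r choose j) * (real r * \<bar>real t / n - \<rho>\<bar>))"
            using d_pos by (intro mult_left_mono) auto
          then show ?thesis using d_pos by (simp add: abs_mult)
        qed
        also have "d / r * n * (c / n + real (r choose j) * (real r * \<bar>real t / n - \<rho>\<bar>)) =
            d / r * (c / n) * n + d * real (r choose j) * \<bar>real t - \<rho> * n\<bar>"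
        proof -
          have "real t / n - \<rho> = (real t - \<rho> * n) / n" using n by (simp add: diff_divide_distrib)
          then have "\<bar>real t / n - \<rho>\<bar> * n = \<bar>real t - \<rho> * n\<bar>" using n by simp
          moreover have "d / r * n * (c / n + C * (real r * z)) = d / r * (c / n) * n + d * C * (z * n)" for C z
            using r3 by (simp add: field_simps)
          ultimately show ?thesis by metis
        qed
        finally show ?thesis unfolding t_def by (simp add: algebra_simps)
      qed
      have "E n (\<lambda>X. \<bar>?a X - \<gamma> j * n\<bar>) \<le> E n (\<lambda>X. \<bar>?a X - E n ?a\<bar> + (\<bar>E n ?a - E n ?h\<bar> + \<bar>E n ?h - \<gamma> j * n\<bar>))"
        by (rule E_mono[OF g]) linarith
      also have "\<dots> = E n (\<lambda>X. \<bar>?a X - E n ?a\<bar>) + (\<bar>E n ?a - E n ?h\<bar> + \<bar>E n ?h - \<gamma> j * n\<bar>)"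
        by (simp add: E_add E_const)
      also have "\<bar>E n ?h - \<gamma> j * n\<bar> \<le> E n (\<lambda>X. \<bar>?h X - \<gamma> j * n\<bar>)" by (rule E_abs_diff[OF g])
      also have "\<dots> \<le> E n (\<lambda>X. (\<bar>dn n - d\<bar> / r + d / r * (c / n)) * n + d * real (r choose j) * \<bar>real (card (L k n X)) - \<rho> * n\<bar>)"
        by (rule E_mono[OF g d3])
      also have "\<dots> = (\<bar>dn n - d\<bar> / r + d / r * (c / n)) * n + d * real (r choose j) * E n (\<lambda>X. \<bar>real (card (L k n X)) - \<rho> * n\<bar>)"
        unfolding E_add E_cmult E_const ..
      finally show ?case using d1 d2 unfolding b_def distrib_right by simp
    qed
  qed (use b_lim d_pos in auto)
qed

section \<open>Exceptional edges are negligible\<close>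

text \<open>Shows that the expected number of edges through a given pair is of order
  \<open>1 / n\<close>, which keeps the mean number of cyclic edges bounded.\<close>

lemma pN2:
  assumes "good n"
  shows "p n * real ((n - 2) choose (r - 2)) * (real n - 1) = dn n * (real r - 1)"
proof -
  interpret VS: vertex_set "{1..n}" r by (rule goodD[OF assms])
  have "real ((n - 1) * ((n - 2) choose (r - 2))) = real ((r - 1) * ((n - 1) choose (r - 1)))"
    using VS.N2_N by simp
  then have "(real n - 1) * real ((n - 2) choose (r - 2)) = (real r - 1) * real ((n - 1) choose (r - 1))"
    using goodD(10)[OF assms] r3 by (simp add: of_nat_diff)
  then show ?thesis using goodD(6)[OF assms] by (metis mult.assoc mult.commute)
qed

lemma pN2_le:
  assumes "good n"
  shows "p n * real ((n - 2) choose (r - 2)) * n \<le> 4 * d * real r"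
proof -
  have n: "n \<ge> 3" using goodD(9)[OF assms] .
  have "p n * real ((n - 2) choose (r - 2)) * n \<le> p n * real ((n - 2) choose (r - 2)) * (2 * (real n - 1))"
    using n goodD(2)[OF assms] by (intro mult_left_mono) auto
  also have "\<dots> = 2 * (dn n * (real r - 1))" unfolding pN2[OF assms, symmetric] by (simp only: mult_ac)
  also have "\<dots> \<le> 2 * (2 * d * real r)"
    using goodD(7,8)[OF assms] r3 by (intro mult_left_mono mult_mono) auto
  finally show ?thesis by simp
qed

lemma E_cyclic_edges_le:
  assumes "good n"
  shows "E n (\<lambda>X. real (card (cyclic_edges k X))) \<le> 8 * d * real r * k"
proof -
  interpret VS: vertex_set "{1..n}" r by (rule goodD[OF assms])
  have c: "card {1..n} = n" by simp
  have "E n (\<lambda>X. real (card (cyclic_edges k X))) \<le> 2 * p n * (real n * k * real ((n - 2) choose (r - 2)))"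
    using VS.Ebin_cyclic_edges[OF goodD(2,4)[OF assms], of k] unfolding c E_def .
  also have "\<dots> = 2 * k * (p n * real ((n - 2) choose (r - 2)) * n)" by simp
  also have "\<dots> \<le> 2 * k * (4 * d * real r)" using pN2_le[OF assms] by (intro mult_left_mono) auto
  finally show ?thesis by (simp add: mult_ac)
qed

lemma negl_cyclic_edges: "negl (\<lambda>k n X. real (card (cyclic_edges k X)))"
proof (rule negl_tendsto[where b = "\<lambda>k n. 8 * d * real r * k / n"])
  fix k :: nat
  show "\<forall>\<^sub>F n in sequentially. E n (\<lambda>X. real (card (cyclic_edges k X))) \<le> 8 * d * real r * k / n * n"
    using eventually_good by (rule eventually_mono) (use E_cyclic_edges_le goodD(10) in fastforce)
qed (rule lim_const_over_n)

lemma negl_pendant_cyclic: "negl (\<lambda>k n X. real (card (pendant_cyclic {1..n} k X)))"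
proof (rule negl_tendsto[where b = "\<lambda>k n. 4 * d * real (r * k) * (8 * d * real r * k) / n"])
  fix k :: nat
  show "\<forall>\<^sub>F n in sequentially. E n (\<lambda>X. real (card (pendant_cyclic {1..n} k X))) \<le>
      4 * d * real (r * k) * (8 * d * real r * k) / n * n"
    using eventually_good
  proof (rule eventually_mono)
    fix n assume g: "good n"
    interpret VS: vertex_set "{1..n}" r by (rule goodD[OF g])
    have c: "card {1..n} = n" by simp
    let ?y = "E n (\<lambda>X. real (card (cyclic_edges k X)))"
    have y: "0 \<le> ?y" unfolding E_def using goodD[OF g] by (intro Ebin_nonneg) auto
    have "E n (\<lambda>X. real (card (pendant_cyclic {1..n} k X))) \<le>
        2 * p n * (real (r * k) * real ((n - 1) choose (r - 1)) * ?y)"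
      using VS.Ebin_pendant_cyclic[OF goodD(2,4)[OF g], of k] unfolding c E_def .
    also have "\<dots> = 2 * (p n * real ((n - 1) choose (r - 1))) * real (r * k) * ?y" by simp
    also have "\<dots> = 2 * dn n * real (r * k) * ?y" unfolding goodD(6)[OF g] ..
    also have "\<dots> \<le> 4 * d * real (r * k) * (8 * d * real r * k)"
    proof (rule mult_mono[OF _ E_cyclic_edges_le[OF g] _ y])
      have "2 * dn n \<le> 4 * d" using goodD(8)[OF g] by linarith
      then show "2 * dn n * real (r * k) \<le> 4 * d * real (r * k)" by (rule mult_right_mono) simp
      show "0 \<le> 4 * d * real (r * k)" using d_pos by simp
    qed
    finally show "E n (\<lambda>X. real (card (pendant_cyclic {1..n} k X))) \<le>
        4 * d * real (r * k) * (8 * d * real r * k) / n * n"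
      using goodD(10)[OF g] by simp
  qed
qed (rule lim_const_over_n)

lemma E_large_square:
  assumes "good n"
  shows "E n (\<lambda>X. (real (card (L k n X)))\<^sup>2) \<le> ((s k n)\<^sup>2 + 2 * d * (real (r * k))\<^sup>2 / n) * (real n)\<^sup>2"
proof -
  interpret VS: vertex_set "{1..n}" r by (rule goodD[OF assms])
  have c: "card {1..n} = n" by simp
  have n: "n > 0" using goodD(10)[OF assms] .
  have rsn: "p n * real (card (rs n)) = dn n * n / r"
    using VS.p_card_A[OF goodD(2,4)[OF assms]] unfolding c goodD(6)[OF assms] .
  have "E n (\<lambda>X. (real (card (L k n X)))\<^sup>2) \<le> (s k n * n)\<^sup>2 + p n * (real (r * k))\<^sup>2 * card (rs n)"
    using VS.large_second_moment[OF goodD(2,4)[OF assms], of k]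
    unfolding E_def[symmetric] E_large[OF assms] .
  also have "p n * (real (r * k))\<^sup>2 * card (rs n) = (real (r * k))\<^sup>2 * (dn n * n / r)"
    unfolding rsn[symmetric] by simp
  also have "\<dots> \<le> (real (r * k))\<^sup>2 * (2 * d * n)"
  proof -
    have "dn n * n / r \<le> dn n * n / 1"
      using goodD(7)[OF assms] r3 by (intro divide_left_mono) auto
    also have "\<dots> \<le> 2 * d * n" using goodD(8)[OF assms] by (simp add: mult_right_mono)
    finally show ?thesis by (intro mult_left_mono) auto
  qed
  also have "(s k n * n)\<^sup>2 + (real (r * k))\<^sup>2 * (2 * d * n) = ((s k n)\<^sup>2 + 2 * d * (real (r * k))\<^sup>2 / n) * (real n)\<^sup>2"
    using n by (simp add: power2_eq_square field_simps)
  finally show ?thesis by simp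
qed

lemma E_apart_le_square:
  assumes "good n"
  shows "E n (\<lambda>X. real (card (apart {1..n} k X))) \<le> E n (\<lambda>X. (real (card (L k n X)))\<^sup>2)"
proof (rule E_mono[OF assms])
  fix X
  have "apart {1..n} k X \<subseteq> L k n X \<times> L k n X" by (auto simp: apart_def)
  then have "card (apart {1..n} k X) \<le> card (L k n X \<times> L k n X)"
    using finite_L by (intro card_mono) auto
  then show "real (card (apart {1..n} k X)) \<le> (real (card (L k n X)))\<^sup>2"
    unfolding card_cartesian_product power2_eq_square by (simp only: of_nat_mult[symmetric] of_nat_le_iff)
qed

lemma square_diff_le:
  fixes x y e :: real
  assumes "0 \<le> x" "x \<le> 1" "0 \<le> y" "y \<le> 1" "x - y \<le> e" "0 \<le> e"
  shows "x\<^sup>2 - y\<^sup>2 \<le> 2 * e"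
proof -
  have "x\<^sup>2 - y\<^sup>2 = (x - y) * (x + y)" by (simp add: power2_eq_square algebra_simps)
  also have "\<dots> \<le> e * (x + y)" using assms by (intro mult_right_mono) auto
  also have "\<dots> \<le> e * 2" using assms by (intro mult_left_mono) auto
  finally show ?thesis by simp
qed

lemma variance_term_small:
  assumes "\<epsilon> > 0"
  shows "\<forall>\<^sub>F n in sequentially. 2 * d * (real (r * k))\<^sup>2 / n < \<epsilon>"
  using order_tendstoD(2)[OF lim_const_over_n[of "2 * d * (real (r * k))\<^sup>2"] assms] .

text \<open>If \<open>\<rho> > 0\<close>, compare with a slightly smaller \<open>d'\<close>: at some density between \<open>d'\<close> and \<open>d\<close> almost
  all pairs of vertices in components of size at least \<open>k\<close> are joined, and joined pairs stay joined
  when edges are added.\<close>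

lemma apart_small:
  assumes e: "\<epsilon> > 0"
  shows "\<exists>K. \<forall>k\<ge>K. \<forall>\<^sub>F n in sequentially. E n (\<lambda>X. real (card (apart {1..n} k X))) \<le> \<epsilon> * (real n)\<^sup>2"
proof -
  define \<delta> where "\<delta> = min (\<epsilon> / 12) 1"
  have \<delta>: "0 < \<delta>" "\<delta> \<le> \<epsilon> / 12" "\<delta> \<le> 1" using e by (auto simp: \<delta>_def)
  obtain K0 where K0: "\<And>k. k \<ge> K0 \<Longrightarrow> \<forall>\<^sub>F n in sequentially. \<bar>s k n - \<rho>\<bar> \<le> \<delta>"
    using s_limit[OF \<delta>(1)] by blast
  show ?thesis
  proof (cases "\<rho> \<le> \<delta>")
    \<comment> \<open>Few large vertices, hence few pairs of them; the comparison of densities is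
      for the other case.\<close>
    case True
    have "\<forall>\<^sub>F n in sequentially. E n (\<lambda>X. real (card (apart {1..n} k X))) \<le> \<epsilon> * (real n)\<^sup>2" if "k \<ge> K0" for k
      using K0[OF that] eventually_good variance_term_small[OF \<delta>(1), of k]
    proof eventually_elim
      case (elim n)
      have "(s k n)\<^sup>2 - 0\<^sup>2 \<le> 2 * (2 * \<delta>)"
        by (rule square_diff_le) (use s_bounds[OF elim(2)] elim(1) True \<delta> in auto)
      then have "((s k n)\<^sup>2 + 2 * d * (real (r * k))\<^sup>2 / n) * (real n)\<^sup>2 \<le> \<epsilon> * (real n)\<^sup>2"
        using elim(3) \<delta> by (intro mult_right_mono) auto
      then show ?case using E_apart_le_square[OF elim(2), of k] E_large_square[OF elim(2), of k] by linarith
    qed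
    then show ?thesis by blast
  next
    case False
    obtain d' where d': "0 < d'" "d' < d" "\<rho> - \<delta> \<le> rho_star r d'"
      using rho_star_left_continuous[OF d_pos, of r "\<rho> - \<delta>"] False \<delta> r3 by auto
    \<comment> \<open>The preceding analysis applies to the constant density \<open>d'\<close> as
      well and bounds its number of large vertices from below.\<close>
    interpret S': sparse_hypergraph r d' "\<lambda>_. d'"
      using r3 d'(1) by unfold_locales auto
    \<comment> \<open>From this level on, the sprinkling term
      \<open>(real r)\<^sup>2 * 2 / ((d - d') * k)\<close> is at most \<delta>.\<close>
    obtain K1 :: nat where K1: "real K1 > (real r)\<^sup>2 * 2 / ((d - d') * \<delta>)" using reals_Archimedean2 by blast
    have "\<forall>\<^sub>F n in sequentially. E n (\<lambda>X. real (card (apart {1..n} k X))) \<le> \<epsilon> * (real n)\<^sup>2"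
      if k: "k \<ge> max (max K0 K1) 1" for k
    proof -
      have "\<forall>\<^sub>F n in sequentially. rho_star r d' - \<delta> \<le> S'.s k n" using S'.s_lower[of k \<delta>] k \<delta> by simp
      moreover have "\<forall>\<^sub>F n in sequentially. (d + d') / 2 < dn n"
        using order_tendstoD(1)[OF dn_lim, of "(d + d') / 2"] d' by simp
      moreover have "\<forall>\<^sub>F n in sequentially. \<bar>s k n - \<rho>\<bar> \<le> \<delta>" using K0 k by simp
      ultimately show ?thesis using eventually_good S'.eventually_good variance_term_small[OF \<delta>(1), of k]
      proof eventually_elim
        case (elim n)
        note g = elim(4) and g' = elim(5)
        interpret VS: vertex_set "{1..n}" r by (rule goodD[OF g])
        have c: "card {1..n} = n" by simp
        have n: "n > 0" "n \<ge> 3" using goodD(9,10)[OF g] by auto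
        let ?N = "real ((n - 1) choose (r - 1))" and ?N2 = "real ((n - 2) choose (r - 2))"
        have N: "?N > 0" "?N2 > 0" using VS.N_pos VS.N2_pos unfolding c by simp_all
        have diff: "p n - S'.p n = (dn n - d') / ?N"
          unfolding p_def S'.p_def by (simp add: diff_divide_distrib)
        have "0 < (dn n - d') / ?N" using N elim(2) d' by (intro divide_pos_pos) auto
        then have pp: "S'.p n < p n" using diff by linarith
        have E': "Ebin (rs n) (S'.p n) (\<lambda>X. real (card (L k n X))) = S'.s k n * n"
          using S'.E_large[OF g', of k] unfolding S'.E_def .
        have "E n (\<lambda>X. real (card (apart {1..n} k X))) \<le>
           E n (\<lambda>X. (real (card (L k n X)))\<^sup>2) - (S'.s k n * n)\<^sup>2 + real (r\<^sup>2 * n) / (k * (p n - S'.p n) * ?N2)"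
          using VS.Ebin_apart_sprinkle[OF S'.goodD(2)[OF g'] pp goodD(5)[OF g], of k] k
          unfolding c E' E_def by simp
        also have "real (r\<^sup>2 * n) / (k * (p n - S'.p n) * ?N2) \<le> \<delta> * (real n)\<^sup>2"
        proof -
          have N2N: "?N2 / ?N = (real r - 1) / (real n - 1)"
          proof -
            have "(n - 1) * ((n - 2) choose (r - 2)) = (r - 1) * ((n - 1) choose (r - 1))"
              using VS.N2_N unfolding c .
            then have "real (n - 1) * ?N2 = real (r - 1) * ?N" by (simp only: of_nat_mult[symmetric])
            then show ?thesis using N n r3 by (simp add: field_simps of_nat_diff)
          qed
          have "(p n - S'.p n) * ?N2 = (dn n - d') * (?N2 / ?N)" unfolding diff by simp
          also have "\<dots> = (dn n - d') * ((real r - 1) / (real n - 1))" unfolding N2N ..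
          also have "\<dots> \<ge> (d - d') / 2 * (1 / n)"
            using elim(2) d' n r3 by (intro mult_mono frac_le) (auto simp: field_simps)
          finally have low: "(d - d') / 2 * (1 / n) \<le> (p n - S'.p n) * ?N2" .
          have "real (r\<^sup>2 * n) / (k * ((p n - S'.p n) * ?N2)) \<le> real (r\<^sup>2 * n) / (k * ((d - d') / 2 * (1 / n)))"
            using low k d' n pp N by (intro divide_left_mono mult_left_mono mult_pos_pos) auto
          also have "\<dots> = (real r)\<^sup>2 * 2 / ((d - d') * k) * (real n)\<^sup>2"
            using n k d' by (simp add: field_simps power2_eq_square)
          also have "\<dots> \<le> \<delta> * (real n)\<^sup>2"
          proof (rule mult_right_mono)
            have "(real r)\<^sup>2 * 2 / ((d - d') * \<delta>) < real k" using K1 k by linarith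
            then have "(real r)\<^sup>2 * 2 < real k * ((d - d') * \<delta>)" using d' \<delta> by (simp add: pos_divide_less_eq)
            then have "(real r)\<^sup>2 * 2 \<le> \<delta> * ((d - d') * k)" by (simp add: mult_ac)
            moreover have "0 < (d - d') * k" using d' k by simp
            ultimately show "(real r)\<^sup>2 * 2 / ((d - d') * k) \<le> \<delta>" by (simp add: pos_divide_le_eq)
          qed simp
          finally show ?thesis by (simp only: mult.assoc)
        qed
        also have "E n (\<lambda>X. (real (card (L k n X)))\<^sup>2) - (S'.s k n * n)\<^sup>2 \<le> 7 * \<delta> * (real n)\<^sup>2"
        proof -
          \<comment> \<open>Here \<open>s k n \<le> \<rho> + \<delta>\<close> and \<open>S'.s k n
            \<ge> rho_star r d' - \<delta> \<ge> \<rho> - 2 * \<delta>\<close>, which differ by at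
            most \<open>3 * \<delta>\<close>.\<close>
          have "(s k n)\<^sup>2 - (S'.s k n)\<^sup>2 \<le> 2 * (3 * \<delta>)"
            by (rule square_diff_le) (use s_bounds[OF g] S'.s_bounds[OF g'] elim d' \<delta> in auto)
          then have "(s k n)\<^sup>2 + 2 * d * (real (r * k))\<^sup>2 / n - (S'.s k n)\<^sup>2 \<le> 7 * \<delta>" using elim(6) by linarith
          then have "((s k n)\<^sup>2 + 2 * d * (real (r * k))\<^sup>2 / n - (S'.s k n)\<^sup>2) * (real n)\<^sup>2 \<le> 7 * \<delta> * (real n)\<^sup>2"
            by (intro mult_right_mono) auto
          then show ?thesis using E_large_square[OF g, of k]
            unfolding left_diff_distrib power_mult_distrib by linarith
        qed
        finally have "E n (\<lambda>X. real (card (apart {1..n} k X))) \<le> 8 * \<delta> * (real n)\<^sup>2" by (simp add: algebra_simps)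
        also have "\<dots> \<le> \<epsilon> * (real n)\<^sup>2" using \<delta> by (intro mult_right_mono) auto
        finally show ?case .
      qed
    qed
    then show ?thesis by blast
  qed
qed

lemma negl_bad_edges: "negl (\<lambda>k n X. real (card (bad_edges {1..n} k X)))"
  unfolding negl_def
proof (intro allI impI)
  fix \<epsilon> :: real assume e: "\<epsilon> > 0"
  \<comment> \<open>Compensates the factor 2 of \<open>Ebin_bad_edges\<close> and the bound
    \<open>4 * d * real r\<close> of \<open>pN2_le\<close>.\<close>
  define \<delta> where "\<delta> = \<epsilon> / (8 * d * real r)"
  have \<delta>: "\<delta> > 0" unfolding \<delta>_def using e d_pos r3 by (intro divide_pos_pos) auto
  obtain K where K: "\<And>k. k \<ge> K \<Longrightarrow> \<forall>\<^sub>F n in sequentially. E n (\<lambda>X. real (card (apart {1..n} k X))) \<le> \<delta> * (real n)\<^sup>2"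
    using apart_small[OF \<delta>] by blast
  have "\<forall>\<^sub>F n in sequentially. E n (\<lambda>X. real (card (bad_edges {1..n} k X))) \<le> \<epsilon> * n" if "k \<ge> K" for k
    using K[OF that] eventually_good
  proof eventually_elim
    case (elim n)
    interpret VS: vertex_set "{1..n}" r by (rule goodD[OF elim(2)])
    have c: "card {1..n} = n" by simp
    let ?N2 = "real ((n - 2) choose (r - 2))"
    have "E n (\<lambda>X. real (card (bad_edges {1..n} k X))) \<le> 2 * p n * (?N2 * E n (\<lambda>X. real (card (apart {1..n} k X))))"
      using VS.Ebin_bad_edges[OF goodD(2,4)[OF elim(2)], of k] unfolding c E_def .
    also have "\<dots> \<le> 2 * p n * (?N2 * (\<delta> * (real n)\<^sup>2))"
      using elim(1) goodD(2)[OF elim(2)] by (intro mult_left_mono) auto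
    also have "\<dots> = 2 * (p n * ?N2 * n) * (\<delta> * n)" by (simp add: power2_eq_square)
    also have "\<dots> \<le> 2 * (4 * d * real r) * (\<delta> * n)"
      using pN2_le[OF elim(2)] \<delta> by (intro mult_right_mono mult_left_mono) auto
    also have "\<dots> = \<epsilon> * n" unfolding \<delta>_def using d_pos r3 by simp
    finally show ?case .
  qed
  then show "\<exists>K. \<forall>k\<ge>K. \<forall>\<^sub>F n in sequentially. E n (\<lambda>X. real (card (bad_edges {1..n} k X))) \<le> \<epsilon> * n" by blast
qed

lemma uniform_good:
  assumes "good n" "X \<subseteq> rs n"
  shows "uniform_edges {1..n} r X"
proof -
  interpret VS: vertex_set "{1..n}" r by (rule goodD[OF assms(1)])
  show ?thesis by (rule VS.uniform[OF assms(2)])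
qed

section \<open>Limits for the edges and vertices of the core\<close>

definition \<beta> :: real where "\<beta> = d / r - \<gamma> 0 - \<gamma> 1"

lemma negl_core_edges: "negl (\<lambda>k n X. \<bar>real (card (core X)) - \<beta> * n\<bar>)"
proof (rule negl_mono)
  show "negl (\<lambda>k n X. \<bar>real (card X) - d / r * n\<bar> + (\<bar>real (card (attached {1..n} k 0 X)) - \<gamma> 0 * n\<bar> +
     (\<bar>real (card (attached {1..n} k 1 X)) - \<gamma> 1 * n\<bar> + (real (card (bad_edges {1..n} k X)) +
     (real (card (cyclic_edges k X)) + real (card (pendant_cyclic {1..n} k X)))))))"
    using r3 by (intro negl_add negl_edges negl_attached negl_bad_edges negl_cyclic_edges negl_pendant_cyclic) auto
  fix k n :: nat and X assume g: "good n" and X: "X \<subseteq> rs n"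
  interpret U: uniform_edges "{1..n}" r X by (rule uniform_good[OF g X])
  have bn: "\<beta> * n = d / r * n - \<gamma> 0 * n - \<gamma> 1 * n" by (simp add: \<beta>_def left_diff_distrib)
  show "\<bar>real (card (core X)) - \<beta> * n\<bar> \<le>
     \<bar>real (card X) - d / r * n\<bar> + (\<bar>real (card (attached {1..n} k 0 X)) - \<gamma> 0 * n\<bar> +
     (\<bar>real (card (attached {1..n} k 1 X)) - \<gamma> 1 * n\<bar> + (real (card (bad_edges {1..n} k X)) +
     (real (card (cyclic_edges k X)) + real (card (pendant_cyclic {1..n} k X))))))"
    using U.card_core_upper[of k] U.card_core_lower[of k] unfolding bn by linarith
qed

text \<open>The limit of the formula in \<open>card_core_verts\<close>, with
  \<open>\<gamma> 0\<close> for the edges in small components; unfolding \<beta>, it equals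
  \<open>\<rho> - (real r - 1) * \<gamma> 1\<close>.\<close>

definition \<alpha> :: real where "\<alpha> = \<rho> + (real r - 1) * (\<gamma> 0 + \<beta> - d / r)"

lemma negl_fraction: "negl (\<lambda>k n X. real n / k)"
  unfolding negl_def E_const
proof (intro allI impI)
  fix \<epsilon> :: real assume e: "\<epsilon> > 0"
  obtain K :: nat where K: "1 / \<epsilon> < real K" using reals_Archimedean2 by blast
  have "real n / k \<le> \<epsilon> * n" if "k \<ge> K" for k n :: nat
  proof -
    have k: "1 / \<epsilon> < real k" using K that by linarith
    then have "0 < real k" using e by (meson divide_pos_pos less_trans zero_less_one)
    then have "1 / real k \<le> \<epsilon>" using k e by (simp add: field_simps)
    then show ?thesis using mult_right_mono[of "1 / real k" \<epsilon> "real n"] by simp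
  qed
  then show "\<exists>K. \<forall>k\<ge>K. \<forall>\<^sub>F n in sequentially. real n / real k \<le> \<epsilon> * real n"
    by (intro exI[of _ K] allI impI always_eventually)
qed

text \<open>\<open>card_core_verts\<close> is applied at level \<open>r * k\<close>, so that its
  count of small edges lies between the \<open>attached\<close> counts at levels \<open>k\<close>
  and \<open>r * k\<close>, both close to \<open>\<gamma> 0 * n\<close>.\<close>

lemma negl_core_verts: "negl (\<lambda>k n X. \<bar>real (card (\<Union>(core X))) - \<alpha> * n\<bar>)"
proof (rule negl_mono)
  let ?l = "\<lambda>k (n :: nat) (X :: nat set set). \<bar>real (card (L k n X)) - \<rho> * n\<bar>"
  let ?a = "\<lambda>k (n :: nat) (X :: nat set set). \<bar>real (card (attached {1..n} k 0 X)) - \<gamma> 0 * n\<bar>"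
  let ?c = "\<lambda>k (n :: nat) (X :: nat set set). real (card (cyclic_edges k X)) + real (card (pendant_cyclic {1..n} k X))"
  let ?e = "\<lambda>(k :: nat) (n :: nat) (X :: nat set set). \<bar>real (card (core X)) - \<beta> * n\<bar>"
  let ?x = "\<lambda>(k :: nat) (n :: nat) (X :: nat set set). \<bar>real (card X) - d / r * n\<bar>"
  show "negl (\<lambda>k n X. real n / (r * k) + ((real r + 1) * ?c (r * k) n X + (?l (r * k) n X +
     (real r - 1) * (?a k n X + (?a (r * k) n X + (?e k n X + ?x k n X))))))"
  proof (intro negl_add negl_cmult)
    show "negl (\<lambda>k n X. real n / (r * k))"
      by (rule negl_scale_index[of "\<lambda>k n X. real n / k", OF negl_fraction])
    show "negl (\<lambda>k n X. real (card (cyclic_edges (r * k) X)))"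
      by (rule negl_scale_index[of "\<lambda>k n X. real (card (cyclic_edges k X))", OF negl_cyclic_edges])
    show "negl (\<lambda>k n X. real (card (pendant_cyclic {1..n} (r * k) X)))"
      by (rule negl_scale_index[of "\<lambda>k n X. real (card (pendant_cyclic {1..n} k X))", OF negl_pendant_cyclic])
    show "negl (\<lambda>k. ?l (r * k))" by (rule negl_scale_index[of ?l, OF negl_large])
    show "negl ?a" by (rule negl_attached) simp
    then show "negl (\<lambda>k. ?a (r * k))" by (rule negl_scale_index)
    show "negl ?e" by (rule negl_core_edges)
    show "negl ?x" by (rule negl_edges)
  qed (use r3 in auto)
  fix k n :: nat and X assume k: "k \<ge> 1" and g: "good n" and X: "X \<subseteq> rs n"
  interpret U: uniform_edges "{1..n}" r X by (rule uniform_good[OF g X])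
  define S where "S = real (card (U.small_edges (r * k)))"
  have rk: "r * k \<ge> 1" using k r3 by simp
  have S: "real (card (attached {1..n} k 0 X)) \<le> S" "S \<le> real (card (attached {1..n} (r * k) 0 X))"
    unfolding S_def using U.attached_small_edges[OF k] U.small_edges_attached[of "r * k"] by auto
  define z where "z = S + real (card (core X)) - real (card X) - (\<gamma> 0 + \<beta> - d / r) * n"
  have "(\<gamma> 0 + \<beta> - d / r) * n = \<gamma> 0 * n + \<beta> * n - d / r * n" by (simp add: algebra_simps)
  then have "\<bar>z\<bar> \<le> ?a k n X + (?a (r * k) n X + (?e k n X + ?x k n X))"
    unfolding z_def using S by linarith
  then have z: "\<bar>(real r - 1) * z\<bar> \<le> (real r - 1) * (?a k n X + (?a (r * k) n X + (?e k n X + ?x k n X)))"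
    unfolding abs_mult using r3 by (simp add: mult_left_mono)
  have an: "\<alpha> * n = \<rho> * n + (real r - 1) * ((\<gamma> 0 + \<beta> - d / r) * n)" by (simp add: \<alpha>_def algebra_simps)
  have "\<bar>real (card (\<Union>(core X))) - (real (card (L (r * k) n X)) +
      (real r - 1) * (S + real (card (core X)) - real (card X)))\<bar> \<le> real n / (r * k) + (real r + 1) * ?c (r * k) n X"
    using U.card_core_verts[OF rk] unfolding S_def by simp
  moreover have "(real r - 1) * (S + real (card (core X)) - real (card X)) =
      (real r - 1) * z + (real r - 1) * ((\<gamma> 0 + \<beta> - d / r) * n)"
    unfolding z_def by (simp add: algebra_simps)
  moreover have "\<bar>v - (l' + q)\<bar> \<le> B1 + (B2 + (\<bar>l - l'\<bar> + B3))"
    if "\<bar>v - (l + t)\<bar> \<le> B1 + B2" "t = y + q" "\<bar>y\<bar> \<le> B3" for v l l' q t y B1 B2 B3 :: real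
    using that by linarith
  ultimately show "\<bar>real (card (\<Union>(core X))) - \<alpha> * n\<bar> \<le>
     real n / (r * k) + ((real r + 1) * ?c (r * k) n X + (?l (r * k) n X +
     (real r - 1) * (?a k n X + (?a (r * k) n X + (?e k n X + ?x k n X)))))"
    using z unfolding an by blast
qed

lemma alpha_eq: "\<alpha> = \<rho> * (1 - d * (real r - 1) * (1 - \<rho>) ^ (r - 1))"
proof -
  have "\<gamma> 1 = d * \<rho> * (1 - \<rho>) ^ (r - 1)" using r3 by (simp add: \<gamma>_def)
  then show ?thesis unfolding \<alpha>_def \<beta>_def by (simp add: algebra_simps)
qed

lemma beta_eq: "\<beta> = d / r * (1 - (1 - \<rho>) ^ r - r * \<rho> * (1 - \<rho>) ^ (r - 1))"
  unfolding \<beta>_def \<gamma>_def by (simp add: algebra_simps)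

section \<open>From means to high probability\<close>

lemma prob_eq_E:
  assumes "good n"
  shows "measure_pmf.prob (random_hypergraph r n (p n)) {H. Q H} = E n (\<lambda>X. of_bool (Q ({1..n}, X)))"
proof -
  let ?M = "Pi_pmf (rs n) False (\<lambda>_. bernoulli_pmf (p n))"
  have eq: "random_hypergraph r n (p n) = map_pmf (\<lambda>X. ({1..n}, {e \<in> rs n. X e})) ?M"
    unfolding random_hypergraph_def rsets_def by (simp add: conj_assoc)
  have "measure_pmf.prob (random_hypergraph r n (p n)) {H. Q H} =
      measure_pmf.expectation ?M (indicator {X. Q ({1..n}, {e \<in> rs n. X e})})"
    unfolding eq by (simp add: vimage_def)
  also have "\<dots> = measure_pmf.expectation ?M (\<lambda>X. of_bool (Q ({1..n}, {e \<in> rs n. X e})))"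
    by (rule Bochner_Integration.integral_cong) (auto simp: indicator_def)
  also have "\<dots> = E n (\<lambda>X. of_bool (Q ({1..n}, X)))"
    unfolding E_def using expectation_Pi_pmf_bernoulli[OF finite_A, of "p n" n "\<lambda>X. of_bool (Q ({1..n}, X))"] goodD[OF assms] by simp
  finally show ?thesis .
qed

lemma E_markov:
  assumes "good n" "c > 0" "\<And>X. 0 \<le> f X"
  shows "E n (\<lambda>X. of_bool (\<not> f X \<le> c)) \<le> E n f / c"
proof -
  have "E n (\<lambda>X. of_bool (\<not> f X \<le> c)) \<le> E n (\<lambda>X. 1 / c * f X)"
    using assms by (intro E_mono) (auto simp: of_bool_def field_simps)
  then show ?thesis unfolding E_cmult by simp
qed

lemma core_sizes_whp:
  "\<exists>\<epsilon> \<eta> :: nat \<Rightarrow> real. \<epsilon> \<in> o(\<lambda>_. 1) \<and> \<eta> \<in> o(\<lambda>_. 1) \<and>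
    whp (\<lambda>n. random_hypergraph r n (p n))
      (\<lambda>n H. \<bar>real (card (verts (loose_core H))) - \<alpha> * real n\<bar> \<le> \<epsilon> n * real n \<and>
             \<bar>real (card (edges (loose_core H))) - \<beta> * real n\<bar> \<le> \<eta> n * real n)"
proof -
  let ?f = "\<lambda>n X. \<bar>real (card (\<Union>(core X))) - \<alpha> * n\<bar>" and ?g = "\<lambda>n X. \<bar>real (card (core X)) - \<beta> * n\<bar>"
  \<comment> \<open>For Markov's inequality: with threshold \<open>w f n * n\<close> the failure
    probability is at most \<open>(E n (f n) / n) / w f n \<le> w f n\<close>, so one sequence
    serves both as error term and as failure bound. The summand \<open>1 / n\<close> keeps it
    positive.\<close>
  define w where "w = (\<lambda>f n. sqrt (\<bar>E n (f n) / n\<bar> + 1 / n))"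
  have lim: "w f \<longlonglongrightarrow> 0" if "(\<lambda>n. E n (f n) / n) \<longlonglongrightarrow> 0" for f
  proof -
    have "w f \<longlonglongrightarrow> sqrt (\<bar>0\<bar> + 0)"
      unfolding w_def by (intro tendsto_intros that lim_const_over_n)
    then show ?thesis by simp
  qed
  have f: "w ?f \<longlonglongrightarrow> 0" and g: "w ?g \<longlonglongrightarrow> 0"
    by (intro lim negl_const_index negl_core_verts negl_core_edges; simp)+
  have markov: "E n (\<lambda>X. of_bool (\<not> h n X \<le> w h n * n)) \<le> w h n" if n: "good n" and h: "\<And>X. 0 \<le> h n X" for h n
  proof -
    have n0: "n > 0" using goodD(10)[OF n] .
    have pos: "w h n > 0" unfolding w_def using n0 by (simp add: add_nonneg_pos)
    have "E n (h n) / n \<le> \<bar>E n (h n) / n\<bar> + 1 / n"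
      by (rule order_trans[OF abs_ge_self]) simp
    then have sq: "E n (h n) / n \<le> (w h n)\<^sup>2" unfolding w_def by simp
    have "E n (\<lambda>X. of_bool (\<not> h n X \<le> w h n * n)) \<le> E n (h n) / (w h n * n)"
      using n0 pos h by (intro E_markov n) auto
    also have "\<dots> = (E n (h n) / n) / w h n" by simp
    also have "\<dots> \<le> (w h n)\<^sup>2 / w h n"
      using pos sq by (intro divide_right_mono) auto
    also have "\<dots> = w h n" using pos by (simp add: power2_eq_square)
    finally show ?thesis .
  qed
  let ?P = "\<lambda>n H. \<bar>real (card (verts (loose_core H))) - \<alpha> * real n\<bar> \<le> w ?f n * real n \<and>
             \<bar>real (card (edges (loose_core H))) - \<beta> * real n\<bar> \<le> w ?g n * real n"
  have "whp (\<lambda>n. random_hypergraph r n (p n)) ?P"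
    unfolding whp_def
  proof (rule tendsto_sandwich)
    show "(\<lambda>n. 1 - (w ?f n + w ?g n)) \<longlonglongrightarrow> 1"
      using tendsto_diff[OF tendsto_const tendsto_add[OF f g], of 1] by simp
    show "\<forall>\<^sub>F n in sequentially. 1 - (w ?f n + w ?g n) \<le> measure_pmf.prob (random_hypergraph r n (p n)) {x. ?P n x}"
      using eventually_good
    proof eventually_elim
      case (elim n)
      have "E n (\<lambda>X. 1 - (of_bool (\<not> ?f n X \<le> w ?f n * n) + of_bool (\<not> ?g n X \<le> w ?g n * n))) \<le>
          E n (\<lambda>X. of_bool (?P n ({1..n}, X)))"
      proof (rule E_mono[OF elim])
        fix X assume "X \<subseteq> rs n"
        then have "loose_core ({1..n}, X) = (\<Union>(core X), core X)"
          by (intro loose_core_eq) (auto simp: rsets_def)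
        then show "1 - (of_bool (\<not> ?f n X \<le> w ?f n * n) + of_bool (\<not> ?g n X \<le> w ?g n * n))
           \<le> (of_bool (?P n ({1..n}, X)) :: real)" by auto
      qed
      moreover have "E n (\<lambda>X. of_bool (\<not> ?f n X \<le> w ?f n * n)) \<le> w ?f n" "E n (\<lambda>X. of_bool (\<not> ?g n X \<le> w ?g n * n)) \<le> w ?g n"
        by (rule markov[OF elim]; simp)+
      ultimately show ?case unfolding prob_eq_E[OF elim] E_diff E_add E_const by linarith
    qed
    show "\<forall>\<^sub>F n in sequentially. measure_pmf.prob (random_hypergraph r n (p n)) {x. ?P n x} \<le> 1"
      by simp
  qed simp
  moreover have "w ?f \<in> o(\<lambda>_. 1)" "w ?g \<in> o(\<lambda>_. 1)"
    using f g by (auto intro!: smalloI_tendsto)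
  ultimately show ?thesis by blast
qed

end

theorem theorem1p5:
  fixes r :: nat and d \<alpha> \<beta> :: real and dn p :: "nat \<Rightarrow> real"
  assumes "r \<ge> 3" and "d > 0" and "dn \<longlonglongrightarrow> d"
    and "\<And>n. p n = dn n / real ((n - 1) choose (r - 1))"
    and "\<alpha> = rho_star r d * (1 - d * (real r - 1) * (1 - rho_star r d) ^ (r - 1))"
    and "\<beta> = d / real r *
           (1 - (1 - rho_star r d) ^ r - real r * rho_star r d * (1 - rho_star r d) ^ (r - 1))"
  shows "\<exists>\<epsilon> \<eta> :: nat \<Rightarrow> real. \<epsilon> \<in> o(\<lambda>_. 1) \<and> \<eta> \<in> o(\<lambda>_. 1) \<and>
    whp (\<lambda>n. random_hypergraph r n (p n))
      (\<lambda>n H. \<bar>real (card (verts (loose_core H))) - \<alpha> * real n\<bar> \<le> \<epsilon> n * real n \<and>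
             \<bar>real (card (edges (loose_core H))) - \<beta> * real n\<bar> \<le> \<eta> n * real n)"
proof -
  interpret S: sparse_hypergraph r d dn by unfold_locales (use assms in auto)
  have p: "p = S.p" using assms(4) by (auto simp: S.p_def fun_eq_iff)
  have "\<alpha> = S.\<alpha>" "\<beta> = S.\<beta>" using assms(5,6) by (simp_all add: S.alpha_eq S.beta_eq)
  then show ?thesis using S.core_sizes_whp unfolding p by simp
qed

end
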